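(* If $G$ is a special cubulated group, then its growth is either exponential or polynomial.
   Context: A special cubulated group is the fundamental group of a compact special cube complex, i.e. of a compact nonpositively curved cube complex that admits a local isometry into the Salvetti complex of some right-angled Artin group (the standard cube complex with one vertex, one loop per generator, and one $n$-torus for each $n$-clique of the defining graph). A growth function of $G$ is a function $g:\mathbb N\to\mathbb N$ with $g(n)$ the number of elements of $G$ at distance $n$ from the identity in the word metric of some finite generating set; its degree of growth (polynomial or exponential) does not depend on the generating set. *)

theory Defs
  imports
    "HOL-Analysis.Analysis"
    "HOL-Algebra.Generated_Groups"
    "HOL-Library.Landau_Symbols"
begin

section \<open>Cube complexes\<close>

text \<open>
  The cube with coordinate directions \<open>I\<close> is \<open>[0,1]\<^sup>I\<close>, realised inside \<open>nat \<Rightarrow> real\<close> by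
  filling the other coordinates with \<open>0\<close>. Labelling the directions by an arbitrary finite set
  rather than by an initial segment of the naturals lets the faces of a cube, and the tori of a
  Salvetti complex, keep their natural labels.
\<close>

definition cube :: "nat set \<Rightarrow> (nat \<Rightarrow> real) set" where
  "cube I = {t. (\<forall>i\<in>I. 0 \<le> t i \<and> t i \<le> 1) \<and> (\<forall>i. i \<notin> I \<longrightarrow> t i = 0)}"

definition open_cube :: "nat set \<Rightarrow> (nat \<Rightarrow> real) set" where
  "open_cube I = {t. (\<forall>i\<in>I. 0 < t i \<and> t i < 1) \<and> (\<forall>i. i \<notin> I \<longrightarrow> t i = 0)}"

definition cube_vertices :: "nat set \<Rightarrow> (nat \<Rightarrow> real) set" where
  "cube_vertices I = {t. (\<forall>i\<in>I. t i = 0 \<or> t i = 1) \<and> (\<forall>i. i \<notin> I \<longrightarrow> t i = 0)}"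

text \<open>
  The isometries between Euclidean unit cubes are the maps which permute the coordinates and
  reflect some of them. Here \<open>F\<close> is the set of reflected coordinates.
\<close>

definition cube_isometry :: "nat set \<Rightarrow> nat set \<Rightarrow> ((nat \<Rightarrow> real) \<Rightarrow> (nat \<Rightarrow> real)) \<Rightarrow> bool" where
  "cube_isometry I J h \<longleftrightarrow>
     (\<exists>\<pi> F. bij_betw \<pi> J I \<and>
        (\<forall>t\<in>cube I. h t =
           (\<lambda>j. if j \<in> J then (if j \<in> F then 1 - t (\<pi> j) else t (\<pi> j)) else 0)))"

text \<open>
  A cell is a finite set of directions together with a characteristic map, of which only the
  values on the cube matter. A cube complex is a space with the weak topology determined by its
  characteristic maps, in which every point lies in exactly one open cell, and in which each
  codimension-one face of a cube is attached to another cube of the complex by an isometry.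
  Cubes need not be embedded: faces of one cube may be identified with each other.
\<close>

type_synonym 'a cell = "nat set \<times> ((nat \<Rightarrow> real) \<Rightarrow> 'a)"

definition cube_complex :: "'a::topological_space set \<Rightarrow> 'a cell set \<Rightarrow> bool" where
  "cube_complex X \<Phi> \<longleftrightarrow>
     (\<forall>(I, \<phi>)\<in>\<Phi>. finite I \<and> continuous_on (cube I) \<phi> \<and> \<phi> ` cube I \<subseteq> X \<and> inj_on \<phi> (open_cube I)) \<and>
     (\<forall>x\<in>X. \<exists>!c. c \<in> \<Phi> \<and> x \<in> snd c ` open_cube (fst c)) \<and>
     (\<forall>(I, \<phi>)\<in>\<Phi>. \<forall>i\<in>I. \<forall>e\<in>{0, 1}. \<exists>(J, \<psi>)\<in>\<Phi>. \<exists>h. cube_isometry (I - {i}) J h \<and>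
        (\<forall>t\<in>cube (I - {i}). \<phi> (t(i := e)) = \<psi> (h t))) \<and>
     (\<forall>A\<subseteq>X. closedin (top_of_set X) A \<longleftrightarrow>
        (\<forall>(I, \<phi>)\<in>\<Phi>. closedin (top_of_set (cube I)) {t \<in> cube I. \<phi> t \<in> A}))"

definition complex_vertices :: "'a cell set \<Rightarrow> 'a set" where
  "complex_vertices \<Phi> = {\<phi> (\<lambda>_. 0) | \<phi>. ({}, \<phi>) \<in> \<Phi>}"


section \<open>Links and nonpositive curvature\<close>

text \<open>
  The vertices of the link of \<open>x\<close> are the oriented edges issuing from \<open>x\<close>, parametrised from
  \<open>x\<close> at unit speed; an edge which is a loop at \<open>x\<close> contributes two of them. Each corner at \<open>x\<close>
  of an \<open>n\<close>-cube contributes the \<open>(n - 1)\<close>-simplex spanned by the \<open>n\<close> oriented edges of the cube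
  issuing from that corner.
\<close>

definition out_edge :: "((nat \<Rightarrow> real) \<Rightarrow> 'a) \<Rightarrow> (nat \<Rightarrow> real) \<Rightarrow> nat \<Rightarrow> real \<Rightarrow> 'a" where
  "out_edge \<phi> v i = restrict (\<lambda>s. \<phi> (v(i := \<bar>v i - s\<bar>))) {0..1}"

definition corners :: "'a cell set \<Rightarrow> 'a \<Rightarrow> ('a cell \<times> (nat \<Rightarrow> real)) set" where
  "corners \<Phi> x = {((I, \<phi>), v). (I, \<phi>) \<in> \<Phi> \<and> v \<in> cube_vertices I \<and> \<phi> v = x}"

definition corner_simplex :: "'a cell \<times> (nat \<Rightarrow> real) \<Rightarrow> (real \<Rightarrow> 'a) set" where
  "corner_simplex = (\<lambda>((I, \<phi>), v). out_edge \<phi> v ` I)"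

definition link_simplices :: "'a cell set \<Rightarrow> 'a \<Rightarrow> (real \<Rightarrow> 'a) set set" where
  "link_simplices \<Phi> x = corner_simplex ` corners \<Phi> x"

definition link_vertices :: "'a cell set \<Rightarrow> 'a \<Rightarrow> (real \<Rightarrow> 'a) set" where
  "link_vertices \<Phi> x = \<Union> (link_simplices \<Phi> x)"

text \<open>
  In general a link is only a complex of simplices: a simplex may have repeated vertices, and
  several simplices may have the same vertices. It is simplicial if neither happens.
\<close>

definition simplicial_link :: "'a cell set \<Rightarrow> 'a \<Rightarrow> bool" where
  "simplicial_link \<Phi> x \<longleftrightarrow>
     (\<forall>((I, \<phi>), v)\<in>corners \<Phi> x. inj_on (out_edge \<phi> v) I) \<and>
     inj_on corner_simplex (corners \<Phi> x)"

definition flag_link :: "'a cell set \<Rightarrow> 'a \<Rightarrow> bool" where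
  "flag_link \<Phi> x \<longleftrightarrow>
     (\<forall>A. finite A \<longrightarrow> A \<subseteq> link_vertices \<Phi> x \<longrightarrow>
        (\<forall>a\<in>A. \<forall>b\<in>A. a \<noteq> b \<longrightarrow> {a, b} \<in> link_simplices \<Phi> x) \<longrightarrow>
        A \<in> link_simplices \<Phi> x)"

definition nonpositively_curved :: "'a::topological_space set \<Rightarrow> 'a cell set \<Rightarrow> bool" where
  "nonpositively_curved X \<Phi> \<longleftrightarrow>
     cube_complex X \<Phi> \<and> (\<forall>x\<in>complex_vertices \<Phi>. simplicial_link \<Phi> x \<and> flag_link \<Phi> x)"


section \<open>Local isometries\<close>

definition cubical_map ::
  "'a::topological_space set \<Rightarrow> 'a cell set \<Rightarrow> 'b::topological_space set \<Rightarrow> 'b cell set \<Rightarrow> ('a \<Rightarrow> 'b) \<Rightarrow> bool"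
  where
  "cubical_map X \<Phi> Y \<Psi> f \<longleftrightarrow>
     continuous_on X f \<and> f ` X \<subseteq> Y \<and>
     (\<forall>(I, \<phi>)\<in>\<Phi>. \<exists>(J, \<psi>)\<in>\<Psi>. \<exists>h. cube_isometry I J h \<and> (\<forall>t\<in>cube I. f (\<phi> t) = \<psi> (h t)))"

definition link_map :: "('a \<Rightarrow> 'b) \<Rightarrow> (real \<Rightarrow> 'a) \<Rightarrow> real \<Rightarrow> 'b" where
  "link_map f \<alpha> = restrict (f \<circ> \<alpha>) {0..1}"

text \<open>
  A cubical map of nonpositively curved cube complexes is a local isometry if it embeds the link
  of each vertex as a full subcomplex of the link of the image vertex.
\<close>

definition local_isometry ::
  "'a::topological_space set \<Rightarrow> 'a cell set \<Rightarrow> 'b::topological_space set \<Rightarrow> 'b cell set \<Rightarrow> ('a \<Rightarrow> 'b) \<Rightarrow> bool"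
  where
  "local_isometry X \<Phi> Y \<Psi> f \<longleftrightarrow>
     cubical_map X \<Phi> Y \<Psi> f \<and>
     (\<forall>x\<in>complex_vertices \<Phi>.
        inj_on (link_map f) (link_vertices \<Phi> x) \<and>
        (\<forall>B\<in>link_simplices \<Psi> (f x). B \<subseteq> link_map f ` link_vertices \<Phi> x \<longrightarrow>
           (\<exists>A\<in>link_simplices \<Phi> x. link_map f ` A = B)))"


section \<open>Salvetti complexes\<close>

text \<open>
  Every finite simple graph is isomorphic to one whose vertices are natural numbers.
\<close>

definition finite_simple_graph :: "nat set \<Rightarrow> nat set set \<Rightarrow> bool" where
  "finite_simple_graph V E \<longleftrightarrow> finite V \<and> (\<forall>e\<in>E. e \<subseteq> V \<and> card e = 2)"

definition clique :: "nat set \<Rightarrow> nat set set \<Rightarrow> nat set \<Rightarrow> bool" where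
  "clique V E \<sigma> \<longleftrightarrow> \<sigma> \<subseteq> V \<and> (\<forall>u\<in>\<sigma>. \<forall>v\<in>\<sigma>. u \<noteq> v \<longrightarrow> {u, v} \<in> E)"

text \<open>
  The Salvetti complex of the right-angled Artin group with defining graph \<open>(V, E)\<close>, as the
  union of the coordinate subtori, one for each clique, of the torus with one circle factor for
  each vertex. The empty clique gives the unique vertex. On the cube with directions \<open>\<sigma>\<close> the
  map below wraps the cube once around the torus of \<open>\<sigma>\<close> and is constantly \<open>1\<close> in the other
  coordinates.
\<close>

definition salvetti :: "nat set \<Rightarrow> nat set set \<Rightarrow> (nat \<Rightarrow> complex) set" where
  "salvetti V E = {z. (\<forall>v. cmod (z v) = 1) \<and> clique V E {v. z v \<noteq> 1}}"

definition torus_map :: "(nat \<Rightarrow> real) \<Rightarrow> nat \<Rightarrow> complex" where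
  "torus_map t = (\<lambda>v. cis (2 * pi * t v))"

definition salvetti_cells :: "nat set \<Rightarrow> nat set set \<Rightarrow> (nat \<Rightarrow> complex) cell set" where
  "salvetti_cells V E = {(\<sigma>, torus_map) | \<sigma>. clique V E \<sigma>}"

definition special_cube_complex :: "'a::topological_space set \<Rightarrow> 'a cell set \<Rightarrow> bool" where
  "special_cube_complex X \<Phi> \<longleftrightarrow>
     nonpositively_curved X \<Phi> \<and>
     (\<exists>V E f. finite_simple_graph V E \<and>
        local_isometry X \<Phi> (salvetti V E) (salvetti_cells V E) f)"


section \<open>The fundamental group\<close>

definition path_class :: "'a::topological_space set \<Rightarrow> (real \<Rightarrow> 'a) \<Rightarrow> (real \<Rightarrow> 'a) set" where
  "path_class X p = {q. homotopic_paths X p q}"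

definition fundamental_group :: "'a::topological_space set \<Rightarrow> 'a \<Rightarrow> (real \<Rightarrow> 'a) set monoid" where
  "fundamental_group X x =
     \<lparr>carrier = {path_class X p | p.
        path p \<and> path_image p \<subseteq> X \<and> pathstart p = x \<and> pathfinish p = x},
      mult = (\<lambda>A B. \<Union>p\<in>A. \<Union>q\<in>B. path_class X (p +++ q)),
      one = path_class X (\<lambda>_. x)\<rparr>"

text \<open>
  The first argument only records the type in which the underlying space of the cube complex is
  taken.
\<close>

definition special_cubulated_group ::
  "'a::topological_space itself \<Rightarrow> ('g, 'm) monoid_scheme \<Rightarrow> bool" where
  "special_cubulated_group T G \<longleftrightarrow>
     group G \<and>
     (\<exists>(X :: 'a set) \<Phi> x. special_cube_complex X \<Phi> \<and> compact X \<and> x \<in> X \<and>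
        G \<cong> fundamental_group X x)"


section \<open>Growth\<close>

definition finite_generating_set :: "('g, 'm) monoid_scheme \<Rightarrow> 'g set \<Rightarrow> bool" where
  "finite_generating_set G S \<longleftrightarrow> finite S \<and> S \<subseteq> carrier G \<and> generate G S = carrier G"

text \<open>The distance from the identity in the word metric of \<open>S\<close>.\<close>

definition word_length :: "('g, 'm) monoid_scheme \<Rightarrow> 'g set \<Rightarrow> 'g \<Rightarrow> nat" where
  "word_length G S g =
     (LEAST n. \<exists>w. length w = n \<and> set w \<subseteq> S \<union> m_inv G ` S \<and> foldr (mult G) w (one G) = g)"

definition growth_function :: "('g, 'm) monoid_scheme \<Rightarrow> 'g set \<Rightarrow> nat \<Rightarrow> nat" where
  "growth_function G S n = card {g \<in> carrier G. word_length G S g = n}"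

text \<open>
  Growth functions are at most exponential, so exponential growth only asks for a lower bound;
  polynomial growth asks for an upper bound. Both are required for every finite generating set.
\<close>

definition exponential_growth :: "('g, 'm) monoid_scheme \<Rightarrow> bool" where
  "exponential_growth G \<longleftrightarrow>
     (\<exists>S. finite_generating_set G S) \<and>
     (\<forall>S. finite_generating_set G S \<longrightarrow>
        (\<exists>a>1. (\<lambda>n. real (growth_function G S n)) \<in> \<Omega>(\<lambda>n. a ^ n)))"

definition polynomial_growth :: "('g, 'm) monoid_scheme \<Rightarrow> bool" where
  "polynomial_growth G \<longleftrightarrow>
     (\<exists>S. finite_generating_set G S) \<and>
     (\<forall>S. finite_generating_set G S \<longrightarrow>
        (\<exists>d. (\<lambda>n. real (growth_function G S n)) \<in> O(\<lambda>n. real n ^ d)))"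

end

theory Submission
  imports Defs
begin

text \<open>
  Let \<open>X\<close> be a compact special cube complex with a local isometry \<open>f\<close> into a Salvetti complex.
  Then \<open>f\<close> labels every oriented edge of \<open>X\<close> by a generator of the right-angled Artin group or the
  inverse of one. Since \<open>f\<close> is injective on links, an edge path is determined by its first vertex
  and the word formed by its labels, and the elements of the fundamental group can be described by
  the words which can be read along loops at a fixed vertex.

  These words can be brought into normal form inside \<open>X\<close>. If two consecutive labels commute, the
  image of the link being a full subcomplex provides a square of \<open>X\<close>, across which the two edges
  can be exchanged (\<open>square_swap\<close>); if two consecutive labels are inverse to each other, the path
  backtracks. So every edge path is homotopic to one whose label word is the lexicographic normal
  form of the original label word (\<open>ex_normal_form\<close>). Conversely, homotopic edge paths have label
  words which represent the same element of the Artin group (\<open>homotopic_reads_act_equally\<close>) and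
  therefore the same normal form (\<open>normal_unique\<close>). Thus the fundamental group is in bijection
  with the normal words that can be read along loops, and these are recognised by a finite
  automaton: its states are the pairs of a vertex of \<open>X\<close> and a set of letters that must not follow.

  For a finite deterministic automaton there are two possibilities (\<open>automaton_dichotomy\<close>). Either
  a reachable state has two different loops \<open>u\<close> and \<open>v\<close> of the same length. If \<open>t\<close> leads to this
  state, then the elements \<open>t u t\<^sup>-\<^sup>1\<close> and \<open>t v t\<^sup>-\<^sup>1\<close> of the group have \<open>2\<^sup>n\<close> different products
  of \<open>n\<close> factors, and the growth is exponential. Or a run is determined by a bounded number
  of letters and lengths, so that there are only polynomially many normal words of length \<open>n\<close>. As
  bringing a word into normal form does not make it longer, the growth is then polynomial.

  Two facts from topology connect this with homotopy classes of arbitrary paths. First, every path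
  in \<open>X\<close> is homotopic to an edge path (\<open>path_edge_approximable\<close>), because every point has an open
  neighbourhood which contracts to it along segments in cubes. Secondly, the element of the Artin
  group which is read along a path is invariant under homotopies: a path in the Salvetti complex
  contributes the generator \<open>v\<close> or its inverse whenever its coordinate \<open>v\<close> passes through \<open>-1\<close>, and
  locally the contribution of a path depends only on its end points.
\<close>

section \<open>Deterministic partial automata\<close>

primrec run :: "('q \<Rightarrow> 'l \<Rightarrow> 'q option) \<Rightarrow> 'q \<Rightarrow> 'l list \<Rightarrow> 'q option" where
  "run \<delta> q [] = Some q"
| "run \<delta> q (a # w) = (case \<delta> q a of None \<Rightarrow> None | Some r \<Rightarrow> run \<delta> r w)"

lemma run_append:
  "run \<delta> q (u @ w) = (case run \<delta> q u of None \<Rightarrow> None | Some r \<Rightarrow> run \<delta> r w)"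
  by (induction u arbitrary: q) (auto split: option.splits)

definition restrict_automaton :: "('q \<Rightarrow> 'l \<Rightarrow> 'q option) \<Rightarrow> 'q set \<Rightarrow> 'q \<Rightarrow> 'l \<Rightarrow> 'q option" where
  "restrict_automaton \<delta> P q a =
     (case \<delta> q a of None \<Rightarrow> None | Some r \<Rightarrow> if r \<in> P then Some r else None)"

lemma run_restrict_imp: "run (restrict_automaton \<delta> P) q w = Some r \<Longrightarrow> run \<delta> q w = Some r"
  by (induction w arbitrary: q)
     (auto simp: restrict_automaton_def split: option.splits if_splits)

text \<open>
  After its last visit to \<open>p\<close> a run stays inside the automaton from which \<open>p\<close> has been removed.
\<close>

lemma run_avoiding:
  assumes "run \<delta> q w \<noteq> None" "q \<in> P"
    and closed: "\<And>q a r. q \<in> P \<Longrightarrow> \<delta> q a = Some r \<Longrightarrow> r \<in> P"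
    and avoid: "\<And>u v. w = u @ v \<Longrightarrow> u \<noteq> [] \<Longrightarrow> run \<delta> q u \<noteq> Some p"
  shows "run (restrict_automaton \<delta> (P - {p})) q w \<noteq> None"
  using assms(1,2) avoid
proof (induction w arbitrary: q)
  case (Cons a w)
  then obtain r where r: "\<delta> q a = Some r" by (auto split: option.splits)
  have "r \<noteq> p" using Cons.prems(3)[of "[a]" w] r by auto
  moreover have "r \<in> P" using closed Cons.prems r by blast
  moreover have "run (restrict_automaton \<delta> (P - {p})) r w \<noteq> None"
  proof (rule Cons.IH)
    show "run \<delta> r w \<noteq> None" using Cons.prems r by simp
    show "r \<in> P" by fact
    fix u v assume "w = u @ v" "u \<noteq> []"
    then show "run \<delta> r u \<noteq> Some p" using Cons.prems(3)[of "a # u" v] r by auto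
  qed
  moreover from calculation have "restrict_automaton \<delta> (P - {p}) q a = Some r"
    using r by (simp add: restrict_automaton_def)
  ultimately show ?case by simp
qed simp

text \<open>
  Cut a run that starts in \<open>q\<close> at its last visit to \<open>q\<close>. The first part is a loop, which by
  assumption is determined by its length; the second part is empty or consists of a letter and a
  run that avoids \<open>q\<close>. So the removal of one state from the automaton costs a factor linear in \<open>n\<close>,
  and the bound follows by induction on the number of states.
\<close>

lemma polynomially_many_runs:
  assumes "finite P" "finite \<Sigma>"
    and "\<And>q a r. q \<in> P \<Longrightarrow> \<delta> q a = Some r \<Longrightarrow> r \<in> P \<and> a \<in> \<Sigma>"
    and "\<And>q u v. q \<in> P \<Longrightarrow> run \<delta> q u = Some q \<Longrightarrow> run \<delta> q v = Some q \<Longrightarrow>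
           length u = length v \<Longrightarrow> u = v"
  shows "\<exists>K d. \<forall>q\<in>P. \<forall>n. finite {w. length w \<le> n \<and> run \<delta> q w \<noteq> None} \<and>
           card {w. length w \<le> n \<and> run \<delta> q w \<noteq> None} \<le> K * (n + 1) ^ d"
  using assms
proof (induction "card P" arbitrary: P \<delta>)
  case 0
  then show ?case by auto
next
  case (Suc N)
  have "\<exists>K d. \<forall>n. finite {w. length w \<le> n \<and> run \<delta> q w \<noteq> None} \<and>
           card {w. length w \<le> n \<and> run \<delta> q w \<noteq> None} \<le> K * (n + 1) ^ d" if q: "q \<in> P" for q
  proof -
    let ?\<delta> = "restrict_automaton \<delta> (P - {q})"
    have "\<exists>K d. \<forall>r\<in>P-{q}. \<forall>n. finite {w. length w \<le> n \<and> run ?\<delta> r w \<noteq> None} \<and>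
           card {w. length w \<le> n \<and> run ?\<delta> r w \<noteq> None} \<le> K * (n + 1) ^ d"
    proof (rule Suc.hyps)
      show "N = card (P - {q})" using Suc.hyps(2) q Suc.prems(1) by simp
      show "finite (P - {q})" using Suc.prems by simp
      show "finite \<Sigma>" by fact
      fix p a r assume "p \<in> P - {q}" "?\<delta> p a = Some r"
      then show "r \<in> P - {q} \<and> a \<in> \<Sigma>" using Suc.prems(3)[of p a]
        by (auto simp: restrict_automaton_def split: option.splits if_splits)
    next
      fix p u v assume "p \<in> P - {q}" "run ?\<delta> p u = Some p" "run ?\<delta> p v = Some p" "length u = length v"
      then show "u = v" using Suc.prems(4)[of p u v] run_restrict_imp by (metis DiffD1)
    qed
    then obtain K d where Kd: "\<And>r n. r \<in> P - {q} \<Longrightarrow> finite {w. length w \<le> n \<and> run ?\<delta> r w \<noteq> None} \<and>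
           card {w. length w \<le> n \<and> run ?\<delta> r w \<noteq> None} \<le> K * (n + 1) ^ d" by blast
    define loop where "loop l = (SOME u. run \<delta> q u = Some q \<and> length u = l)" for l
    have loop: "loop (length u) = u" if "run \<delta> q u = Some q" for u
      unfolding loop_def
      by (rule some_equality) (use that Suc.prems(4)[OF q] in auto)
    define tails where "tails n = insert [] (\<Union>a\<in>\<Sigma>. case \<delta> q a of None \<Rightarrow> {}
        | Some r \<Rightarrow> if r = q then {} else (#) a ` {w. length w \<le> n \<and> run ?\<delta> r w \<noteq> None})" for n
    have tails: "finite (tails n) \<and> card (tails n) \<le> 1 + card \<Sigma> * (K * (n + 1) ^ d)" for n
    proof -
      have f: "finite (case \<delta> q a of None \<Rightarrow> {} | Some r \<Rightarrow> if r = q then {} else (#) a ` {w. length w \<le> n \<and> run ?\<delta> r w \<noteq> None})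
        \<and> card (case \<delta> q a of None \<Rightarrow> {} | Some r \<Rightarrow> if r = q then {} else (#) a ` {w. length w \<le> n \<and> run ?\<delta> r w \<noteq> None}) \<le> K * (n + 1) ^ d"
        for a
      proof (cases "\<delta> q a")
        case (Some r)
        show ?thesis
        proof (cases "r = q")
          case False
          then have "r \<in> P - {q}" using Suc.prems(3)[OF q Some] by auto
          from Kd[OF this, of n] show ?thesis using Some False by (simp add: card_image)
        qed (simp add: Some)
      qed simp
      show ?thesis unfolding tails_def
        apply (intro conjI)
        subgoal using f Suc.prems(2) by blast
        subgoal
          apply (rule order_trans[OF eq_refl[OF card_insert_if]])
          subgoal using f Suc.prems(2) by blast
          apply (rule order_trans[where y = "Suc (card (\<Union>a\<in>\<Sigma>. case \<delta> q a of None \<Rightarrow> {}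
        | Some r \<Rightarrow> if r = q then {} else (#) a ` {w. length w \<le> n \<and> run ?\<delta> r w \<noteq> None}))"])
           apply simp
          apply (simp only: plus_1_eq_Suc Suc_le_mono)
          apply (rule order_trans[OF card_UN_le[OF Suc.prems(2)]])
          apply (rule order_trans[OF sum_bounded_above[where K = "K * (n + 1) ^ d"]])
          using f by auto
        done
    qed
    have sub: "{w. length w \<le> n \<and> run \<delta> q w \<noteq> None} \<subseteq> (\<lambda>(l, v). loop l @ v) ` ({..n} \<times> tails n)" for n
    proof
      fix w assume w: "w \<in> {w. length w \<le> n \<and> run \<delta> q w \<noteq> None}"
      \<comment> \<open>split \<open>w\<close> at the last visit of its run to \<open>q\<close>\<close>
      let ?I = "{k. k \<le> length w \<and> run \<delta> q (take k w) = Some q}"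
      have "0 \<in> ?I" and fin: "finite ?I" by auto
      then have M: "Max ?I \<in> ?I" using Max_in[OF fin] by blast
      have Mx: "\<And>k. k \<in> ?I \<Longrightarrow> k \<le> Max ?I" using Max_ge[OF fin] by blast
      define k where "k = Max ?I"
      have k: "k \<le> length w" "run \<delta> q (take k w) = Some q" using M by (auto simp: k_def)
      have eq: "w = loop k @ drop k w" using loop[OF k(2)] k(1) by (metis append_take_drop_id length_take min.absorb2)
      have "drop k w \<in> tails n"
      proof (cases "drop k w")
        case Nil then show ?thesis by (simp add: tails_def)
      next
        case (Cons a v)
        have run: "run \<delta> q (drop k w) \<noteq> None"
          using w k run_append[of \<delta> q "take k w" "drop k w"] by auto
        then obtain r where r: "\<delta> q a = Some r" using Cons by (auto split: option.splits)
        have last: "run \<delta> r u \<noteq> Some q" if "v = u @ u'" for u u'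
        proof
          assume "run \<delta> r u = Some q"
          then have "run \<delta> q (take k w @ a # u) = Some q" using k r run_append by (metis option.simps(5) run.simps(2))
          moreover have "take (k + 1 + length u) w = take k w @ a # u"
            using Cons that k(1) by (metis (no_types, lifting) add.assoc append_eq_conv_conj append_Cons length_Cons plus_1_eq_Suc take_add)
          moreover have "k + 1 + length u \<le> length w"
            using arg_cong[OF Cons, of length] that by simp
          ultimately have "k + 1 + length u \<in> ?I" by simp
          from Mx[OF this] show False by (simp add: k_def)
        qed
        have rq: "r \<noteq> q" using last[of "[]" v] by simp
        have ra: "run ?\<delta> r v \<noteq> None"
        proof (rule run_avoiding)
          show "run \<delta> r v \<noteq> None" using run Cons r by simp
          show "r \<in> P" using Suc.prems(3)[OF q r] by simp
          show "\<And>q a r. q \<in> P \<Longrightarrow> \<delta> q a = Some r \<Longrightarrow> r \<in> P" using Suc.prems(3) by blast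
          show "\<And>u u'. v = u @ u' \<Longrightarrow> u \<noteq> [] \<Longrightarrow> run \<delta> r u \<noteq> Some q" using last by blast
        qed
        have "length w \<le> n" using w by blast
        then have rl: "length v \<le> n" using arg_cong[OF Cons, of length] by simp
        have "a # v \<in> (#) a ` {w. length w \<le> n \<and> run ?\<delta> r w \<noteq> None}" using ra rl by blast
        moreover have "(case \<delta> q a of None \<Rightarrow> {}
            | Some r \<Rightarrow> if r = q then {} else (#) a ` {w. length w \<le> n \<and> run ?\<delta> r w \<noteq> None})
          = (#) a ` {w. length w \<le> n \<and> run ?\<delta> r w \<noteq> None}"
          by (simp only: r option.case rq if_False)
        moreover have "a \<in> \<Sigma>" using Suc.prems(3)[OF q r] by blast
        ultimately show ?thesis unfolding Cons tails_def by (metis (no_types, lifting) UN_I insertI2)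
      qed
      moreover have "k \<le> n" using k(1) w by auto
      ultimately have "(k, drop k w) \<in> {..n} \<times> tails n" by simp
      moreover have "w = (\<lambda>(l, v). loop l @ v) (k, drop k w)" unfolding prod.case by (rule eq)
      ultimately show "w \<in> (\<lambda>(l, v). loop l @ v) ` ({..n} \<times> tails n)" by (rule rev_image_eqI)
    qed
    have "finite {w. length w \<le> n \<and> run \<delta> q w \<noteq> None} \<and>
           card {w. length w \<le> n \<and> run \<delta> q w \<noteq> None} \<le> (1 + card \<Sigma> * K) * (n + 1) ^ (d + 1)" for n
    proof -
      have fin: "finite ((\<lambda>(l, v). loop l @ v) ` ({..n} \<times> tails n))" using tails by blast
      have "card ((\<lambda>(l, v). loop l @ v) ` ({..n} \<times> tails n)) \<le> card ({..n} \<times> tails n)"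
        by (rule card_image_le) (use tails in blast)
      also have "\<dots> = (n + 1) * card (tails n)" by (simp add: card_cartesian_product)
      also have "\<dots> \<le> (n + 1) * (1 * (n + 1) ^ d + card \<Sigma> * (K * (n + 1) ^ d))"
        by (intro mult_left_mono order_trans[OF conjunct2[OF tails]] add_mono mult_mono) auto
      also have "\<dots> = (1 + card \<Sigma> * K) * (n + 1) ^ (d + 1)" by (simp add: algebra_simps)
      finally show ?thesis using card_mono[OF fin sub] finite_subset[OF sub fin] by linarith
    qed
    then show ?thesis by blast
  qed
  then have "\<forall>q\<in>P. \<exists>Kd. \<forall>n. finite {w. length w \<le> n \<and> run \<delta> q w \<noteq> None} \<and>
           card {w. length w \<le> n \<and> run \<delta> q w \<noteq> None} \<le> fst Kd * (n + 1) ^ snd Kd" by simp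
  then obtain Kd where Kd: "\<forall>q\<in>P. \<forall>n. finite {w. length w \<le> n \<and> run \<delta> q w \<noteq> None} \<and>
           card {w. length w \<le> n \<and> run \<delta> q w \<noteq> None} \<le> fst (Kd q) * (n + 1) ^ snd (Kd q)"
    by (elim bchoice[elim_format] exE)
  have le: "fst (Kd q) * (n + 1) ^ snd (Kd q) \<le> (\<Sum>q\<in>P. fst (Kd q)) * (n + 1) ^ (\<Sum>q\<in>P. snd (Kd q))"
    if "q \<in> P" for q n
  proof (rule mult_mono)
    show "fst (Kd q) \<le> (\<Sum>q\<in>P. fst (Kd q))" using that Suc.prems(1) by (intro member_le_sum) auto
    have "snd (Kd q) \<le> (\<Sum>q\<in>P. snd (Kd q))" using that Suc.prems(1) by (intro member_le_sum) auto
    then show "(n + 1) ^ snd (Kd q) \<le> (n + 1) ^ (\<Sum>q\<in>P. snd (Kd q))" by (intro power_increasing) auto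
  qed auto
  show ?case
  proof (intro exI ballI allI conjI)
    fix q n assume q: "q \<in> P"
    show "finite {w. length w \<le> n \<and> run \<delta> q w \<noteq> None}" using Kd q by blast
    show "card {w. length w \<le> n \<and> run \<delta> q w \<noteq> None}
        \<le> (\<Sum>q\<in>P. fst (Kd q)) * (n + 1) ^ (\<Sum>q\<in>P. snd (Kd q))"
      using Kd q le[OF q, of n] order_trans by blast
  qed
qed

text \<open>
  Loops can only be used if their state is reachable from \<open>q0\<close>, so the polynomial bound is
  applied to the automaton formed by the reachable states.
\<close>

lemma automaton_dichotomy:
  assumes fin: "finite Q" "finite \<Sigma>" and q0: "q0 \<in> Q"
    and closed: "\<And>q a r. q \<in> Q \<Longrightarrow> \<delta> q a = Some r \<Longrightarrow> r \<in> Q \<and> a \<in> \<Sigma>"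
  shows "(\<exists>t q u v. run \<delta> q0 t = Some q \<and> run \<delta> q u = Some q \<and> run \<delta> q v = Some q \<and>
            length u = length v \<and> u \<noteq> v) \<or>
         (\<exists>K d. \<forall>n. finite {w. length w \<le> n \<and> run \<delta> q0 w \<noteq> None} \<and>
            card {w. length w \<le> n \<and> run \<delta> q0 w \<noteq> None} \<le> K * (n + 1) ^ d)"
proof (cases "\<exists>t q u v. run \<delta> q0 t = Some q \<and> run \<delta> q u = Some q \<and> run \<delta> q v = Some q \<and>
            length u = length v \<and> u \<noteq> v")
  case none: False
  let ?P = "{q \<in> Q. \<exists>t. run \<delta> q0 t = Some q}"
  have "\<exists>K d. \<forall>q\<in>?P. \<forall>n. finite {w. length w \<le> n \<and> run \<delta> q w \<noteq> None} \<and>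
           card {w. length w \<le> n \<and> run \<delta> q w \<noteq> None} \<le> K * (n + 1) ^ d"
  proof (rule polynomially_many_runs)
    show "finite ?P" "finite \<Sigma>" using fin by auto
    fix q a r assume "q \<in> ?P" and r: "\<delta> q a = Some r"
    then obtain t where "run \<delta> q0 t = Some q" "q \<in> Q" by auto
    then have "run \<delta> q0 (t @ [a]) = Some r" using r by (simp add: run_append)
    then show "r \<in> ?P \<and> a \<in> \<Sigma>" using closed[OF \<open>q \<in> Q\<close> r] by blast
  qed (use none in blast)
  moreover have "q0 \<in> ?P" using q0 by (auto intro: exI[of _ "[]"])
  ultimately show ?thesis by blast
qed blast

section \<open>Word metrics and growth\<close>

context group
begin

abbreviation letters_of :: "'a set \<Rightarrow> 'a set" where
  "letters_of S \<equiv> S \<union> m_inv G ` S"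

abbreviation word_value :: "'a list \<Rightarrow> 'a" where
  "word_value w \<equiv> foldr (mult G) w (one G)"

lemma word_value_closed: "set w \<subseteq> carrier G \<Longrightarrow> word_value w \<in> carrier G"
  by (induction w) auto

lemma word_value_append:
  "set u \<subseteq> carrier G \<Longrightarrow> set w \<subseteq> carrier G \<Longrightarrow> word_value (u @ w) = word_value u \<otimes> word_value w"
  by (induction u) (auto simp: m_assoc word_value_closed)

lemma letters_of_subset:
  "finite_generating_set G S \<Longrightarrow> letters_of S \<subseteq> carrier G"
  by (auto simp: finite_generating_set_def)

lemma ex_word:
  assumes S: "finite_generating_set G S" and x: "x \<in> carrier G"
  shows "\<exists>w. set w \<subseteq> letters_of S \<and> word_value w = x"
proof -
  have SG: "S \<subseteq> carrier G" using S by (simp add: finite_generating_set_def)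
  have "x \<in> generate G S" using S x by (simp add: finite_generating_set_def)
  then show ?thesis
  proof (induction rule: generate.induct)
    case one
    show ?case by (rule exI[of _ "[]"]) simp
  next
    case (incl h)
    then show ?case using SG by (intro exI[of _ "[h]"]) auto
  next
    case (inv h)
    then show ?case using SG by (intro exI[of _ "[inv h]"]) auto
  next
    case (eng h1 h2)
    then obtain u w where "set u \<subseteq> letters_of S" "word_value u = h1"
      "set w \<subseteq> letters_of S" "word_value w = h2" by blast
    moreover from this have "set u \<subseteq> carrier G" "set w \<subseteq> carrier G"
      using letters_of_subset[OF S] by auto
    ultimately have "set (u @ w) \<subseteq> letters_of S \<and> word_value (u @ w) = h1 \<otimes> h2"
      by (simp add: word_value_append del: foldr_append)
    then show ?case by blast
  qed
qed

lemma word_length_word: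
  assumes S: "finite_generating_set G S" and x: "x \<in> carrier G"
  obtains w where "length w = word_length G S x" "set w \<subseteq> letters_of S" "word_value w = x"
proof -
  obtain w where "set w \<subseteq> letters_of S \<and> word_value w = x" using ex_word[OF S x] by blast
  then have "\<exists>n w. length w = n \<and> set w \<subseteq> letters_of S \<and> word_value w = x" by blast
  from LeastI_ex[OF this] show ?thesis using that unfolding word_length_def by blast
qed

lemma word_length_le:
  assumes "set w \<subseteq> letters_of S" "word_value w = x"
  shows "word_length G S x \<le> length w"
  unfolding word_length_def by (rule Least_le) (use assms in blast)

lemma word_length_one: "word_length G S \<one> = 0"
  using word_length_le[of "[]" S \<one>] by simp

lemma word_length_mult:
  assumes S: "finite_generating_set G S" and "x \<in> carrier G" "y \<in> carrier G"
  shows "word_length G S (x \<otimes> y) \<le> word_length G S x + word_length G S y"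
proof -
  obtain u w where "length u = word_length G S x" "set u \<subseteq> letters_of S" "word_value u = x"
    "length w = word_length G S y" "set w \<subseteq> letters_of S" "word_value w = y"
    using word_length_word[OF S] assms(2,3) by metis
  then show ?thesis using word_length_le[of "u @ w" S "x \<otimes> y"] letters_of_subset[OF S]
    by (auto simp: word_value_append simp del: foldr_append)
qed

definition sphere :: "'a set \<Rightarrow> nat \<Rightarrow> 'a set" where
  "sphere S n = {x \<in> carrier G. word_length G S x = n}"

lemma growth_function_eq: "growth_function G S n = card (sphere S n)"
  by (simp add: growth_function_def sphere_def)

lemma finite_sphere:
  assumes S: "finite_generating_set G S"
  shows "finite (sphere S n)"
proof (rule finite_subset)
  show "sphere S n \<subseteq> word_value ` {w. set w \<subseteq> letters_of S \<and> length w = n}"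
  proof
    fix x assume "x \<in> sphere S n"
    then have x: "x \<in> carrier G" "word_length G S x = n" by (auto simp: sphere_def)
    obtain w where "length w = n" "set w \<subseteq> letters_of S" "word_value w = x"
      using word_length_word[OF S x(1)] x(2) by blast
    then show "x \<in> word_value ` {w. set w \<subseteq> letters_of S \<and> length w = n}" by blast
  qed
  show "finite (word_value ` {w. set w \<subseteq> letters_of S \<and> length w = n})"
    using S by (intro finite_imageI finite_lists_length_eq) (auto simp: finite_generating_set_def)
qed

lemma card_sphere_0: 
  assumes S: "finite_generating_set G S"
  shows "card (sphere S 0) = 1"
proof -
  have "x = \<one>" if x: "x \<in> carrier G" "word_length G S x = 0" for x
  proof -
    obtain w where "length w = 0" "word_value w = x"
      using word_length_word[OF S x(1)] x(2) by metis
    then show ?thesis by simp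
  qed
  then have "sphere S 0 = {\<one>}" by (auto simp: sphere_def word_length_one)
  then show ?thesis by simp
qed

text \<open>
  A geodesic word of length \<open>m + n\<close> is the concatenation of geodesic words of lengths \<open>m\<close> and \<open>n\<close>.
\<close>

lemma card_sphere_add:
  assumes S: "finite_generating_set G S"
  shows "card (sphere S (m + n)) \<le> card (sphere S m) * card (sphere S n)"
proof -
  have "sphere S (m + n) \<subseteq> (\<lambda>(x, y). x \<otimes> y) ` (sphere S m \<times> sphere S n)"
  proof
    fix z assume z: "z \<in> sphere S (m + n)"
    then obtain w where w: "length w = m + n" "set w \<subseteq> letters_of S" "word_value w = z"
      using word_length_word[OF S, of z] by (auto simp: sphere_def)
    define x y where "x = word_value (take m w)" and "y = word_value (drop m w)"
    have sub: "set (take m w) \<subseteq> letters_of S" "set (drop m w) \<subseteq> letters_of S"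
      using w(2) set_take_subset[of m w] set_drop_subset[of m w] by auto
    then have car: "set (take m w) \<subseteq> carrier G" "set (drop m w) \<subseteq> carrier G"
      using letters_of_subset[OF S] by auto
    then have xy: "x \<in> carrier G" "y \<in> carrier G" by (auto simp: x_def y_def word_value_closed)
    have "z = x \<otimes> y" using w(3) word_value_append[OF car] by (simp add: x_def y_def)
    moreover have "word_length G S x \<le> m" "word_length G S y \<le> n"
      using word_length_le[OF sub(1), of x] word_length_le[OF sub(2), of y] w(1)
      by (auto simp: x_def y_def)
    moreover have "word_length G S z = m + n" using z by (simp add: sphere_def)
    ultimately show "z \<in> (\<lambda>(x, y). x \<otimes> y) ` (sphere S m \<times> sphere S n)"
      using word_length_mult[OF S xy] xy by (intro image_eqI[of _ _ "(x, y)"]) (auto simp: sphere_def)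
  qed
  then have "card (sphere S (m + n)) \<le> card (sphere S m \<times> sphere S n)"
    using finite_sphere[OF S] by (intro surj_card_le) auto
  then show ?thesis by (simp add: card_cartesian_product)
qed

lemma card_sphere_power:
  assumes S: "finite_generating_set G S"
  shows "card (sphere S (q * k)) \<le> card (sphere S k) ^ q"
proof (induction q)
  case (Suc q)
  have "card (sphere S (Suc q * k)) \<le> card (sphere S k) * card (sphere S (q * k))"
    using card_sphere_add[OF S, of k "q * k"] by simp
  also have "\<dots> \<le> card (sphere S k) * card (sphere S k) ^ q" using Suc by simp
  finally show ?case by simp
qed (simp add: card_sphere_0[OF S])

text \<open>
  By submultiplicativity a single small sphere makes all spheres small: divide the radius by \<open>k\<close>
  and absorb the spheres whose radius is a remainder into the constant.
\<close>

lemma card_sphere_bound: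
  assumes S: "finite_generating_set G S" and a: "a \<ge> (1::real)" and k: "real (card (sphere S k)) < a ^ k"
  shows "\<exists>C. \<forall>n. real (card (sphere S n)) \<le> C * a ^ n"
proof -
  have k0: "k > 0" using k card_sphere_0[OF S] by (cases k) auto
  define C where "C = real (\<Sum>r<k. card (sphere S r))"
  have C0: "C \<ge> 0" by (simp add: C_def del: of_nat_sum)
  have "real (card (sphere S n)) \<le> C * a ^ n" for n
  proof -
    have "card (sphere S n) \<le> card (sphere S (n div k * k)) * card (sphere S (n mod k))"
      using card_sphere_add[OF S, of "n div k * k" "n mod k"] by simp
    also have "\<dots> \<le> card (sphere S k) ^ (n div k) * (\<Sum>r<k. card (sphere S r))"
      using k0 by (intro mult_mono card_sphere_power[OF S] member_le_sum) auto
    finally have "card (sphere S n) \<le> card (sphere S k) ^ (n div k) * (\<Sum>r<k. card (sphere S r))" .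
    then have "real (card (sphere S n)) \<le> real (card (sphere S k)) ^ (n div k) * C"
      unfolding C_def by (metis of_nat_le_iff of_nat_mult of_nat_power)
    also have "\<dots> \<le> (a ^ k) ^ (n div k) * C"
      using k C0 by (intro mult_right_mono power_mono) auto
    also have "\<dots> \<le> a ^ n * C"
      unfolding power_mult[symmetric] using a C0 by (intro mult_right_mono power_increasing) auto
    finally show ?thesis by (simp add: mult.commute)
  qed
  then show ?thesis by blast
qed

lemma word_length_word_value:
  assumes S: "finite_generating_set G S" and "set w \<subseteq> carrier G"
    and "\<And>x. x \<in> set w \<Longrightarrow> word_length G S x \<le> M"
  shows "word_length G S (word_value w) \<le> M * length w"
  using assms(2,3)
proof (induction w)
  case (Cons x w)
  have "word_length G S (word_value (x # w)) \<le> word_length G S x + word_length G S (word_value w)"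
    using word_length_mult[OF S] Cons.prems(1) word_value_closed by simp
  also have "\<dots> \<le> M + M * length w" using Cons by (intro add_mono) auto
  finally show ?case by simp
qed (simp add: word_length_one)

text \<open>
  Balls grow exponentially, since the \<open>2\<^sup>n\<close> products of \<open>n\<close> factors lie in a ball whose radius is
  linear in \<open>n\<close>. A lower bound for every single sphere follows from this by submultiplicativity: one
  exceptionally small sphere would bound the growth of all balls.
\<close>

lemma free_products_imp_exponential:
  assumes S0: "finite_generating_set G S0"
    and gh: "g \<in> carrier G" "h \<in> carrier G" "g \<noteq> h"
    and free: "\<And>n. inj_on word_value {w. length w = n \<and> set w \<subseteq> {g, h}}"
  shows "exponential_growth G"
  unfolding exponential_growth_def
proof (intro conjI allI impI)
  show "\<exists>S. finite_generating_set G S" using S0 by blast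
next
  fix S assume S: "finite_generating_set G S"
  define M where "M = word_length G S g + word_length G S h + 1"
  have M: "word_length G S g \<le> M" "word_length G S h \<le> M" "M > 0" by (auto simp: M_def)
  \<comment> \<open>With this \<open>a\<close>, spheres of size at most \<open>C * a ^ i\<close> would leave at most \<open>C * (M * n + 1) * sqrt 2 ^ n\<close> elements
    for the ball of radius \<open>M * n\<close>.\<close>
  define a where "a = root (2 * M) 2"
  have a1: "a > 1" using M by (simp add: a_def)
  have a2: "a ^ (2 * M) = 2" unfolding a_def by (rule real_root_pow_pos2) (use M in auto)
  define b where "b = a ^ M"
  have b1: "b > 1" using a1 M by (simp add: b_def one_less_power)
  have b2: "b ^ 2 = 2" using a2 by (simp add: b_def power_mult[symmetric] mult.commute)
  have large: "real (card (sphere S k)) \<ge> a ^ k" for k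
  proof (rule ccontr)
    assume "\<not> a ^ k \<le> real (card (sphere S k))"
    then obtain C where C: "\<And>n. real (card (sphere S n)) \<le> C * a ^ n"
      using card_sphere_bound[OF S, of a k] a1 by auto
    have C0: "C \<ge> 0" using C[of 0] by (auto intro: order_trans[OF of_nat_0_le_iff])
    have bound: "b ^ n \<le> C * (1 + M * n)" for n
    proof -
      let ?W = "{w. length w = n \<and> set w \<subseteq> {g, h}}"
      have "?W = {w. set w \<subseteq> {g, h} \<and> length w = n}" by auto
      then have "card ?W = 2 ^ n" using card_lists_length_eq[of "{g, h}" n] gh by (simp add: numeral_2_eq_2)
      then have "2 ^ n = card (word_value ` ?W)" using card_image[OF free[of n]] by simp
      also have "word_value ` ?W \<subseteq> (\<Union>i\<le>M * n. sphere S i)"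
      proof safe
        fix w assume w: "n = length w" "set w \<subseteq> {g, h}"
        have "word_length G S (word_value w) \<le> M * length w"
          using w gh M by (intro word_length_word_value[OF S]) auto
        moreover have "word_value w \<in> carrier G" using w gh by (intro word_value_closed) auto
        ultimately show "word_value w \<in> (\<Union>i\<le>M * length w. sphere S i)" by (auto simp: sphere_def)
      qed
      then have "card (word_value ` ?W) \<le> card (\<Union>i\<le>M * n. sphere S i)"
        using finite_sphere[OF S] by (intro card_mono) auto
      also have "\<dots> \<le> (\<Sum>i\<le>M * n. card (sphere S i))" by (rule card_UN_le) simp
      finally have "2 ^ n \<le> (\<Sum>i\<le>M * n. card (sphere S i))" .
      then have "real (2 ^ n) \<le> real (\<Sum>i\<le>M * n. card (sphere S i))" by linarith
      then have "2 ^ n \<le> (\<Sum>i\<le>M * n. real (card (sphere S i)))" by simp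
      also have "\<dots> \<le> (\<Sum>i\<le>M * n. C * a ^ (M * n))"
        using a1 C0 by (intro sum_mono order_trans[OF C] mult_left_mono power_increasing) auto
      also have "\<dots> = C * (1 + M * n) * b ^ n" by (simp add: b_def power_mult algebra_simps)
      finally have "2 ^ n \<le> C * (1 + M * n) * b ^ n" .
      moreover have "b ^ n * b ^ n = 2 ^ n"
        using b2 by (simp add: power2_eq_square flip: power_mult_distrib)
      ultimately have "b ^ n * b ^ n \<le> C * (1 + M * n) * b ^ n" by simp
      then show ?thesis using b1 by (simp add: mult_le_cancel_right)
    qed
    have l1: "(\<lambda>n. 1 / b ^ n) \<longlonglongrightarrow> 0" using LIMSEQ_divide_realpow_zero[of b 1] b1 by simp
    have l2: "(\<lambda>n. real n / b ^ n) \<longlonglongrightarrow> 0" using lim_n_over_pown[of b] b1 by simp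
    note lim = tendsto_mult[OF tendsto_const[of C] tendsto_add[OF l1 tendsto_mult[OF tendsto_const[of "real M"] l2]]]
    have eq: "(\<lambda>n. C * (1 + M * n) / b ^ n) = (\<lambda>n. C * (1 / b ^ n + M * (real n / b ^ n)))"
      using b1 by (auto simp: fun_eq_iff field_simps)
    have "(\<lambda>n. C * (1 + M * n) / b ^ n) \<longlonglongrightarrow> 0"
      using lim unfolding eq by (simp only: mult_zero_right add_0_left)
    then have "\<forall>\<^sub>F n in sequentially. C * (1 + M * n) / b ^ n < 1" by (rule order_tendstoD) simp
    then obtain n where "C * (1 + M * n) / b ^ n < 1" by (auto simp: eventually_sequentially)
    then show False using bound[of n] b1 by (simp add: field_simps)
  qed
  show "\<exists>a>1. (\<lambda>n. real (growth_function G S n)) \<in> \<Omega>(\<lambda>n. a ^ n)"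
  proof (intro exI conjI)
    show "a > 1" by fact
    show "(\<lambda>n. real (growth_function G S n)) \<in> \<Omega>(\<lambda>n. a ^ n)"
      using large a1 by (intro landau_omega.bigI[of 1]) (auto simp: growth_function_eq)
  qed
qed

text \<open>
  Here \<open>code\<close> plays the role of a normal form with respect to some other generating set. An element
  at distance \<open>n\<close> is a product of \<open>n\<close> generators, so its code has length at most linear in \<open>n\<close>.
\<close>

lemma polynomially_many_codes_imp_polynomial:
  fixes code :: "'a \<Rightarrow> 'l list"
  assumes S0: "finite_generating_set G S0"
    and inj: "inj_on code (carrier G)" and sub: "code ` carrier G \<subseteq> L"
    and len: "\<And>x y. x \<in> carrier G \<Longrightarrow> y \<in> carrier G \<Longrightarrow>
                length (code (x \<otimes> y)) \<le> length (code x) + length (code y)"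
    and poly: "\<And>n. finite {w \<in> L. length w \<le> n} \<and> card {w \<in> L. length w \<le> n} \<le> K * (n + 1) ^ d"
  shows "polynomial_growth G"
  unfolding polynomial_growth_def
proof (intro conjI allI impI)
  show "\<exists>S. finite_generating_set G S" using S0 by blast
next
  fix S assume S: "finite_generating_set G S"
  define m where "m = (\<Sum>s\<in>letters_of S. length (code s)) + length (code \<one>) + 1"
  have fin: "finite (letters_of S)" using S by (auto simp: finite_generating_set_def)
  have m: "length (code s) \<le> m" if "s \<in> letters_of S" for s
    using member_le_sum[of s "letters_of S" "\<lambda>s. length (code s)"] fin that by (auto simp: m_def)
  have code_word: "length (code (word_value w)) \<le> m * length w + m" if "set w \<subseteq> letters_of S" for w
    using that
  proof (induction w)
    case (Cons s w)
    have "length (code (word_value (s # w))) \<le> length (code s) + length (code (word_value w))"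
    proof -
      have "s \<in> carrier G" "set w \<subseteq> carrier G" using Cons.prems letters_of_subset[OF S] by auto
      then show ?thesis using len word_value_closed by simp
    qed
    also have "\<dots> \<le> m + (m * length w + m)" using Cons m by (intro add_mono) auto
    finally show ?case by simp
  qed (simp add: m_def)
  have bound: "card (sphere S n) \<le> K * (m * n + m + 1) ^ d" for n
  proof -
    have "code ` sphere S n \<subseteq> {w \<in> L. length w \<le> m * n + m}"
    proof
      fix c assume "c \<in> code ` sphere S n"
      then obtain x where x: "c = code x" "x \<in> carrier G" "word_length G S x = n" by (auto simp: sphere_def)
      then show "c \<in> {w \<in> L. length w \<le> m * n + m}"
        using word_length_word[OF S x(2)] code_word sub by (metis (mono_tags, lifting) image_subset_iff mem_Collect_eq)
    qed
    then have "card (code ` sphere S n) \<le> card {w \<in> L. length w \<le> m * n + m}"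
      using poly by (intro card_mono) auto
    moreover have "card (code ` sphere S n) = card (sphere S n)"
      by (rule card_image, rule inj_on_subset[OF inj]) (auto simp: sphere_def)
    ultimately show ?thesis using poly[of "m * n + m"] by linarith
  qed
  have "(\<lambda>n. real (growth_function G S n)) \<in> O(\<lambda>n. real n ^ d)"
  proof (rule bigoI)
    show "\<forall>\<^sub>F n in at_top. norm (real (growth_function G S n)) \<le> real (K * (2 * m + 1) ^ d) * norm (real n ^ d)"
      using eventually_ge_at_top[of 1]
    proof eventually_elim
      case (elim n)
      then have "m * n + m + 1 \<le> (2 * m + 1) * n"
        by (cases n) auto
      then have "K * (m * n + m + 1) ^ d \<le> K * ((2 * m + 1) * n) ^ d"
        by (intro mult_left_mono power_mono) auto
      then have "card (sphere S n) \<le> K * (2 * m + 1) ^ d * n ^ d"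
        using order_trans[OF bound[of n]] by (simp only: power_mult_distrib mult.assoc)
      then have "real (card (sphere S n)) \<le> real (K * (2 * m + 1) ^ d * n ^ d)" by linarith
      then show ?case by (simp add: growth_function_eq)
    qed
  qed
  then show "\<exists>d. (\<lambda>n. real (growth_function G S n)) \<in> O(\<lambda>n. real n ^ d)" by blast
qed

end

section \<open>Words in the generators of a right-angled Artin group\<close>

text \<open>
  The letter \<open>(v, True)\<close> stands for the generator \<open>v\<close>, and \<open>(v, False)\<close> for its inverse.
\<close>

type_synonym letter = "nat \<times> bool"

definition inv_letter :: "letter \<Rightarrow> letter" where
  "inv_letter a = (fst a, \<not> snd a)"

lemma inv_letter_simps [simp]:
  "inv_letter (inv_letter a) = a" "fst (inv_letter a) = fst a" "inv_letter a \<noteq> a"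
  by (auto simp: inv_letter_def prod_eq_iff)

text \<open>
  Up to the exchange of commuting letters, a word is determined by its projections to the single
  generators and to the pairs of generators that do not commute. Each projection is kept as a stack
  with the last letter on top. The relations of the Artin group are easily verified for its action
  on such families of stacks, since letters which commute operate on disjoint sets of stacks.
\<close>

type_synonym stacks = "nat \<times> nat \<Rightarrow> letter list"

locale raag =
  fixes V :: "nat set" and E :: "nat set set"
  assumes graph: "finite_simple_graph V E"
begin

definition com :: "letter \<Rightarrow> letter \<Rightarrow> bool" where
  "com a b \<longleftrightarrow> fst a \<noteq> fst b \<and> {fst a, fst b} \<in> E"

lemma com_sym: "com a b \<Longrightarrow> com b a"
  by (auto simp: com_def insert_commute)

lemma com_inv [simp]: "com (inv_letter a) b = com a b" "com a (inv_letter b) = com a b"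
  by (auto simp: com_def)

subsection \<open>Stacks\<close>

text \<open>
  The pairs of generators whose stack records the generator \<open>u\<close>: a stack belongs to a generator, or
  to two generators that do not commute. Two different commuting generators share no stack.
\<close>

definition pairs :: "nat \<Rightarrow> (nat \<times> nat) set" where
  "pairs u = {(x, y). (x = u \<or> y = u) \<and> (x = y \<or> {x, y} \<notin> E)}"

lemma pairs_self: "(u, u) \<in> pairs u"
  by (simp add: pairs_def)

lemma pairs_com: "com a b \<Longrightarrow> k \<in> pairs (fst a) \<Longrightarrow> k \<notin> pairs (fst b)"
  by (auto simp: com_def pairs_def insert_commute)

lemma pairs_not_com:
  "\<not> com a b \<Longrightarrow> (fst a, fst b) \<in> pairs (fst a) \<and> (fst a, fst b) \<in> pairs (fst b)"
  by (auto simp: com_def pairs_def)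

definition push :: "letter \<Rightarrow> stacks \<Rightarrow> stacks" where
  "push a p = (\<lambda>k. if k \<in> pairs (fst a) then a # p k else p k)"

definition pop :: "letter \<Rightarrow> stacks \<Rightarrow> stacks" where
  "pop a p = (\<lambda>k. if k \<in> pairs (fst a) then tl (p k) else p k)"

text \<open>
  If \<open>a\<close> is on top of all stacks that record its generator, then every letter after the last \<open>a\<close>
  commutes with \<open>a\<close>. So this is the condition that the recorded word can be rewritten to end with \<open>a\<close>.
\<close>

definition on_top :: "letter \<Rightarrow> stacks \<Rightarrow> bool" where
  "on_top a p \<longleftrightarrow> (\<forall>k\<in>pairs (fst a). p k \<noteq> [] \<and> hd (p k) = a)"

abbreviation empty_stacks :: stacks where
  "empty_stacks \<equiv> \<lambda>_. []"

definition stacks_of :: "letter list \<Rightarrow> stacks" where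
  "stacks_of w = fold push w empty_stacks"

lemma stacks_of_simps [simp]:
  "stacks_of [] = empty_stacks" "stacks_of (w @ [a]) = push a (stacks_of w)"
  by (auto simp: stacks_of_def)

lemma pop_push: "fst a = fst b \<Longrightarrow> pop a (push b p) = p"
  by (auto simp: pop_def push_def)

lemma on_top_push: "on_top a (push a p)"
  by (simp add: on_top_def push_def)

lemma on_top_com:
  assumes "com a b"
  shows "on_top a (push b p) = on_top a p" "on_top a (pop b p) = on_top a p"
  using pairs_com[OF assms] by (auto simp: on_top_def push_def pop_def)

lemma push_pop_com:
  assumes "com a b"
  shows "push a (push b p) = push b (push a p)" "push a (pop b p) = pop b (push a p)"
    "pop a (pop b p) = pop b (pop a p)"
  using pairs_com[OF assms] by (auto simp: push_def pop_def fun_eq_iff)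

lemma on_top_push_cases:
  assumes "on_top b (push c p)"
  shows "c = b \<or> com b c \<and> on_top b p"
proof (cases "com b c")
  case True
  then show ?thesis using assms by (simp add: on_top_com)
next
  case False
  then have "hd (push c p (fst b, fst c)) = b" using assms pairs_not_com by (auto simp: on_top_def)
  then show ?thesis using pairs_not_com[OF False] by (simp add: push_def)
qed

lemma not_on_top_empty: "\<not> on_top a empty_stacks"
  using pairs_self by (auto simp: on_top_def)

text \<open>
  No letter cancels against an earlier one, even after commuting letters have been exchanged.
\<close>

definition reduced :: "letter list \<Rightarrow> bool" where
  "reduced w \<longleftrightarrow> (\<forall>u a v. w = u @ a # v \<longrightarrow> \<not> on_top (inv_letter a) (stacks_of u))"

lemma reduced_snoc: "reduced (w @ [a]) \<longleftrightarrow> reduced w \<and> \<not> on_top (inv_letter a) (stacks_of w)"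
proof
  assume r: "reduced (w @ [a])"
  then show "reduced w \<and> \<not> on_top (inv_letter a) (stacks_of w)"
    unfolding reduced_def by (metis append.assoc append_Cons)
next
  assume r: "reduced w \<and> \<not> on_top (inv_letter a) (stacks_of w)"
  show "reduced (w @ [a])"
    unfolding reduced_def
  proof (intro allI impI)
    fix u b v assume eq: "w @ [a] = u @ b # v"
    show "\<not> on_top (inv_letter b) (stacks_of u)"
    proof (cases v rule: rev_cases)
      case Nil
      then show ?thesis using eq r by simp
    next
      case (snoc v' c)
      then have "w = u @ b # v'" using eq by simp
      then show ?thesis using r unfolding reduced_def by blast
    qed
  qed
qed

text \<open>
  A letter which is on top of all its stacks can be moved to the end of the word, and the word that
  precedes it there is again reduced.
\<close>

lemma reduced_on_top:
  assumes "reduced w" "on_top b (stacks_of w)"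
  shows "\<exists>w'. reduced w' \<and> stacks_of w = push b (stacks_of w') \<and> \<not> on_top (inv_letter b) (stacks_of w')"
  using assms
proof (induction w rule: rev_induct)
  case Nil
  then show ?case by (simp add: not_on_top_empty)
next
  case (snoc c w)
  then consider "c = b" | "com b c" "on_top b (stacks_of w)"
    using on_top_push_cases by fastforce
  then show ?case
  proof cases
    case 1
    then show ?thesis using snoc.prems by (auto simp: reduced_snoc)
  next
    case 2
    then obtain w' where w': "reduced w'" "stacks_of w = push b (stacks_of w')"
      "\<not> on_top (inv_letter b) (stacks_of w')"
      using snoc by (auto simp: reduced_snoc)
    have "\<not> on_top (inv_letter c) (stacks_of w')"
      using snoc.prems(1) 2(1) w'(2) by (auto simp: reduced_snoc on_top_com com_sym)
    then have "reduced (w' @ [c])" using w' by (simp add: reduced_snoc)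
    moreover have "stacks_of (w @ [c]) = push b (stacks_of (w' @ [c]))"
      using push_pop_com(1)[OF 2(1)] w'(2) by simp
    moreover have "\<not> on_top (inv_letter b) (stacks_of (w' @ [c]))"
      using 2(1) w'(3) by (simp add: on_top_com)
    ultimately show ?thesis by blast
  qed
qed

definition reduced_stacks :: "stacks set" where
  "reduced_stacks = stacks_of ` {w. reduced w}"

text \<open>
  The action of a generator by multiplication from the right. Outside the stacks of reduced words it
  is trivial, so that \<open>act a\<close> is a bijection and the commutation relations hold without side
  conditions.
\<close>

definition act :: "letter \<Rightarrow> stacks \<Rightarrow> stacks" where
  "act a p = (if p \<notin> reduced_stacks then p
              else if on_top (inv_letter a) p then pop a p else push a p)"

lemma act_reduced_stacks:
  assumes "p \<in> reduced_stacks"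
  shows "act a p \<in> reduced_stacks"
proof -
  obtain w where w: "reduced w" "p = stacks_of w" using assms by (auto simp: reduced_stacks_def)
  show ?thesis
  proof (cases "on_top (inv_letter a) p")
    case True
    then obtain w' where "reduced w'" "p = push (inv_letter a) (stacks_of w')"
      using reduced_on_top w by blast
    then have "act a p = stacks_of w'" using assms True by (simp add: act_def pop_push)
    then show ?thesis using \<open>reduced w'\<close> by (simp add: reduced_stacks_def)
  next
    case False
    then have "reduced (w @ [a])" "act a p = stacks_of (w @ [a])"
      using w assms by (auto simp: reduced_snoc act_def)
    then show ?thesis unfolding reduced_stacks_def by blast
  qed
qed

lemma act_inv: "act (inv_letter a) (act a p) = p"
proof (cases "p \<in> reduced_stacks")
  case True
  note r = act_reduced_stacks[OF True, of a]
  show ?thesis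
  proof (cases "on_top (inv_letter a) p")
    case t: True
    obtain w where w: "reduced w" "p = stacks_of w" using True by (auto simp: reduced_stacks_def)
    then obtain w' where w': "p = push (inv_letter a) (stacks_of w')" "\<not> on_top a (stacks_of w')"
      using reduced_on_top[of w "inv_letter a"] t by auto
    then have "act a p = stacks_of w'" using True t by (simp add: act_def pop_push)
    then show ?thesis using r w' by (simp add: act_def)
  next
    case False
    then have "act a p = push a p" using True by (simp add: act_def)
    then show ?thesis using r by (simp add: act_def on_top_push pop_push)
  qed
qed (simp add: act_def)

lemma act_inv': "act a (act (inv_letter a) p) = p"
  using act_inv[of "inv_letter a"] by simp

lemma act_com:
  assumes "com a b"
  shows "act a (act b p) = act b (act a p)"
proof (cases "p \<in> reduced_stacks")
  case True
  have "com (inv_letter a) b" "com (inv_letter b) a" "com b a" using assms com_sym by auto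
  then show ?thesis using act_reduced_stacks[OF True, of a] act_reduced_stacks[OF True, of b] True assms
    by (auto simp: act_def on_top_com push_pop_com)
qed (simp add: act_def)

definition acts :: "letter list \<Rightarrow> stacks \<Rightarrow> stacks" where
  "acts w p = fold act w p"

lemma acts_simps [simp]:
  "acts [] p = p" "acts (a # w) p = acts w (act a p)" "acts (u @ w) p = acts w (acts u p)"
  by (auto simp: acts_def)

definition inv_word :: "letter list \<Rightarrow> letter list" where
  "inv_word w = rev (map inv_letter w)"

lemma inv_word_simps [simp]:
  "inv_word [] = []" "inv_word (a # w) = inv_word w @ [inv_letter a]" "length (inv_word w) = length w"
  by (auto simp: inv_word_def)

lemma acts_inv_word': "acts w (acts (inv_word w) p) = p"
  by (induction w arbitrary: p) (auto simp: act_inv')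

lemma acts_reduced: "reduced w \<Longrightarrow> acts w empty_stacks = stacks_of w"
proof (induction w rule: rev_induct)
  case (snoc a w)
  then have "stacks_of w \<in> reduced_stacks" by (auto simp: reduced_snoc reduced_stacks_def)
  then show ?case using snoc by (simp add: reduced_snoc act_def)
qed simp

subsection \<open>Lexicographic normal forms\<close>

text \<open>
  Let \<open>F\<close> be the set of letters which must not follow a word in normal form. A letter \<open>a\<close> must not
  follow if it can be moved to the left until it meets either its inverse, or a letter which commutes
  with it and has a greater generator. If \<open>b\<close> is appended to the word, then \<open>a\<close> can be moved past
  \<open>b\<close> exactly if they commute, whence the following recursion. Commuting letters have different
  generators, which is why the order of the generators suffices.
\<close>

definition forbid :: "letter \<Rightarrow> letter set \<Rightarrow> letter set" where
  "forbid b F = {a. a = inv_letter b \<or> com a b \<and> (a \<in> F \<or> fst a < fst b)}"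

primrec normal_from :: "letter set \<Rightarrow> letter list \<Rightarrow> bool" where
  "normal_from F [] = True"
| "normal_from F (a # w) \<longleftrightarrow> a \<notin> F \<and> normal_from (forbid a F) w"

lemma normal_from_append:
  "normal_from F (u @ w) \<longleftrightarrow> normal_from F u \<and> normal_from (fold forbid u F) w"
  by (induction u arbitrary: F) auto

abbreviation normal :: "letter list \<Rightarrow> bool" where
  "normal w \<equiv> normal_from {} w"

text \<open>
  A letter that would cancel can be moved to the left up to its inverse, so normal words are reduced.
\<close>

lemma on_top_imp_forbidden: "on_top (inv_letter a) (stacks_of u) \<Longrightarrow> a \<in> fold forbid u {}"
proof (induction u rule: rev_induct)
  case Nil
  then show ?case by (simp add: not_on_top_empty)
next
  case (snoc b u)
  then show ?case using on_top_push_cases[of "inv_letter a" b "stacks_of u"]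
    by (auto simp: forbid_def)
qed

lemma normal_imp_reduced: "normal w \<Longrightarrow> reduced w"
  unfolding reduced_def using on_top_imp_forbidden by (auto simp: normal_from_append)

abbreviation proj :: "nat \<times> nat \<Rightarrow> letter list \<Rightarrow> letter list" where
  "proj k w \<equiv> filter (\<lambda>a. k \<in> pairs (fst a)) w"

lemma stacks_of_proj: "stacks_of w k = rev (proj k w)"
  by (induction w rule: rev_induct) (auto simp: push_def)

text \<open>
  If \<open>a\<close> comes first in each of its projections, then all letters before the first \<open>a\<close> commute with
  \<open>a\<close>, and \<open>a\<close> is still forbidden when it is reached.
\<close>

lemma forbidden_not_first:
  assumes "a \<in> F" "\<And>k. k \<in> pairs (fst a) \<Longrightarrow> proj k s \<noteq> [] \<and> hd (proj k s) = a"
  shows "\<not> normal_from F s"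
  using assms
proof (induction s arbitrary: F)
  case Nil
  then show ?case using pairs_self by fastforce
next
  case (Cons c s)
  show ?case
  proof (cases "com a c")
    case True
    then have "a \<in> forbid c F" using Cons.prems by (simp add: forbid_def)
    moreover have "proj k s \<noteq> [] \<and> hd (proj k s) = a" if "k \<in> pairs (fst a)" for k
      using Cons.prems(2)[OF that] pairs_com[OF True that] by simp
    ultimately show ?thesis using Cons.IH by simp
  next
    case False
    then have "a = c" using Cons.prems(2)[of "(fst a, fst c)"] pairs_not_com[OF False] by simp
    then show ?thesis using Cons.prems(1) by simp
  qed
qed

lemma normal_first_letter:
  assumes "com a b" "fst a < fst b" "\<And>k. proj k (a # s) = proj k (b # s')"
  shows "\<not> normal_from F (b # s')"
proof -
  have "a \<in> forbid b F" using assms by (simp add: forbid_def)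
  moreover have "proj k s' \<noteq> [] \<and> hd (proj k s') = a" if "k \<in> pairs (fst a)" for k
    using assms(3)[of k] that pairs_com[OF assms(1) that] by (simp split: if_splits) (metis list.sel(1) list.distinct(1))
  ultimately show ?thesis using forbidden_not_first by simp
qed

text \<open>
  Consider the first place where the two words have different letters \<open>a\<close> and \<open>b\<close>. These commute,
  because otherwise the projections to the pair of their generators would differ there. If \<open>a\<close> is
  the smaller one, then in the word with \<open>b\<close> the first \<open>a\<close> can be moved to the left beyond \<open>b\<close>,
  which is not possible in a normal word.
\<close>

lemma normal_unique_from:
  assumes "normal_from F w" "normal_from F w'" "\<And>k. proj k w = proj k w'"
  shows "w = w'"
  using assms
proof (induction w arbitrary: F w')
  case Nil
  show ?case
  proof (cases w')
    case (Cons b s)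
    then show ?thesis using Nil.prems(3)[of "(fst b, fst b)"] pairs_self by simp
  qed simp
next
  case (Cons a s)
  show ?case
  proof (cases w')
    case Nil
    then show ?thesis using Cons.prems(3)[of "(fst a, fst a)"] pairs_self by simp
  next
    case w': (Cons b s')
    have eq: "proj k (a # s) = proj k (b # s')" for k using Cons.prems(3) w' by simp
    show ?thesis
    proof (cases "a = b")
      case True
      have "proj k s = proj k s'" for k using eq[of k] True by (auto split: if_splits)
      then show ?thesis using Cons w' True by auto
    next
      case False
      have "com a b"
      proof (rule ccontr)
        assume "\<not> com a b"
        from pairs_not_com[OF this] show False using eq[of "(fst a, fst b)"] False by simp
      qed
      moreover have "fst a < fst b \<or> fst b < fst a" using \<open>com a b\<close> by (auto simp: com_def)
      ultimately have False
        using normal_first_letter[of a b s s' F] normal_first_letter[of b a s' s F] eq Cons.prems(1,2) w' com_sym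
        by metis
      then show ?thesis ..
    qed
  qed
qed

lemma normal_unique:
  assumes "normal w" "normal w'" "acts w empty_stacks = acts w' empty_stacks"
  shows "w = w'"
proof (rule normal_unique_from[OF assms(1,2)])
  fix k
  have "stacks_of w k = stacks_of w' k" using assms acts_reduced normal_imp_reduced by simp
  then show "proj k w = proj k w'" by (simp add: stacks_of_proj)
qed

lemma forbidden_decomp:
  "a \<in> fold forbid u {} \<Longrightarrow> \<exists>c b s. u = c @ b # s \<and> (\<forall>x\<in>set s. com a x) \<and>
     (a = inv_letter b \<or> com a b \<and> fst a < fst b)"
proof (induction u rule: rev_induct)
  case (snoc b u)
  then have "a \<in> forbid b (fold forbid u {})" by simp
  then consider "a = inv_letter b \<or> com a b \<and> fst a < fst b" | "com a b" "a \<in> fold forbid u {}"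
    unfolding forbid_def[of b "fold forbid u {}"] by blast
  then show ?case
  proof cases
    case 1
    then show ?thesis by (intro exI[of _ u] exI[of _ b] exI[of _ "[]"]) simp
  next
    case 2
    then obtain c b' s where "u = c @ b' # s" "\<forall>x\<in>set s. com a x"
      "a = inv_letter b' \<or> com a b' \<and> fst a < fst b'" using snoc.IH by blast
    then show ?thesis using 2 by (intro exI[of _ c] exI[of _ b'] exI[of _ "s @ [b]"]) auto
  qed
qed simp

lemma not_normal_decomp: "\<not> normal_from F w \<Longrightarrow> \<exists>u a r. w = u @ a # r \<and> a \<in> fold forbid u F"
proof (induction w arbitrary: F)
  case (Cons b w)
  show ?case
  proof (cases "b \<in> F")
    case True
    then show ?thesis by (intro exI[of _ "[]"] exI[of _ b] exI[of _ w]) simp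
  next
    case False
    then have "\<not> normal_from (forbid b F) w" using Cons.prems by simp
    then obtain u a r where "w = u @ a # r" "a \<in> fold forbid u (forbid b F)" using Cons.IH by blast
    then show ?thesis by (intro exI[of _ "b # u"] exI[of _ a] exI[of _ r]) simp
  qed
qed simp

lemma lenlex_cancel: "(map fst (c @ s @ r), map fst (c @ b # s @ a # r)) \<in> lenlex less_than"
  by (simp add: lenlex_conv)

lemma lenlex_move:
  assumes "fst a < fst b"
  shows "(map fst (c @ a # b # s @ r), map fst (c @ b # s @ a # r)) \<in> lenlex less_than"
  using assms by (simp add: lenlex_conv lex_append_leftI)

text \<open>
  A word which is not normal contains a letter \<open>b\<close> and later a letter \<open>a\<close>, such that \<open>a\<close> commutes with
  all letters between them and either cancels \<open>b\<close> or commutes with \<open>b\<close> and has a smaller generator.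
  Moving \<open>a\<close> towards \<open>b\<close> makes the word shorter or, at the same length, lexicographically smaller.
  The relation \<open>Q\<close> stands for homotopy of the edge paths that are labelled by the two words.
\<close>

lemma ex_normal_form:
  assumes refl: "\<And>w. Q w w"
    and trans: "\<And>u v w. Q u v \<Longrightarrow> Q v w \<Longrightarrow> Q u w"
    and swap: "\<And>c a b r. com a b \<Longrightarrow> Q (c @ a # b # r) (c @ b # a # r)"
    and cancel: "\<And>c a r. Q (c @ a # inv_letter a # r) (c @ r)"
  shows "\<exists>w'. normal w' \<and> length w' \<le> length w \<and> Q w w'"
proof (induction w rule: wf_induct_rule[OF wf_inv_image[where f = "map fst", OF wf_lenlex[OF wf_less_than]]])
  case (1 w)
  show ?case
  proof (cases "normal w")
    case True
    then show ?thesis using refl by blast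
  next
    case False
    then obtain c b s a r where w: "w = c @ b # s @ a # r" and s: "\<forall>x\<in>set s. com a x"
      and ab: "a = inv_letter b \<or> com a b \<and> fst a < fst b"
      using not_normal_decomp[OF False] forbidden_decomp by (metis append.assoc append_Cons)
    have move: "Q (c @ s @ a # r) (c @ a # s @ r)" for c r
      using s
    proof (induction s arbitrary: r rule: rev_induct)
      case Nil
      then show ?case using refl by simp
    next
      case (snoc x s)
      have "Q ((c @ s) @ x # a # r) ((c @ s) @ a # x # r)"
        using swap[of x a "c @ s" r] com_sym snoc.prems by simp
      then have "Q (c @ s @ x # a # r) (c @ s @ a # x # r)" by simp
      moreover have "Q (c @ s @ a # x # r) (c @ a # s @ x # r)" using snoc.IH[of "x # r"] snoc.prems by simp
      ultimately have "Q (c @ s @ x # a # r) (c @ a # s @ x # r)" using trans by blast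
      then show ?case by simp
    qed
    obtain v where v: "Q w v" "length v \<le> length w" "(map fst v, map fst w) \<in> lenlex less_than"
    proof (cases "a = inv_letter b")
      case True
      have "Q w (c @ b # inv_letter b # s @ r)" using move[of "c @ [b]" r] w True by simp
      then have "Q w (c @ s @ r)" using cancel trans by blast
      moreover have "length (c @ s @ r) \<le> length w" by (simp add: w)
      ultimately show ?thesis using lenlex_cancel[of c s r b a] unfolding w by (rule that[unfolded w])
    next
      case False
      then have b: "com a b" "fst a < fst b" using ab by auto
      have "Q w (c @ b # a # s @ r)" using move[of "c @ [b]" r] w by simp
      then have "Q w (c @ a # b # s @ r)" using swap[OF com_sym[OF b(1)]] trans by blast
      moreover have "length (c @ a # b # s @ r) \<le> length w" by (simp add: w)
      ultimately show ?thesis using lenlex_move[OF b(2), of c s r] unfolding w by (rule that[unfolded w])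
    qed
    then have "\<exists>w'. normal w' \<and> length w' \<le> length v \<and> Q v w'" using 1 by (simp add: inv_image_def)
    then show ?thesis using trans v by (meson order_trans)
  qed
qed

end

section \<open>Paths\<close>

text \<open>
  The unit interval is convex. Changes of parametrisation, constant paths and inverse paths in an
  arbitrary topological space can all be treated by this.
\<close>

lemma homotopic_paths_compose_unit:
  fixes p :: "real \<Rightarrow> 'a::topological_space" and f g :: "real \<Rightarrow> real"
  assumes p: "path p" "path_image p \<subseteq> S"
    and f: "path f" "path_image f \<subseteq> {0..1}" and g: "path g" "path_image g \<subseteq> {0..1}"
    and ends: "pathstart g = pathstart f" "pathfinish g = pathfinish f"
  shows "homotopic_paths S (p \<circ> f) (p \<circ> g)"
proof (rule homotopic_paths_continuous_image)
  show "homotopic_paths {0..1} f g"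
  proof (rule homotopic_paths_linear)
    fix t :: real assume "t \<in> {0..1}"
    then have "f t \<in> path_image f" "g t \<in> path_image g" by (auto simp: path_image_def)
    then have "f t \<in> {0..1}" "g t \<in> {0..1}" using f g by blast+
    then show "closed_segment (f t) (g t) \<subseteq> {0..1}" by (intro closed_segment_subset) auto
  qed (use f g ends in auto)
  show "continuous_on {0..1} p" "p \<in> {0..1} \<rightarrow> S" using p by (auto simp: path_def path_image_def)
qed

lemma homotopic_paths_const_right:
  fixes p :: "real \<Rightarrow> 'a::topological_space"
  assumes "path p" "path_image p \<subseteq> S" "pathfinish p = x"
  shows "homotopic_paths S (p +++ (\<lambda>_. x)) p"
proof -
  have "homotopic_paths S (p \<circ> (linepath 0 1 +++ linepath 1 1)) (p \<circ> linepath 0 1)"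
    using assms by (intro homotopic_paths_compose_unit) (auto simp: path_image_join closed_segment_eq_real_ivl)
  moreover have "p \<circ> (linepath 0 1 +++ linepath 1 1) = p +++ (\<lambda>_. x)" "p \<circ> linepath 0 1 = p"
    using assms(3) by (auto simp: fun_eq_iff joinpaths_def linepath_def pathfinish_def)
  ultimately show ?thesis by simp
qed

lemma homotopic_paths_const_left:
  fixes p :: "real \<Rightarrow> 'a::topological_space"
  assumes "path p" "path_image p \<subseteq> S" "pathstart p = x"
  shows "homotopic_paths S ((\<lambda>_. x) +++ p) p"
proof -
  have "homotopic_paths S (p \<circ> (linepath 0 0 +++ linepath 0 1)) (p \<circ> linepath 0 1)"
    using assms by (intro homotopic_paths_compose_unit) (auto simp: path_image_join closed_segment_eq_real_ivl)
  moreover have "p \<circ> (linepath 0 0 +++ linepath 0 1) = (\<lambda>_. x) +++ p" "p \<circ> linepath 0 1 = p"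
    using assms(3) by (auto simp: fun_eq_iff joinpaths_def linepath_def pathstart_def)
  ultimately show ?thesis by simp
qed

lemma homotopic_paths_right_inverse:
  fixes p :: "real \<Rightarrow> 'a::topological_space"
  assumes "path p" "path_image p \<subseteq> S" "pathstart p = x"
  shows "homotopic_paths S (p +++ reversepath p) (\<lambda>_. x)"
proof -
  have "homotopic_paths S (p \<circ> (linepath 0 1 +++ linepath 1 0)) (p \<circ> linepath 0 0)"
    using assms by (intro homotopic_paths_compose_unit) (auto simp: path_image_join closed_segment_eq_real_ivl)
  moreover have "p \<circ> (linepath 0 1 +++ linepath 1 0) = p +++ reversepath p" "p \<circ> linepath 0 0 = (\<lambda>_. x)"
    using assms(3) by (auto simp: fun_eq_iff joinpaths_def linepath_def pathstart_def reversepath_def)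
  ultimately show ?thesis by simp
qed

lemma homotopic_paths_assoc':
  fixes p q r :: "real \<Rightarrow> 'a::topological_space"
  assumes "path p" "path_image p \<subseteq> S" "path q" "path_image q \<subseteq> S" "path r" "path_image r \<subseteq> S"
    "pathfinish p = pathstart q" "pathfinish q = pathstart r"
  shows "homotopic_paths S ((p +++ q) +++ r) (p +++ (q +++ r))"
  using homotopic_paths_assoc[OF assms] homotopic_paths_sym by blast

lemma homotopic_paths_cancel:
  fixes p q :: "real \<Rightarrow> 'a::topological_space"
  assumes "path p" "path_image p \<subseteq> S" "path q" "path_image q \<subseteq> S" "pathstart p = pathstart q"
  shows "homotopic_paths S (p +++ (reversepath p +++ q)) q"
proof -
  have "homotopic_paths S (p +++ (reversepath p +++ q)) ((p +++ reversepath p) +++ q)"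
    using assms by (intro homotopic_paths_assoc) auto
  also have "homotopic_paths S \<dots> ((\<lambda>_. pathstart q) +++ q)"
    using assms by (intro homotopic_paths_join homotopic_paths_right_inverse) auto
  also have "homotopic_paths S \<dots> q"
    using assms by (intro homotopic_paths_const_left) auto
  finally show ?thesis .
qed

definition line :: "(nat \<Rightarrow> real) \<Rightarrow> (nat \<Rightarrow> real) \<Rightarrow> real \<Rightarrow> nat \<Rightarrow> real" where
  "line t u s = (\<lambda>i. (1 - s) * t i + s * u i)"

lemma line_simps [simp]: "line t u 0 = t" "line t u 1 = u" "line t t s = t"
  by (auto simp: line_def algebra_simps)

lemma line_swap: "line t u (1 - s) = line u t s"
  by (auto simp: line_def fun_eq_iff)

lemma path_line [simp]: "path (line t u)" "pathstart (line t u) = t" "pathfinish (line t u) = u"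
proof -
  show "path (line t u)" unfolding path_def line_def
    by (intro continuous_on_coordinatewise_then_product continuous_intros)
qed (auto simp: pathstart_def pathfinish_def)

lemma line_in_cube: "t \<in> cube I \<Longrightarrow> u \<in> cube I \<Longrightarrow> s \<in> {0..1} \<Longrightarrow> line t u s \<in> cube I"
  unfolding cube_def line_def
  by (auto intro!: add_nonneg_nonneg mult_nonneg_nonneg convex_bound_le)

lemma path_image_line: "t \<in> cube I \<Longrightarrow> u \<in> cube I \<Longrightarrow> path_image (line t u) \<subseteq> cube I"
  using line_in_cube by (auto simp: path_image_def)

lemma cube_paths_homotopic:
  assumes p: "path p" "path_image p \<subseteq> cube I" and q: "path q" "path_image q \<subseteq> cube I"
    and ends: "pathstart p = pathstart q" "pathfinish p = pathfinish q"
    and \<phi>: "continuous_on (cube I) \<phi>" "\<phi> ` cube I \<subseteq> X"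
  shows "homotopic_paths X (\<phi> \<circ> p) (\<phi> \<circ> q)"
proof (rule homotopic_paths_continuous_image[OF _ \<phi>(1)])
  have coord: "continuous_on ({0..1} \<times> {0..1}) (\<lambda>x. r (snd x) i)"
    if r: "path r" for r :: "real \<Rightarrow> nat \<Rightarrow> real" and i
  proof (rule continuous_on_compose2[of "{0..1}" "\<lambda>s. r s i"])
    show "continuous_on {0..1} (\<lambda>s. r s i)"
      using continuous_on_product_then_coordinatewise[OF r[unfolded path_def], of i] .
  qed (auto intro: continuous_on_snd)
  show "homotopic_paths (cube I) p q"
    unfolding homotopic_paths
  proof (intro exI conjI ballI)
    let ?h = "\<lambda>x. line (p (snd x)) (q (snd x)) (fst x)"
    show "continuous_on ({0..1} \<times> {0..1}) ?h" unfolding line_def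
      by (rule continuous_on_coordinatewise_then_product)
         (intro continuous_on_add continuous_on_mult continuous_on_diff continuous_on_const
            continuous_on_fst continuous_on_id coord p(1) q(1))
    show "?h \<in> {0..1} \<times> {0..1} \<rightarrow> cube I"
      using p q by (auto simp: path_image_def intro!: line_in_cube)
    fix t :: real
    show "pathstart (?h \<circ> Pair t) = pathstart p" "pathfinish (?h \<circ> Pair t) = pathfinish p"
      using ends by (auto simp: pathstart_def pathfinish_def)
  qed auto
  show "\<phi> \<in> cube I \<rightarrow> X" using \<phi> by auto
qed

text \<open>
  The conditions are required for all smaller \<open>d\<close> as well, so that finitely many of them can be
  combined.
\<close>

lemma finite_uniform:
  assumes "finite A" "\<And>a. a \<in> A \<Longrightarrow> \<exists>e>0. \<forall>d. 0 < d \<longrightarrow> d \<le> e \<longrightarrow> P a d"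
  shows "\<exists>e>(0::real). \<forall>d. 0 < d \<longrightarrow> d \<le> e \<longrightarrow> (\<forall>a\<in>A. P a d)"
  using assms
proof (induction A)
  case (insert a A)
  then obtain e where "e > 0" "\<forall>d. 0 < d \<longrightarrow> d \<le> e \<longrightarrow> (\<forall>a\<in>A. P a d)"
    by (metis insertI2)
  moreover obtain f where "f > 0" "\<forall>d. 0 < d \<longrightarrow> d \<le> f \<longrightarrow> P a d"
    using insert.prems[of a] by (elim meta_impE exE conjE) auto
  ultimately show ?case by (intro exI[of _ "min e f"]) auto
qed (auto intro: exI[of _ 1])

section \<open>Cube complexes\<close>

text \<open>
  The restriction of a cube isometry to one coordinate: a reflection of the unit interval or the
  identity.
\<close>

definition flip :: "bool \<Rightarrow> real \<Rightarrow> real" where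
  "flip b x = (if b then 1 - x else x)"

lemma flip_flip [simp]: "flip a (flip b x) = flip (a \<noteq> b) x"
  by (simp add: flip_def)

lemma flip_False [simp]: "flip False x = x"
  by (simp add: flip_def)

lemma flip_inj [simp]: "flip a x = flip a y \<longleftrightarrow> x = y"
  by (simp add: flip_def)

lemma flip_range [simp]:
  "0 \<le> flip b x \<and> flip b x \<le> 1 \<longleftrightarrow> 0 \<le> x \<and> x \<le> 1"
  "0 < flip b x \<and> flip b x < 1 \<longleftrightarrow> 0 < x \<and> x < 1"
  by (auto simp: flip_def)

lemma flip_line: "flip b ((1 - s) * x + s * y) = (1 - s) * flip b x + s * flip b y"
  by (simp add: flip_def algebra_simps)

lemma flip_dist: "\<bar>flip b x - flip b y\<bar> = \<bar>x - y\<bar>"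
  by (auto simp: flip_def)

definition reindex :: "nat set \<Rightarrow> (nat \<Rightarrow> nat) \<Rightarrow> nat set \<Rightarrow> (nat \<Rightarrow> real) \<Rightarrow> nat \<Rightarrow> real" where
  "reindex J \<pi> F s = (\<lambda>j. if j \<in> J then flip (j \<in> F) (s (\<pi> j)) else 0)"

lemma cube_isometry_reindex:
  "cube_isometry I J h \<longleftrightarrow> (\<exists>\<pi> F. bij_betw \<pi> J I \<and> (\<forall>t\<in>cube I. h t = reindex J \<pi> F t))"
  unfolding cube_isometry_def reindex_def flip_def ..

text \<open>
  The directions of the open face of the cube \<open>I\<close> that contains \<open>t\<close>.
\<close>

definition free :: "nat set \<Rightarrow> (nat \<Rightarrow> real) \<Rightarrow> nat set" where
  "free I t = {i \<in> I. 0 < t i \<and> t i < 1}"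

definition same_face :: "nat set \<Rightarrow> (nat \<Rightarrow> real) \<Rightarrow> (nat \<Rightarrow> real) \<Rightarrow> bool" where
  "same_face I t s \<longleftrightarrow> (\<forall>i\<in>I - free I t. s i = t i)"

lemma not_free: "t \<in> cube I \<Longrightarrow> i \<notin> free I t \<Longrightarrow> t i = 0 \<or> t i = 1"
  by (force simp: cube_def free_def)

lemma cube_bounds: "t \<in> cube I \<Longrightarrow> 0 \<le> t i \<and> t i \<le> 1"
  by (cases "i \<in> I") (auto simp: cube_def)

lemma cube_outside: "t \<in> cube I \<Longrightarrow> i \<notin> I \<Longrightarrow> t i = 0"
  by (simp add: cube_def)

lemma open_cube_subset: "open_cube I \<subseteq> cube I"
  by (auto simp: cube_def open_cube_def)

lemma cube_vertices_subset: "cube_vertices I \<subseteq> cube I"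
  by (fastforce simp: cube_def cube_vertices_def)

definition near :: "nat set \<Rightarrow> (nat \<Rightarrow> real) \<Rightarrow> (nat \<Rightarrow> real) \<Rightarrow> real \<Rightarrow> bool" where
  "near I t u e \<longleftrightarrow> (\<forall>i\<in>I. \<bar>t i - u i\<bar> < e)"

locale cubed_space =
  fixes X :: "'a::topological_space set" and \<Phi> :: "'a cell set"
  assumes cubed: "cube_complex X \<Phi>"
begin

lemma cell:
  assumes "(I, \<phi>) \<in> \<Phi>"
  shows "finite I" "continuous_on (cube I) \<phi>" "\<phi> ` cube I \<subseteq> X" "inj_on \<phi> (open_cube I)"
proof -
  have "\<forall>(I, \<phi>)\<in>\<Phi>. finite I \<and> continuous_on (cube I) \<phi> \<and> \<phi> ` cube I \<subseteq> X \<and> inj_on \<phi> (open_cube I)"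
    using cubed unfolding cube_complex_def by (rule conjunct1)
  from bspec[OF this assms]
  show "finite I" "continuous_on (cube I) \<phi>" "\<phi> ` cube I \<subseteq> X" "inj_on \<phi> (open_cube I)" by simp_all
qed

lemma cell_in: "(I, \<phi>) \<in> \<Phi> \<Longrightarrow> t \<in> cube I \<Longrightarrow> \<phi> t \<in> X"
  using cell(3) by blast

lemma unique_cell:
  assumes "(I, \<phi>) \<in> \<Phi>" "(J, \<psi>) \<in> \<Phi>" "t \<in> open_cube I" "u \<in> open_cube J" "\<phi> t = \<psi> u"
  shows "I = J \<and> \<phi> = \<psi> \<and> t = u"
proof -
  have "\<phi> t \<in> X" using assms cell_in open_cube_subset by blast
  moreover have "\<forall>x\<in>X. \<exists>!c. c \<in> \<Phi> \<and> x \<in> snd c ` open_cube (fst c)"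
    using cubed unfolding cube_complex_def by (elim conjE)
  ultimately have "\<exists>!c. c \<in> \<Phi> \<and> \<phi> t \<in> snd c ` open_cube (fst c)" by blast
  then have "(I, \<phi>) = (J, \<psi>)" using assms by (metis fst_conv snd_conv image_eqI)
  then show ?thesis using assms cell(4)[OF assms(1)] by (auto dest: inj_onD)
qed

lemma ex_cell:
  assumes "z \<in> X"
  obtains I \<phi> t where "(I, \<phi>) \<in> \<Phi>" "t \<in> open_cube I" "\<phi> t = z"
proof -
  have "\<forall>x\<in>X. \<exists>!c. c \<in> \<Phi> \<and> x \<in> snd c ` open_cube (fst c)"
    using cubed unfolding cube_complex_def by (elim conjE)
  then have "\<exists>!c. c \<in> \<Phi> \<and> z \<in> snd c ` open_cube (fst c)" using assms by (rule bspec)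
  then obtain c t where "c \<in> \<Phi>" "t \<in> open_cube (fst c)" "snd c t = z" by blast
  then show ?thesis by (intro that[of "fst c" "snd c" t]) auto
qed

lemma face_attached:
  assumes "(I, \<phi>) \<in> \<Phi>" "i \<in> I" "e = 0 \<or> e = 1"
  obtains J \<psi> \<pi> F where "(J, \<psi>) \<in> \<Phi>" "bij_betw \<pi> J (I - {i})"
    "\<And>t. t \<in> cube (I - {i}) \<Longrightarrow> \<phi> (t(i := e)) = \<psi> (reindex J \<pi> F t)"
proof -
  have "\<forall>(I, \<phi>)\<in>\<Phi>. \<forall>i\<in>I. \<forall>e\<in>{0, 1}. \<exists>(J, \<psi>)\<in>\<Phi>. \<exists>h. cube_isometry (I - {i}) J h \<and>
      (\<forall>t\<in>cube (I - {i}). \<phi> (t(i := e)) = \<psi> (h t))"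
    using cubed unfolding cube_complex_def by (elim conjE)
  note bspec[OF bspec[OF bspec[OF this assms(1), unfolded prod.case] assms(2)], of e]
  moreover have "e \<in> {0, 1}" using assms(3) by simp
  ultimately have "\<exists>(J, \<psi>)\<in>\<Phi>. \<exists>h. cube_isometry (I - {i}) J h \<and> (\<forall>t\<in>cube (I - {i}). \<phi> (t(i := e)) = \<psi> (h t))"
    by blast
  then obtain c h where "c \<in> \<Phi>" "case c of (J, \<psi>) \<Rightarrow> \<exists>h. cube_isometry (I - {i}) J h \<and> (\<forall>t\<in>cube (I - {i}). \<phi> (t(i := e)) = \<psi> (h t))"
    by (rule bexE)
  then obtain J \<psi> h where *: "(J, \<psi>) \<in> \<Phi>" "cube_isometry (I - {i}) J h"
    "\<forall>t\<in>cube (I - {i}). \<phi> (t(i := e)) = \<psi> (h t)" by (cases c) auto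
  obtain \<pi> F where "bij_betw \<pi> J (I - {i})" "\<forall>t\<in>cube (I - {i}). h t = reindex J \<pi> F t"
    using *(2) unfolding cube_isometry_reindex by blast
  with * show ?thesis using that by simp
qed

subsection \<open>Faces\<close>

text \<open>
  Faces of higher codimension are attached by composing the attachments of faces of codimension one.
\<close>

lemma iterated_face:
  assumes c: "(I, \<phi>) \<in> \<Phi>" and "finite D" "D \<subseteq> I" "\<forall>i\<in>D. t i = 0 \<or> t i = 1"
  shows "\<exists>J \<psi> \<pi> F. (J, \<psi>) \<in> \<Phi> \<and> bij_betw \<pi> J (I - D) \<and>
           (\<forall>s\<in>cube I. (\<forall>i\<in>D. s i = t i) \<longrightarrow> \<phi> s = \<psi> (reindex J \<pi> F s))"
  using assms(2-)
proof (induction D)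
  case empty
  have *: "reindex I id {} s = s" if "s \<in> cube I" for s
    using cube_outside[OF that] by (auto simp: reindex_def fun_eq_iff)
  show ?case
  proof (intro exI conjI)
    show "(I, \<phi>) \<in> \<Phi>" by fact
    show "bij_betw id I (I - {})" by simp
    show "\<forall>s\<in>cube I. (\<forall>i\<in>{}. s i = t i) \<longrightarrow> \<phi> s = \<phi> (reindex I id {} s)" using * by simp
  qed
next
  case (insert d D)
  then obtain J' \<psi>' \<pi>' F' where c': "(J', \<psi>') \<in> \<Phi>" "bij_betw \<pi>' J' (I - D)"
    and eq': "\<And>s. s \<in> cube I \<Longrightarrow> (\<forall>i\<in>D. s i = t i) \<Longrightarrow> \<phi> s = \<psi>' (reindex J' \<pi>' F' s)"
    by auto
  have "d \<in> I - D" using insert by auto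
  then obtain j where j: "j \<in> J'" "\<pi>' j = d" using c'(2) by (metis bij_betwE bij_betw_def imageE)
  define e where "e = flip (j \<in> F') (t d)"
  have "e = 0 \<or> e = 1" using insert.prems by (auto simp: e_def flip_def)
  then obtain J \<psi> \<pi>1 F1 where c1: "(J, \<psi>) \<in> \<Phi>" "bij_betw \<pi>1 J (J' - {j})"
    and eq1: "\<And>r. r \<in> cube (J' - {j}) \<Longrightarrow> \<psi>' (r(j := e)) = \<psi> (reindex J \<pi>1 F1 r)"
    using face_attached[OF c'(1) j(1)] by metis
  define F where "F = {k. (k \<in> F1) \<noteq> (\<pi>1 k \<in> F')}"
  have "bij_betw \<pi>' (J' - {j}) (I - insert d D)"
    using c'(2) j inj_on_image_set_diff[of \<pi>' J' J' "{j}"]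
    by (auto simp: bij_betw_def intro: inj_on_subset)
  then have "bij_betw (\<pi>' \<circ> \<pi>1) J (I - insert d D)" using c1(2) by (rule bij_betw_trans[rotated])
  moreover have "\<phi> s = \<psi> (reindex J (\<pi>' \<circ> \<pi>1) F s)" if s: "s \<in> cube I" "\<forall>i\<in>insert d D. s i = t i" for s
  proof -
    define r where "r = (reindex J' \<pi>' F' s)(j := 0)"
    have "\<pi>' k \<in> I" if "k \<in> J'" for k using c'(2) that by (auto dest: bij_betwE)
    then have "r \<in> cube (J' - {j})"
      using s(1) by (auto simp: r_def cube_def reindex_def flip_def)
    moreover have "reindex J' \<pi>' F' s = r(j := e)"
      using s j by (auto simp: r_def e_def reindex_def)
    moreover have "reindex J \<pi>1 F1 r = reindex J (\<pi>' \<circ> \<pi>1) F s"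
    proof
      fix k
      have "\<pi>1 k \<in> J' - {j}" if "k \<in> J" using c1(2) that by (auto dest: bij_betwE)
      then show "reindex J \<pi>1 F1 r k = reindex J (\<pi>' \<circ> \<pi>1) F s k"
        by (auto simp: reindex_def r_def F_def)
    qed
    ultimately show ?thesis using eq'[of s] eq1[of r] s by simp
  qed
  ultimately show ?case using c1(1) by blast
qed

text \<open>
  The open face of a cube that contains a given point is mapped isometrically onto an open cell.
\<close>

lemma carrier:
  assumes c: "(I, \<phi>) \<in> \<Phi>" and t: "t \<in> cube I"
  obtains J \<psi> \<pi> F where "(J, \<psi>) \<in> \<Phi>" "bij_betw \<pi> J (free I t)" "reindex J \<pi> F t \<in> open_cube J"
    "\<And>s. s \<in> cube I \<Longrightarrow> same_face I t s \<Longrightarrow> \<phi> s = \<psi> (reindex J \<pi> F s)"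
proof -
  have "I - (I - free I t) = free I t" by (auto simp: free_def)
  then obtain J \<psi> \<pi> F where *: "(J, \<psi>) \<in> \<Phi>" "bij_betw \<pi> J (free I t)"
    "\<And>s. s \<in> cube I \<Longrightarrow> same_face I t s \<Longrightarrow> \<phi> s = \<psi> (reindex J \<pi> F s)"
    using iterated_face[OF c, of "I - free I t" t] cell(1)[OF c] not_free[OF t]
    unfolding same_face_def by auto
  have "\<pi> j \<in> free I t" if "j \<in> J" for j using *(2) that by (auto dest: bij_betwE)
  then have "reindex J \<pi> F t \<in> open_cube J" by (auto simp: open_cube_def reindex_def free_def)
  with * show ?thesis using that by blast
qed

text \<open>
  If points of two cubes have the same image, then the open faces containing them are attached to the
  same cell. Hence there is an isometry between these faces which is compatible with the two
  characteristic maps. All statements about points of \<open>X\<close> that are represented in several cubes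
  are reduced to this.
\<close>

lemma transfer:
  assumes c: "(I, \<phi>) \<in> \<Phi>" "(I', \<phi>') \<in> \<Phi>" and t: "t \<in> cube I" "t' \<in> cube I'" and eq: "\<phi> t = \<phi>' t'"
  shows "\<exists>\<sigma> F. bij_betw \<sigma> (free I' t') (free I t) \<and>
    (\<forall>i\<in>free I' t'. t' i = flip (i \<in> F) (t (\<sigma> i))) \<and>
    (\<forall>s\<in>cube I. same_face I t s \<longrightarrow>
       \<phi> s = \<phi>' (\<lambda>i. if i \<in> free I' t' then flip (i \<in> F) (s (\<sigma> i)) else t' i))"
proof -
  obtain J \<psi> \<pi> F1 where 1: "(J, \<psi>) \<in> \<Phi>" "bij_betw \<pi> J (free I t)" "reindex J \<pi> F1 t \<in> open_cube J"
    and eq1: "\<And>s. s \<in> cube I \<Longrightarrow> same_face I t s \<Longrightarrow> \<phi> s = \<psi> (reindex J \<pi> F1 s)"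
    using carrier[OF c(1) t(1)] by metis
  obtain J' \<psi>' \<pi>' F2 where 2: "(J', \<psi>') \<in> \<Phi>" "bij_betw \<pi>' J' (free I' t')" "reindex J' \<pi>' F2 t' \<in> open_cube J'"
    and eq2: "\<And>s. s \<in> cube I' \<Longrightarrow> same_face I' t' s \<Longrightarrow> \<phi>' s = \<psi>' (reindex J' \<pi>' F2 s)"
    using carrier[OF c(2) t(2)] by metis
  have "\<psi> (reindex J \<pi> F1 t) = \<psi>' (reindex J' \<pi>' F2 t')"
    using eq eq1[OF t(1)] eq2[OF t(2)] by (simp add: same_face_def)
  from unique_cell[OF 1(1) 2(1) 1(3) 2(3) this]
  have J: "J' = J" "\<psi>' = \<psi>" and u: "reindex J \<pi> F1 t = reindex J \<pi>' F2 t'" by auto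
  note \<pi>' = 2(2)[unfolded J]
  define \<rho> where "\<rho> = inv_into J \<pi>'"
  have \<rho>: "bij_betw \<rho> (free I' t') J" unfolding \<rho>_def by (rule bij_betw_inv_into[OF \<pi>'])
  have \<rho>1: "\<rho> i \<in> J" "\<pi>' (\<rho> i) = i" if "i \<in> free I' t'" for i
    using \<rho> that \<pi>' by (auto simp: \<rho>_def bij_betw_inv_into_right dest: bij_betwE)
  have \<rho>2: "\<rho> (\<pi>' j) = j" "\<pi>' j \<in> free I' t'" if "j \<in> J" for j
    using that \<pi>' by (auto simp: \<rho>_def bij_betw_inv_into_left dest: bij_betwE)
  define F where "F = {i. (\<rho> i \<in> F1) \<noteq> (\<rho> i \<in> F2)}"
  show ?thesis
  proof (intro exI conjI)
    show b: "bij_betw (\<pi> \<circ> \<rho>) (free I' t') (free I t)" using \<rho> 1(2) by (rule bij_betw_trans)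
    show "\<forall>i\<in>free I' t'. t' i = flip (i \<in> F) (t ((\<pi> \<circ> \<rho>) i))"
    proof
      fix i assume i: "i \<in> free I' t'"
      have "flip (\<rho> i \<in> F1) (t (\<pi> (\<rho> i))) = flip (\<rho> i \<in> F2) (t' i)"
        using fun_cong[OF u, of "\<rho> i"] \<rho>1[OF i] by (simp add: reindex_def)
      then show "t' i = flip (i \<in> F) (t ((\<pi> \<circ> \<rho>) i))" by (auto simp: F_def flip_def split: if_splits)
    qed
    show "\<forall>s\<in>cube I. same_face I t s \<longrightarrow>
       \<phi> s = \<phi>' (\<lambda>i. if i \<in> free I' t' then flip (i \<in> F) (s ((\<pi> \<circ> \<rho>) i)) else t' i)"
    proof (intro ballI impI)
    fix s assume s: "s \<in> cube I" "same_face I t s"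
    let ?s' = "\<lambda>i. if i \<in> free I' t' then flip (i \<in> F) (s ((\<pi> \<circ> \<rho>) i)) else t' i"
    have "?s' \<in> cube I'"
    proof -
      have "0 \<le> ?s' i \<and> ?s' i \<le> 1" for i
        using cube_bounds[OF s(1)] cube_bounds[OF t(2)] by simp
      moreover have "?s' i = 0" if "i \<notin> I'" for i
        using that cube_outside[OF t(2)] by (simp add: free_def)
      ultimately show ?thesis unfolding cube_def by blast
    qed
    moreover have "same_face I' t' ?s'" by (simp add: same_face_def)
    moreover have "reindex J \<pi>' F2 ?s' = reindex J \<pi> F1 s"
      using \<rho>2 by (auto simp: reindex_def F_def fun_eq_iff flip_def)
    ultimately show "\<phi> s = \<phi>' ?s'" using eq1[OF s] eq2[of ?s'] J by simp
    qed
  qed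
qed

text \<open>
  Up to reflection, the coordinates of all preimages of \<open>z\<close> are those of a single one.
\<close>

lemma finite_coordinates:
  assumes "z \<in> X"
  shows "\<exists>W. finite W \<and> (\<forall>I \<phi> t i. (I, \<phi>) \<in> \<Phi> \<longrightarrow> t \<in> cube I \<longrightarrow> \<phi> t = z \<longrightarrow> t i \<in> W)"
proof -
  obtain I0 \<phi>0 u where c: "(I0, \<phi>0) \<in> \<Phi>" "u \<in> open_cube I0" "\<phi>0 u = z" using ex_cell[OF assms] .
  define W where "W = {0, 1} \<union> (\<lambda>(i, b). flip b (u i)) ` (I0 \<times> UNIV)"
  show ?thesis
  proof (intro exI conjI allI impI)
    show "finite W" using cell(1)[OF c(1)] by (simp add: W_def)
    fix I \<phi> t i assume *: "(I, \<phi>) \<in> \<Phi>" "t \<in> cube I" "\<phi> t = z"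
    have u: "u \<in> cube I0" using c open_cube_subset by blast
    have "\<phi>0 u = \<phi> t" using c(3) *(3) by simp
    from transfer[OF c(1) *(1) u *(2) this] obtain \<sigma> F where \<sigma>: "bij_betw \<sigma> (free I t) (free I0 u)"
      "\<forall>i\<in>free I t. t i = flip (i \<in> F) (u (\<sigma> i))"
      by (elim exE conjE) (rule that)
    show "t i \<in> W"
    proof (cases "i \<in> free I t")
      case True
      then have "\<sigma> i \<in> I0" using \<sigma>(1) by (auto simp: free_def dest: bij_betwE)
      then show ?thesis using bspec[OF \<sigma>(2) True] by (auto simp: W_def image_iff)
    qed (use not_free[OF *(2)] in \<open>auto simp: W_def\<close>)
  qed
qed

subsection \<open>Stars\<close>

text \<open>
  A preimage of \<open>z\<close> has distance at least \<open>2 * e\<close> from all faces of its cube which do not contain it.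
\<close>

definition gap :: "'a \<Rightarrow> real \<Rightarrow> bool" where
  "gap z e \<longleftrightarrow> 0 < e \<and> e < 1 / 2 \<and> (\<forall>(I, \<phi>)\<in>\<Phi>. \<forall>t\<in>cube I. \<phi> t = z \<longrightarrow>
     (\<forall>i. t i = 0 \<or> t i = 1 \<or> 2 * e \<le> t i \<and> t i \<le> 1 - 2 * e))"

lemma ex_gap:
  assumes "z \<in> X"
  shows "\<exists>e>0. \<forall>d. 0 < d \<longrightarrow> d \<le> e \<longrightarrow> gap z d"
proof -
  obtain W where W: "finite W" "\<And>I \<phi> t i. (I, \<phi>) \<in> \<Phi> \<Longrightarrow> t \<in> cube I \<Longrightarrow> \<phi> t = z \<Longrightarrow> t i \<in> W"
    using finite_coordinates[OF assms] by blast
  have "\<exists>e>0. \<forall>d. 0 < d \<longrightarrow> d \<le> e \<longrightarrow> (\<forall>w\<in>W \<inter> {0..1}. w = 0 \<or> w = 1 \<or> 2 * d \<le> w \<and> w \<le> 1 - 2 * d)"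
  proof (rule finite_uniform)
    fix w assume "w \<in> W \<inter> {0..1}"
    then have "w = 0 \<or> w = 1 \<or> 0 < w \<and> w < 1" by auto
    then show "\<exists>e>0. \<forall>d. 0 < d \<longrightarrow> d \<le> e \<longrightarrow> w = 0 \<or> w = 1 \<or> 2 * d \<le> w \<and> w \<le> 1 - 2 * d"
    proof (elim disjE)
      assume "0 < w \<and> w < 1"
      then show ?thesis by (intro exI[of _ "min w (1 - w) / 2"]) auto
    qed (auto intro: exI[of _ 1])
  qed (use W in simp)
  then obtain e where e: "e > 0" "\<And>d w. 0 < d \<Longrightarrow> d \<le> e \<Longrightarrow> w \<in> W \<inter> {0..1} \<Longrightarrow>
      w = 0 \<or> w = 1 \<or> 2 * d \<le> w \<and> w \<le> 1 - 2 * d" by blast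
  have "gap z d" if d: "0 < d" "d \<le> min e (1 / 4)" for d
  proof -
    have "t i = 0 \<or> t i = 1 \<or> 2 * d \<le> t i \<and> t i \<le> 1 - 2 * d"
      if "(I, \<phi>) \<in> \<Phi>" "t \<in> cube I" "\<phi> t = z" for I \<phi> t i
      using e(2)[of d "t i"] W(2)[OF that, of i] cube_bounds[OF that(2), of i] d by simp
    then show ?thesis using d by (auto simp: gap_def)
  qed
  then show ?thesis using e(1) by (intro exI[of _ "min e (1 / 4)"]) auto
qed

lemma gapD:
  assumes "gap z e" "(I, \<phi>) \<in> \<Phi>" "t \<in> cube I" "\<phi> t = z"
  shows "t i = 0 \<or> t i = 1 \<or> 2 * e \<le> t i \<and> t i \<le> 1 - 2 * e"
  using assms unfolding gap_def by blast

lemma gap_bounds: "gap z e \<Longrightarrow> 0 < e \<and> e < 1 / 2"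
  by (simp add: gap_def)

text \<open>
  When \<open>t\<close> lies in a face of the cube and the preimage \<open>t0\<close> of \<open>z\<close> is close to it, the gap forces
  \<open>t0\<close> to lie in the same face.
\<close>

lemma near_same_face:
  assumes g: "gap z e" and c: "(I, \<phi>) \<in> \<Phi>" and t: "t \<in> cube I" and t0: "t0 \<in> cube I" "\<phi> t0 = z"
    and near: "near I t t0 e"
  shows "same_face I t t0"
  unfolding same_face_def
proof
  fix i assume i: "i \<in> I - free I t"
  then have "t i = 0 \<or> t i = 1" using not_free[OF t] by simp
  moreover have "\<bar>t i - t0 i\<bar> < e" using near i by (simp add: near_def)
  ultimately show "t0 i = t i" using gapD[OF g c t0, of i] gap_bounds[OF g] by (auto simp: abs_if split: if_splits)
qed

text \<open>
  If a point close to \<open>z\<close> is represented in two cubes, then the segments which join it to nearby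
  preimages of \<open>z\<close> in the two cubes have the same image in \<open>X\<close>.
\<close>

lemma star_transfer:
  assumes g: "gap z e" and c: "(I, \<phi>) \<in> \<Phi>" "(J, \<psi>) \<in> \<Phi>"
    and t: "t \<in> cube I" "t' \<in> cube J" "\<phi> t = \<psi> t'"
    and t0: "t0 \<in> cube I" "\<phi> t0 = z" and near: "near I t t0 e"
  shows "\<exists>t0'. t0' \<in> cube J \<and> \<psi> t0' = z \<and> near J t' t0' e \<and>
    (\<forall>s\<in>{0..1}. \<phi> (line t0 t s) = \<psi> (line t0' t' s))"
proof -
  obtain \<sigma> F where \<sigma>: "bij_betw \<sigma> (free J t') (free I t)"
    and t'': "\<forall>i\<in>free J t'. t' i = flip (i \<in> F) (t (\<sigma> i))"
    and eq': "\<forall>s\<in>cube I. same_face I t s \<longrightarrow>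
       \<phi> s = \<psi> (\<lambda>i. if i \<in> free J t' then flip (i \<in> F) (s (\<sigma> i)) else t' i)"
    using transfer[OF c t] by (elim exE conjE) (rule that)
  note t' = bspec[OF t''] and eq = mp[OF bspec[OF eq']]
  \<comment> \<open>Apply the isometry between the open faces of \<open>t\<close> and \<open>t'\<close> to \<open>t0\<close>, which lies in the closed face of \<open>t\<close>.\<close>
  define t0' where "t0' = (\<lambda>i. if i \<in> free J t' then flip (i \<in> F) (t0 (\<sigma> i)) else t' i)"
  have face: "same_face I t t0" by (rule near_same_face[OF g c(1) t(1) t0 near])
  show ?thesis
  proof (intro exI conjI)
    have "0 \<le> t0' i \<and> t0' i \<le> 1" for i
      using cube_bounds[OF t0(1)] cube_bounds[OF t(2)] by (simp add: t0'_def)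
    moreover have "t0' i = 0" if "i \<notin> J" for i
      using that cube_outside[OF t(2)] by (simp add: t0'_def free_def)
    ultimately show "t0' \<in> cube J" unfolding cube_def by blast
    show "\<psi> t0' = z" using eq[OF t0(1) face] t0(2) by (simp add: t0'_def)
    show "near J t' t0' e" unfolding near_def
    proof
      fix i assume "i \<in> J"
      show "\<bar>t' i - t0' i\<bar> < e"
      proof (cases "i \<in> free J t'")
        case True
        then have "\<sigma> i \<in> I" using \<sigma> by (auto simp: free_def dest: bij_betwE)
        then show ?thesis using near t'[OF True] True by (simp add: t0'_def near_def flip_dist)
      qed (use gap_bounds[OF g] in \<open>simp add: t0'_def\<close>)
    qed
    show "\<forall>s\<in>{0..1}. \<phi> (line t0 t s) = \<psi> (line t0' t' s)"
    proof
    fix s :: real assume s: "s \<in> {0..1}"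
    have l: "same_face I t (line t0 t s)"
      using face by (auto simp: same_face_def line_def algebra_simps)
    have "(\<lambda>i. if i \<in> free J t' then flip (i \<in> F) (line t0 t s (\<sigma> i)) else t' i) = line t0' t' s"
    proof
      fix i
      show "(if i \<in> free J t' then flip (i \<in> F) (line t0 t s (\<sigma> i)) else t' i) = line t0' t' s i"
      proof (cases "i \<in> free J t'")
        case True
        then show ?thesis by (simp add: line_def t0'_def flip_line t'[OF True])
      qed (simp add: line_def t0'_def algebra_simps)
    qed
    then show "\<phi> (line t0 t s) = \<psi> (line t0' t' s)"
      using eq[OF line_in_cube[OF t0(1) t(1) s] l] by simp
    qed
  qed
qed

text \<open>
  Two preimages of \<open>z\<close> at distance less than twice the gap lie in the same open face, on which the
  characteristic map is injective.
\<close>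

lemma center_unique:
  assumes g: "gap z e" and c: "(J, \<psi>) \<in> \<Phi>" and t0: "t0 \<in> cube J" "\<psi> t0 = z" and t1: "t1 \<in> cube J" "\<psi> t1 = z"
    and close: "near J t0 t1 (2 * e)"
  shows "t0 = t1"
proof -
  have same: "free J t0 = free J t1" "same_face J t0 t1"
  proof -
    have *: "(t0 i = 0 \<or> t0 i = 1 \<longleftrightarrow> t1 i = 0 \<or> t1 i = 1) \<and> (t0 i = 0 \<or> t0 i = 1 \<longrightarrow> t1 i = t0 i)"
      if "i \<in> J" for i
    proof -
      have "\<bar>t0 i - t1 i\<bar> < 2 * e" using close that by (simp add: near_def)
      then show ?thesis
        using gapD[OF g c t0, of i] gapD[OF g c t1, of i] gap_bounds[OF g] by (auto simp: abs_if split: if_splits)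
    qed
    have f: "i \<in> free J t \<longleftrightarrow> i \<in> J \<and> \<not> (t i = 0 \<or> t i = 1)" if "t \<in> cube J" for t i
      using cube_bounds[OF that, of i] by (auto simp: free_def)
    then show "same_face J t0 t1" "free J t0 = free J t1"
      using * f[OF t0(1)] f[OF t1(1)] unfolding same_face_def by blast+
  qed
  obtain K \<kappa> \<pi> F where K: "(K, \<kappa>) \<in> \<Phi>" "bij_betw \<pi> K (free J t0)" "reindex K \<pi> F t0 \<in> open_cube K"
    and eq: "\<And>s. s \<in> cube J \<Longrightarrow> same_face J t0 s \<Longrightarrow> \<psi> s = \<kappa> (reindex K \<pi> F s)"
    using carrier[OF c t0(1)] by metis
  have "\<pi> j \<in> free J t1" if "j \<in> K" for j using K(2) that same(1) by (auto dest: bij_betwE)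
  then have "reindex K \<pi> F t1 \<in> open_cube K" by (auto simp: open_cube_def reindex_def free_def)
  moreover have "\<kappa> (reindex K \<pi> F t0) = \<kappa> (reindex K \<pi> F t1)"
    using eq[OF t0(1)] eq[OF t1(1) same(2)] t0(2) t1(2) by (simp add: same_face_def)
  ultimately have r: "reindex K \<pi> F t0 = reindex K \<pi> F t1" using unique_cell[OF K(1) K(1) K(3)] by blast
  show ?thesis
  proof
    fix i
    consider "i \<in> free J t0" | "i \<in> J - free J t0" | "i \<notin> J" by blast
    then show "t0 i = t1 i"
    proof cases
      case 1
      then obtain k where k: "k \<in> K" "\<pi> k = i" using K(2) by (metis bij_betw_def imageE)
      then show ?thesis using fun_cong[OF r, of k] by (simp add: reindex_def)
    next
      case 2
      then show ?thesis using same(2) by (simp add: same_face_def)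
    next
      case 3
      then show ?thesis using cube_outside t0 t1 by metis
    qed
  qed
qed

definition star :: "'a \<Rightarrow> real \<Rightarrow> 'a set" where
  "star z e = {y. \<exists>I \<phi> t t0. (I, \<phi>) \<in> \<Phi> \<and> t \<in> cube I \<and> t0 \<in> cube I \<and> \<phi> t0 = z \<and> near I t t0 e \<and> y = \<phi> t}"

lemma star_preimage:
  assumes g: "gap z e" and c: "(I, \<phi>) \<in> \<Phi>" and t: "t \<in> cube I"
  shows "\<phi> t \<in> star z e \<longleftrightarrow> (\<exists>t0\<in>cube I. \<phi> t0 = z \<and> near I t t0 e)"
proof
  assume "\<phi> t \<in> star z e"
  then obtain J \<psi> u u0 where *: "(J, \<psi>) \<in> \<Phi>" "u \<in> cube J" "u0 \<in> cube J" "\<psi> u0 = z" "near J u u0 e" "\<phi> t = \<psi> u"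
    unfolding star_def by blast
  then show "\<exists>t0\<in>cube I. \<phi> t0 = z \<and> near I t t0 e"
    using star_transfer[OF g *(1) c *(2) t *(6)[symmetric] *(3,4,5)] by blast
qed (use c t in \<open>auto simp: star_def\<close>)

lemma open_near: "finite I \<Longrightarrow> open {t. near I t t0 e}"
proof -
  assume "finite I"
  have "{t. near I t t0 e} = (\<Inter>i\<in>I. {t. \<bar>t i - t0 i\<bar> < e})" by (auto simp: near_def)
  moreover have "open {t :: nat \<Rightarrow> real. \<bar>t i - t0 i\<bar> < e}" for i
    by (intro open_Collect_less continuous_intros continuous_on_product_coordinates)
  ultimately show ?thesis using \<open>finite I\<close> by auto
qed

lemma closedin_iff:
  assumes "A \<subseteq> X"
  shows "closedin (top_of_set X) A \<longleftrightarrow>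
    (\<forall>(I, \<phi>)\<in>\<Phi>. closedin (top_of_set (cube I)) {t \<in> cube I. \<phi> t \<in> A})"
  using cubed assms by (simp add: cube_complex_def)

lemma open_star:
  assumes g: "gap z e"
  shows "openin (top_of_set X) (star z e)"
proof -
  have sub: "star z e \<subseteq> X" using cell_in by (auto simp: star_def)
  have "closedin (top_of_set X) (X - star z e)"
    unfolding closedin_iff[OF Diff_subset]
  proof safe
    fix I \<phi> assume c: "(I, \<phi>) \<in> \<Phi>"
    have eq: "{t \<in> cube I. \<phi> t \<in> X - star z e} =
        cube I - cube I \<inter> (\<Union>t0\<in>{t0 \<in> cube I. \<phi> t0 = z}. {t. near I t t0 e})"
      using star_preimage[OF g c] cell_in[OF c] by auto
    have op: "open (\<Union>t0\<in>{t0 \<in> cube I. \<phi> t0 = z}. {t. near I t t0 e})"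
      using open_near[OF cell(1)[OF c]] by blast
    show "closedin (top_of_set (cube I)) {t \<in> cube I. \<phi> t \<in> X - star z e}"
      using closedin_diff[OF closedin_topspace openin_open_Int[OF op, of "cube I"]]
      unfolding eq topspace_euclidean_subtopology .
  qed
  then show ?thesis using sub by (simp add: openin_closedin_eq)
qed

lemma star_center: "z \<in> X \<Longrightarrow> gap z e \<Longrightarrow> z \<in> star z e"
proof -
  assume z: "z \<in> X" "gap z e"
  obtain I \<phi> t where "(I, \<phi>) \<in> \<Phi>" "t \<in> open_cube I" "\<phi> t = z" using ex_cell[OF z(1)] .
  moreover from this have "t \<in> cube I" using open_cube_subset by blast
  moreover have "near I t t e" using gap_bounds[OF z(2)] by (simp add: near_def)
  ultimately show ?thesis unfolding star_def by blast
qed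

text \<open>
  The barycentres of the cells form a closed discrete set: in each cube the preimage of any set of
  barycentres is finite, because the coordinates are \<open>0\<close>, \<open>1 / 2\<close> or \<open>1\<close>.
\<close>

lemma finite_cells:
  assumes "compact X"
  shows "finite \<Phi>"
proof (rule ccontr)
  assume inf: "infinite \<Phi>"
  \<comment> \<open>An infinite set of cells would give an infinite set of barycentres without a limit point.\<close>
  define bary :: "nat set \<Rightarrow> nat \<Rightarrow> real" where "bary I = (\<lambda>i. if i \<in> I then 1 / 2 else 0)" for I
  have bary: "bary I \<in> open_cube I" for I by (simp add: bary_def open_cube_def)
  define m where "m = (\<lambda>(I, \<phi>). \<phi> (bary I) :: 'a)"
  have "inj_on m \<Phi>"
  proof (rule inj_onI)
    fix c c' assume "c \<in> \<Phi>" "c' \<in> \<Phi>" "m c = m c'"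
    then show "c = c'"
      using unique_cell[of "fst c" "snd c" "fst c'" "snd c'" "bary (fst c)" "bary (fst c')"] bary
      by (simp add: m_def case_prod_beta prod_eq_iff)
  qed
  then have D: "infinite (m ` \<Phi>)" using inf finite_imageD by blast
  have "m c \<in> X" if "c \<in> \<Phi>" for c
    using cell_in[of "fst c" "snd c"] that subsetD[OF open_cube_subset bary] by (simp add: m_def case_prod_beta)
  then have DX: "m ` \<Phi> \<subseteq> X" by blast
  obtain x where x: "x \<in> X" "x islimpt m ` \<Phi>"
    using Heine_Borel_imp_Bolzano_Weierstrass[OF assms D DX] by blast
  have "closedin (top_of_set X) (m ` \<Phi> - {x})"
  proof (subst closedin_iff)
    show "m ` \<Phi> - {x} \<subseteq> X" using DX by blast
    show "\<forall>(I, \<phi>)\<in>\<Phi>. closedin (top_of_set (cube I)) {t \<in> cube I. \<phi> t \<in> m ` \<Phi> - {x}}"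
    proof safe
      fix I \<phi> assume c: "(I, \<phi>) \<in> \<Phi>"
      have "{t \<in> cube I. \<phi> t \<in> m ` \<Phi> - {x}} \<subseteq> {t. \<forall>i. (i \<in> I \<longrightarrow> t i \<in> {0, 1 / 2, 1}) \<and> (i \<notin> I \<longrightarrow> t i = 0)}"
      proof
        fix t assume "t \<in> {t \<in> cube I. \<phi> t \<in> m ` \<Phi> - {x}}"
        then obtain J \<psi> where t: "t \<in> cube I" and J: "(J, \<psi>) \<in> \<Phi>" and eq: "\<psi> (bary J) = \<phi> t"
          by (auto simp: m_def)
        have b: "bary J \<in> cube J" using bary open_cube_subset by blast
        from transfer[OF J c b t eq] obtain \<sigma> F where \<sigma>: "bij_betw \<sigma> (free I t) (free J (bary J))"
          "\<forall>i\<in>free I t. t i = flip (i \<in> F) (bary J (\<sigma> i))"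
          by (elim exE conjE) (rule that)
        have half: "t i = 1 / 2" if "i \<in> free I t" for i
        proof -
          have "\<sigma> i \<in> J" using \<sigma>(1) that by (auto simp: free_def dest: bij_betwE)
          then show ?thesis using bspec[OF \<sigma>(2) that] by (simp add: bary_def flip_def)
        qed
        have "t i \<in> {0, 1 / 2, 1}" for i using half not_free[OF t] by blast
        then show "t \<in> {t. \<forall>i. (i \<in> I \<longrightarrow> t i \<in> {0, 1 / 2, 1}) \<and> (i \<notin> I \<longrightarrow> t i = 0)}"
          using cube_outside[OF t] by blast
      qed
      moreover have "finite {t :: nat \<Rightarrow> real. \<forall>i. (i \<in> I \<longrightarrow> t i \<in> {0, 1 / 2, 1}) \<and> (i \<notin> I \<longrightarrow> t i = 0)}"
        using cell(1)[OF c] by (intro finite_set_of_finite_funs) auto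
      ultimately have "finite {t \<in> cube I. \<phi> t \<in> m ` \<Phi> - {x}}" using finite_subset by blast
      then show "closedin (top_of_set (cube I)) {t \<in> cube I. \<phi> t \<in> m ` \<Phi> - {x}}"
        by (intro closed_subset finite_imp_closed) auto
    qed
  qed
  then obtain C where C: "closed C" "m ` \<Phi> - {x} = X \<inter> C" by (auto simp: closedin_closed)
  then have "open (- C)" "x \<in> - C" using x(1) by auto
  from islimptE[OF x(2) this(2,1)] obtain y where "y \<in> m ` \<Phi>" "y \<in> - C" "y \<noteq> x" .
  then show False using C(2) DX by blast
qed

end

context cubed_space
begin

subsection \<open>Contraction of a star to its centre\<close>

text \<open>
  The point at time \<open>s\<close> on the segment from \<open>z\<close> to \<open>y\<close> in a cube, for \<open>y\<close> in the star of \<open>z\<close>.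
\<close>

definition contraction :: "'a \<Rightarrow> real \<Rightarrow> 'a \<Rightarrow> real \<Rightarrow> 'a" where
  "contraction z e y s = (SOME x. \<exists>I \<phi> t t0. (I, \<phi>) \<in> \<Phi> \<and> t \<in> cube I \<and> t0 \<in> cube I \<and> \<phi> t0 = z \<and>
     near I t t0 e \<and> y = \<phi> t \<and> x = \<phi> (line t0 t s))"

text \<open>
  The contraction does not depend on the cube in which it is computed.
\<close>

lemma contraction_eq:
  assumes g: "gap z e" and c: "(I, \<phi>) \<in> \<Phi>" and t: "t \<in> cube I" and t0: "t0 \<in> cube I" "\<phi> t0 = z"
    and near: "near I t t0 e" and s: "s \<in> {0..1}"
  shows "contraction z e (\<phi> t) s = \<phi> (line t0 t s)"
  unfolding contraction_def
proof (rule some_equality)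
  show "\<exists>J \<psi> u u0. (J, \<psi>) \<in> \<Phi> \<and> u \<in> cube J \<and> u0 \<in> cube J \<and> \<psi> u0 = z \<and>
     near J u u0 e \<and> \<phi> t = \<psi> u \<and> \<phi> (line t0 t s) = \<psi> (line u0 u s)"
    using c t t0 near by (intro exI[of _ I] exI[of _ \<phi>] exI conjI) (auto intro: refl)
next
  fix x assume "\<exists>J \<psi> u u0. (J, \<psi>) \<in> \<Phi> \<and> u \<in> cube J \<and> u0 \<in> cube J \<and> \<psi> u0 = z \<and>
     near J u u0 e \<and> \<phi> t = \<psi> u \<and> x = \<psi> (line u0 u s)"
  then obtain J \<psi> u u0 where J: "(J, \<psi>) \<in> \<Phi>" "u \<in> cube J" "u0 \<in> cube J" "\<psi> u0 = z"
     "near J u u0 e" "\<phi> t = \<psi> u" and x: "x = \<psi> (line u0 u s)" by (elim exE conjE) (rule that)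
  from star_transfer[OF g c J(1) t J(2) J(6) t0 near]
  obtain u1 where u1: "u1 \<in> cube J" "\<psi> u1 = z" "near J u u1 e"
    "\<forall>s\<in>{0..1}. \<phi> (line t0 t s) = \<psi> (line u1 u s)" by (elim exE conjE) (rule that)
  have "near J u0 u1 (2 * e)" unfolding near_def
  proof
    fix i assume "i \<in> J"
    then have "\<bar>u i - u0 i\<bar> < e" "\<bar>u i - u1 i\<bar> < e" using J(5) u1(3) by (auto simp: near_def)
    then show "\<bar>u0 i - u1 i\<bar> < 2 * e" by linarith
  qed
  then have "u0 = u1" using center_unique[OF g J(1) J(3,4) u1(1,2)] by simp
  then show "x = \<phi> (line t0 t s)" using u1(4) s x by simp
qed

lemma starE:
  assumes "y \<in> star z e"
  obtains I \<phi> t t0 where "(I, \<phi>) \<in> \<Phi>" "t \<in> cube I" "t0 \<in> cube I" "\<phi> t0 = z" "near I t t0 e" "y = \<phi> t"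
  using assms unfolding star_def by (elim CollectE exE conjE) (rule that)

lemma product_neighbourhood:
  fixes x :: "nat \<Rightarrow> real"
  assumes A: "open A" "x \<in> A" and I: "finite I"
  shows "\<exists>e>0. \<forall>y. near I y x e \<longrightarrow> (\<forall>i. i \<notin> I \<longrightarrow> y i = x i) \<longrightarrow> y \<in> A"
proof -
  have "openin (product_topology (\<lambda>i. euclidean) UNIV) A" using A(1) by (simp add: open_fun_def)
  from product_topology_open_contains_basis[OF this A(2)]
  obtain U where U0: "x \<in> (\<Pi>\<^sub>E i\<in>UNIV. U i) \<and> (\<forall>i. openin euclidean (U i)) \<and>
      finite {i. U i \<noteq> topspace euclidean} \<and> (\<Pi>\<^sub>E i\<in>UNIV. U i) \<subseteq> A" ..
  then have U: "x \<in> (\<Pi>\<^sub>E i\<in>UNIV. U i)" "\<And>i. openin euclidean (U i)" "(\<Pi>\<^sub>E i\<in>UNIV. U i) \<subseteq> A"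
    by blast+
  have xU: "x i \<in> U i" for i using U(1) by (auto simp: PiE_iff)
  have "\<exists>e>0. \<forall>d. 0 < d \<longrightarrow> d \<le> e \<longrightarrow> (\<forall>i\<in>I. \<forall>y. \<bar>y - x i\<bar> < d \<longrightarrow> y \<in> U i)"
  proof (rule finite_uniform[OF I])
    fix i
    have "open (U i)" by (rule iffD2[OF open_openin U(2)])
    from openE[OF this xU] obtain e where "e > 0" "ball (x i) e \<subseteq> U i" .
    then show "\<exists>e>0. \<forall>d. 0 < d \<longrightarrow> d \<le> e \<longrightarrow> (\<forall>y. \<bar>y - x i\<bar> < d \<longrightarrow> y \<in> U i)"
      by (intro exI[of _ e]) (auto simp: subset_iff dist_real_def abs_minus_commute)
  qed
  then obtain e where e: "e > 0" "\<And>i y. i \<in> I \<Longrightarrow> \<bar>y - x i\<bar> < e \<Longrightarrow> y \<in> U i" by blast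
  have "y \<in> A" if "near I y x e" "\<forall>i. i \<notin> I \<longrightarrow> y i = x i" for y
  proof -
    have "y i \<in> U i" for i
      using e(2)[of i "y i"] xU[of i] that by (cases "i \<in> I") (auto simp: near_def)
    then show ?thesis using U(3) by (auto simp: PiE_iff)
  qed
  then show ?thesis using e(1) by blast
qed

text \<open>
  The case of one preimage in one cube, with a fixed end \<open>t0\<close> of the segments, for use in
  \<open>contraction_continuous\<close>.
\<close>

lemma local_box:
  assumes c: "(I, \<phi>) \<in> \<Phi>" and t1: "t1 \<in> cube I" and t0: "t0 \<in> cube I" and near: "near I t1 t0 e"
    and s: "s \<in> {0..1}" and B: "open B" "\<phi> (line t0 t1 s) \<in> B"
  shows "\<exists>d>0. \<forall>d'. 0 < d' \<longrightarrow> d' \<le> d \<longrightarrow> (\<forall>t\<in>cube I. near I t t1 d' \<longrightarrow> near I t t0 e \<and>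
      (\<forall>s'\<in>{0..1}. \<bar>s' - s\<bar> < d' \<longrightarrow> \<phi> (line t0 t s') \<in> B))"
proof -
  have "\<exists>d>0. \<forall>d'. 0 < d' \<longrightarrow> d' \<le> d \<longrightarrow> (\<forall>i\<in>I. \<bar>t1 i - t0 i\<bar> + d' \<le> e)"
  proof (rule finite_uniform[OF cell(1)[OF c]])
    fix i assume "i \<in> I"
    then show "\<exists>d>0. \<forall>d'. 0 < d' \<longrightarrow> d' \<le> d \<longrightarrow> \<bar>t1 i - t0 i\<bar> + d' \<le> e"
      using near by (intro exI[of _ "e - \<bar>t1 i - t0 i\<bar>"]) (auto simp: near_def)
  qed
  then obtain d1 where d1: "d1 > 0" "\<And>i. i \<in> I \<Longrightarrow> \<bar>t1 i - t0 i\<bar> + d1 \<le> e" by auto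
  have coord: "continuous_on (cube I \<times> {0..1}) (\<lambda>x. fst x i)" for i
    by (rule continuous_on_compose2[OF continuous_on_product_coordinates continuous_on_fst[OF continuous_on_id]]) auto
  have "continuous_on (cube I \<times> {0..1}) (\<lambda>x. line t0 (fst x) (snd x))" unfolding line_def
    by (rule continuous_on_coordinatewise_then_product)
       (intro continuous_on_add continuous_on_mult continuous_on_diff continuous_on_const
          continuous_on_snd continuous_on_id coord)
  then have "continuous_on (cube I \<times> {0..1}) (\<lambda>x. \<phi> (line t0 (fst x) (snd x)))"
    using cell(2)[OF c] line_in_cube[OF t0] by (rule_tac continuous_on_compose2[of "cube I" \<phi>]) auto
  then obtain A where A: "open A" "(t1, s) \<in> A"
    "\<And>x. x \<in> cube I \<times> {0..1} \<Longrightarrow> x \<in> A \<Longrightarrow> \<phi> (line t0 (fst x) (snd x)) \<in> B"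
    unfolding continuous_on_topological using t1 s B by (metis SigmaI fst_conv snd_conv)
  obtain A1 A2 where A12: "open A1" "open A2" "(t1, s) \<in> A1 \<times> A2" "A1 \<times> A2 \<subseteq> A"
    using open_prod_elim[OF A(1,2)] by blast
  obtain d2 where d2: "d2 > 0" "\<And>y. near I y t1 d2 \<Longrightarrow> (\<forall>i. i \<notin> I \<longrightarrow> y i = t1 i) \<Longrightarrow> y \<in> A1"
    using product_neighbourhood[of A1 t1 I] A12 cell(1)[OF c] by auto
  obtain d3 where d3: "d3 > 0" "ball s d3 \<subseteq> A2" using A12 openE by blast
  show ?thesis
  proof (intro exI[of _ "min d1 (min d2 d3)"] conjI allI impI ballI)
    show "min d1 (min d2 d3) > 0" using d1 d2 d3 by simp
    fix d' t assume d': "0 < d'" "d' \<le> min d1 (min d2 d3)" and t: "t \<in> cube I" "near I t t1 d'"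
    show "near I t t0 e" unfolding near_def
    proof
      fix i assume "i \<in> I"
      then have "\<bar>t i - t1 i\<bar> < d1" "\<bar>t1 i - t0 i\<bar> + d1 \<le> e" using t(2) d' d1(2) by (auto simp: near_def)
      then show "\<bar>t i - t0 i\<bar> < e" by linarith
    qed
    fix s' :: real assume s': "s' \<in> {0..1}" "\<bar>s' - s\<bar> < d'"
    have "near I t t1 d2" using t(2) d' by (force simp: near_def)
    then have "t \<in> A1" using d2(2) cube_outside[OF t(1)] cube_outside[OF t1] by simp
    moreover have "s' \<in> A2" using d3(2) s' d' by (auto simp: subset_iff dist_real_def abs_minus_commute)
    ultimately show "\<phi> (line t0 t s') \<in> B" using A(3)[of "(t, s')"] A12(4) t s' by auto
  qed
qed

text \<open>
  Let \<open>b\<close> be the point \<open>q r\<close>. A point near \<open>b\<close> lies in a small star of \<open>b\<close>, so in each cube it is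
  represented close to one of the preimages of \<open>b\<close>, and there the contraction is given by the
  segments to a fixed preimage of \<open>z\<close>. As there are finitely many cells and finitely many preimages
  in each of them, one neighbourhood works for all.
\<close>

lemma contraction_continuous:
  assumes fin: "finite \<Phi>" and g: "gap z e" and q: "path q" "path_image q \<subseteq> star z e"
  shows "continuous_on ({0..1} \<times> {0..1}) (\<lambda>x. contraction z e (q (fst x)) (snd x))"
  unfolding continuous_on_topological
proof (intro ballI allI impI)
  fix x :: "real \<times> real" and B
  assume x: "x \<in> {0..1} \<times> {0..1}" and B: "open B" "contraction z e (q (fst x)) (snd x) \<in> B"
  define r s where "r = fst x" and "s = snd x"
  have rs: "r \<in> {0..1}" "s \<in> {0..1}" "x = (r, s)" using x by (auto simp: r_def s_def)
  define b where "b = q r"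
  have b: "b \<in> star z e" using q rs by (auto simp: b_def path_image_def)
  have bX: "b \<in> X" using openin_imp_subset[OF open_star[OF g]] b by blast
  \<comment> \<open>\<open>P ((I, \<phi>), t1) d\<close>: the scale \<open>d\<close> is small enough around the preimage \<open>t1\<close> of \<open>b\<close> in the cube \<open>I\<close>.\<close>
  define P where "P = (\<lambda>((I, \<phi>), t1) d. \<forall>t\<in>cube I. near I t t1 d \<longrightarrow>
      (\<exists>t0\<in>cube I. \<phi> t0 = z \<and> near I t t0 e \<and> (\<forall>s'\<in>{0..1}. \<bar>s' - s\<bar> < d \<longrightarrow> \<phi> (line t0 t s') \<in> B)))"
  define \<F> where "\<F> = (SIGMA c:\<Phi>. {t1 \<in> cube (fst c). snd c t1 = b})"
  have "finite \<F>" unfolding \<F>_def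
  proof (rule finite_SigmaI[OF fin])
    fix c assume c: "c \<in> \<Phi>"
    obtain W where W: "finite W" "\<forall>I \<phi> t i. (I, \<phi>) \<in> \<Phi> \<longrightarrow> t \<in> cube I \<longrightarrow> \<phi> t = b \<longrightarrow> t i \<in> W"
      using finite_coordinates[OF bX] by blast
    have "{t1 \<in> cube (fst c). snd c t1 = b} \<subseteq> {t. \<forall>i. (i \<in> fst c \<longrightarrow> t i \<in> W) \<and> (i \<notin> fst c \<longrightarrow> t i = 0)}"
      using W(2) c cube_outside by (cases c) auto
    moreover have "finite {t. \<forall>i. (i \<in> fst c \<longrightarrow> t i \<in> W) \<and> (i \<notin> fst c \<longrightarrow> t i = (0::real))}"
      using W(1) cell(1)[of "fst c" "snd c"] c by (intro finite_set_of_finite_funs) auto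
    ultimately show "finite {t1 \<in> cube (fst c). snd c t1 = b}" by (rule finite_subset)
  qed
  then have "\<exists>d>0. \<forall>d'. 0 < d' \<longrightarrow> d' \<le> d \<longrightarrow> (\<forall>a\<in>\<F>. P a d')"
  proof (rule finite_uniform)
    fix a assume a: "a \<in> \<F>"
    obtain I \<phi> t1 where a_eq: "a = ((I, \<phi>), t1)" by (metis surj_pair)
    have c: "(I, \<phi>) \<in> \<Phi>" and t1: "t1 \<in> cube I" "\<phi> t1 = b" using a by (auto simp: \<F>_def a_eq)
    obtain t0 where t0: "t0 \<in> cube I" "\<phi> t0 = z" "near I t1 t0 e"
      using star_preimage[OF g c t1(1)] b t1(2) by blast
    have "\<phi> (line t0 t1 s) \<in> B"
      using B(2) contraction_eq[OF g c t1(1) t0 rs(2)] t1(2) by (simp add: b_def r_def s_def)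
    from local_box[OF c t1(1) t0(1) t0(3) rs(2) B(1) this]
    obtain d where d: "d > 0" "\<forall>d'. 0 < d' \<longrightarrow> d' \<le> d \<longrightarrow> (\<forall>t\<in>cube I. near I t t1 d' \<longrightarrow> near I t t0 e \<and>
      (\<forall>s'\<in>{0..1}. \<bar>s' - s\<bar> < d' \<longrightarrow> \<phi> (line t0 t s') \<in> B))" by (elim exE conjE) (rule that)
    show "\<exists>d>0. \<forall>d'. 0 < d' \<longrightarrow> d' \<le> d \<longrightarrow> P a d'"
    proof (intro exI[of _ d] conjI allI impI)
      show "d > 0" by fact
      fix d' assume "0 < d'" "d' \<le> d"
      then have *: "\<forall>t\<in>cube I. near I t t1 d' \<longrightarrow> near I t t0 e \<and>
        (\<forall>s'\<in>{0..1}. \<bar>s' - s\<bar> < d' \<longrightarrow> \<phi> (line t0 t s') \<in> B)" using d(2) by simp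
      show "P a d'" unfolding P_def a_eq prod.case using * t0 by blast
    qed
  qed
  then obtain d1 where d1: "d1 > 0" "\<And>d a. 0 < d \<Longrightarrow> d \<le> d1 \<Longrightarrow> a \<in> \<F> \<Longrightarrow> P a d" by blast
  obtain d2 where d2: "d2 > 0" "\<And>d. 0 < d \<Longrightarrow> d \<le> d2 \<Longrightarrow> gap b d" using ex_gap[OF bX] by blast
  define d where "d = min d1 d2"
  have d: "d > 0" "gap b d" "\<And>a. a \<in> \<F> \<Longrightarrow> P a d" using d1 d2 by (auto simp: d_def)
  obtain O' where O': "open O'" "star b d = X \<inter> O'"
    using open_star[OF d(2)] by (auto simp: openin_open)
  have "b \<in> O'" using star_center[OF bX d(2)] O'(2) by blast
  then obtain A where A: "open A" "r \<in> A" "\<And>r'. r' \<in> {0..1} \<Longrightarrow> r' \<in> A \<Longrightarrow> q r' \<in> O'"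
    using q(1) O'(1) rs(1) unfolding path_def continuous_on_topological b_def by metis
  show "\<exists>A. open A \<and> x \<in> A \<and> (\<forall>y\<in>{0..1} \<times> {0..1}. y \<in> A \<longrightarrow> contraction z e (q (fst y)) (snd y) \<in> B)"
  proof (intro exI[of _ "A \<times> ball s d"] conjI ballI impI)
    show "open (A \<times> ball s d)" using A(1) by (intro open_Times) auto
    show "x \<in> A \<times> ball s d" using A(2) d(1) rs(3) by simp
    fix y assume y: "y \<in> {0..1} \<times> {0..1}" "y \<in> A \<times> ball s d"
    have qO: "q (fst y) \<in> O'" using A(3) y by auto
    have "q (fst y) \<in> path_image q" using y(1) by (auto simp: path_image_def)
    then have "q (fst y) \<in> X" using q(2) openin_imp_subset[OF open_star[OF g]] by blast
    then have "q (fst y) \<in> star b d" using qO O'(2) by blast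
    then obtain I \<phi> t t1 where c: "(I, \<phi>) \<in> \<Phi>" "t \<in> cube I" "t1 \<in> cube I" "\<phi> t1 = b" "near I t t1 d"
      and qy: "q (fst y) = \<phi> t" by (rule starE)
    have "((I, \<phi>), t1) \<in> \<F>" using c by (simp add: \<F>_def)
    from d(3)[OF this] obtain t0 where t0: "t0 \<in> cube I" "\<phi> t0 = z" "near I t t0 e"
      and *: "\<forall>s'\<in>{0..1}. \<bar>s' - s\<bar> < d \<longrightarrow> \<phi> (line t0 t s') \<in> B"
      unfolding P_def prod.case using c by blast
    have sy: "snd y \<in> {0..1}" "\<bar>snd y - s\<bar> < d" using y by (auto simp: dist_real_def abs_minus_commute)
    show "contraction z e (q (fst y)) (snd y) \<in> B"
      using contraction_eq[OF g c(1,2) t0 sy(1)] * sy qy by simp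
  qed
qed

text \<open>
  Consider the map of the unit square which sends \<open>(r, s)\<close> to the point at time \<open>s\<close> on the segment
  from \<open>z\<close> to \<open>q r\<close>. It is constant on the two sides \<open>r = 0\<close> and \<open>s = 0\<close>, is \<open>q\<close> on the side \<open>s = 1\<close>
  and a segment on the side \<open>r = 1\<close>. The two ways along the boundary from \<open>(0, 0)\<close> to \<open>(1, 1)\<close> are
  homotopic in the square.
\<close>

lemma path_from_center:
  assumes fin: "finite \<Phi>" and g: "gap z e" and q: "path q" "path_image q \<subseteq> star z e" "pathstart q = z"
  shows "\<exists>I \<phi> t0 t. (I, \<phi>) \<in> \<Phi> \<and> t0 \<in> cube I \<and> t \<in> cube I \<and> \<phi> t0 = z \<and> \<phi> t = pathfinish q \<and>
           homotopic_paths X q (\<phi> \<circ> line t0 t)"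
proof -
  let ?c = "\<lambda>x. contraction z e (q (fst x)) (snd x)"
  let ?S = "{0..1} \<times> {0..1} :: (real \<times> real) set"
  have qs: "q r \<in> star z e" if "r \<in> {0..1}" for r using q that by (auto simp: path_image_def)
  have cX: "?c x \<in> X" if x: "x \<in> ?S" for x
  proof -
    have "fst x \<in> {0..1}" "snd x \<in> {0..1}" using x by auto
    from qs[OF this(1)] obtain I \<phi> t t0 where c: "(I, \<phi>) \<in> \<Phi>" "t \<in> cube I" "t0 \<in> cube I" "\<phi> t0 = z" "near I t t0 e"
      and qy: "q (fst x) = \<phi> t" by (rule starE)
    then show ?thesis
      using contraction_eq[OF g c \<open>snd x \<in> {0..1}\<close>] line_in_cube[OF c(3,2) \<open>snd x \<in> {0..1}\<close>] cell_in[OF c(1)] by simp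
  qed
  have c1: "contraction z e (q r) 1 = q r" if "r \<in> {0..1}" for r
    using qs[OF that]
  proof (rule starE)
    fix I \<phi> t t0 assume c: "(I, \<phi>) \<in> \<Phi>" "t \<in> cube I" "t0 \<in> cube I" "\<phi> t0 = z" "near I t t0 e" "q r = \<phi> t"
    then show ?thesis using contraction_eq[OF g c(1-5), of 1] by simp
  qed
  have c0: "contraction z e (q r) 0 = z" if "r \<in> {0..1}" for r
    using qs[OF that]
  proof (rule starE)
    fix I \<phi> t t0 assume c: "(I, \<phi>) \<in> \<Phi>" "t \<in> cube I" "t0 \<in> cube I" "\<phi> t0 = z" "near I t t0 e" "q r = \<phi> t"
    then show ?thesis using contraction_eq[OF g c(1-5), of 0] by simp
  qed
  have q0: "q 0 = z" using q(3) by (simp add: pathstart_def)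
  have zX: "z \<in> X" using openin_imp_subset[OF open_star[OF g]] qs[of 0] q0 by auto
  have cz: "contraction z e z s = z" if "s \<in> {0..1}" for s
  proof -
    obtain I \<phi> t where c: "(I, \<phi>) \<in> \<Phi>" "t \<in> open_cube I" "\<phi> t = z" using ex_cell[OF zX] .
    have t: "t \<in> cube I" using c open_cube_subset by blast
    have "near I t t e" using gap_bounds[OF g] by (simp add: near_def)
    from contraction_eq[OF g c(1) t t c(3) this that] show ?thesis using c(3) by simp
  qed
  obtain I \<phi> t t0 where c: "(I, \<phi>) \<in> \<Phi>" "t \<in> cube I" "t0 \<in> cube I" "\<phi> t0 = z" "near I t t0 e"
    and q1: "q 1 = \<phi> t" using qs[of 1] by (auto elim: starE)
  \<comment> \<open>the two ways along the boundary of the unit square\<close>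
  define P where "P = linepath (0, 0) (0, 1) +++ linepath (0, 1) (1 :: real, 1 :: real)"
  define Q where "Q = linepath (0, 0) (1, 0) +++ linepath (1, 0) (1 :: real, 1 :: real)"
  have conv: "convex ?S" by (intro convex_Times) auto
  have PQ: "path P" "path Q" "path_image P \<subseteq> ?S" "path_image Q \<subseteq> ?S"
    using closed_segment_subset[OF _ _ conv] by (auto simp: P_def Q_def path_image_join)
  have "homotopic_paths ?S P Q"
  proof (rule homotopic_paths_linear)
    fix r :: real assume "r \<in> {0..1}"
    then have "P r \<in> ?S" "Q r \<in> ?S" using PQ(3,4) by (auto simp: path_image_def)
    then show "closed_segment (P r) (Q r) \<subseteq> ?S" using conv by (rule closed_segment_subset)
  qed (use PQ in \<open>auto simp: P_def Q_def\<close>)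
  then have "homotopic_paths X (?c \<circ> P) (?c \<circ> Q)"
    by (rule homotopic_paths_continuous_image[OF _ contraction_continuous[OF fin g q(1,2)]]) (use cX in blast)
  note PcQ = this
  have qX: "path_image q \<subseteq> X" using q(2) openin_imp_subset[OF open_star[OF g]] by blast
  let ?l = "\<phi> \<circ> line t0 t"
  have l: "path ?l" "path_image ?l \<subseteq> X" "pathstart ?l = z"
    using c cell[OF c(1)] path_image_line[OF c(3,2)]
    by (auto simp: path_image_compose pathstart_compose intro!: path_continuous_image intro: continuous_on_subset)
  have "homotopic_paths X (?c \<circ> P) ((\<lambda>_. z) +++ q)"
  proof (rule homotopic_paths_eq)
    show "path (?c \<circ> P)" "path_image (?c \<circ> P) \<subseteq> X"
      using homotopic_paths_imp_path[OF PcQ] homotopic_paths_imp_subset[OF PcQ] by auto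
    fix r :: real assume "r \<in> {0..1}"
    then show "(?c \<circ> P) r = ((\<lambda>_. z) +++ q) r"
      using c1 cz q0 by (auto simp: P_def joinpaths_def linepath_def)
  qed
  then have 1: "homotopic_paths X (?c \<circ> P) q"
    using homotopic_paths_const_left[OF q(1) qX q(3)] homotopic_paths_trans by blast
  have "homotopic_paths X (?c \<circ> Q) ((\<lambda>_. z) +++ ?l)"
  proof (rule homotopic_paths_eq)
    show "path (?c \<circ> Q)" "path_image (?c \<circ> Q) \<subseteq> X"
      using homotopic_paths_imp_path[OF PcQ] homotopic_paths_imp_subset[OF PcQ] by auto
    fix r :: real assume "r \<in> {0..1}"
    then show "(?c \<circ> Q) r = ((\<lambda>_. z) +++ ?l) r"
      using c0 contraction_eq[OF g c] q1 by (auto simp: Q_def joinpaths_def linepath_def)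
  qed
  then have 2: "homotopic_paths X (?c \<circ> Q) ?l"
    using homotopic_paths_const_left[OF l] homotopic_paths_trans by blast
  have "homotopic_paths X q ?l"
    using 1 2 PcQ homotopic_paths_sym homotopic_paths_trans by blast
  then show ?thesis using c q1 by (auto simp: pathfinish_def)
qed

subsection \<open>Vertices\<close>

lemma vertex_of_corner:
  assumes c: "(I, \<phi>) \<in> \<Phi>" and v: "v \<in> cube_vertices I"
  shows "\<phi> v \<in> complex_vertices \<Phi>"
proof -
  have vc: "v \<in> cube I" using v cube_vertices_subset by blast
  have fr: "free I v = {}" using v by (auto simp: free_def cube_vertices_def)
  obtain J \<psi> \<pi> F where *: "(J, \<psi>) \<in> \<Phi>" "bij_betw \<pi> J (free I v)"
    "\<And>s. s \<in> cube I \<Longrightarrow> same_face I v s \<Longrightarrow> \<phi> s = \<psi> (reindex J \<pi> F s)"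
    using carrier[OF c vc] by metis
  have "J = {}" using *(2) fr by (simp add: bij_betw_def)
  then have "({}, \<psi>) \<in> \<Phi>" "\<phi> v = \<psi> (\<lambda>_. 0)"
    using * vc by (auto simp: same_face_def reindex_def)
  then show ?thesis by (auto simp: complex_vertices_def)
qed

lemma finite_vertices: "finite \<Phi> \<Longrightarrow> finite (complex_vertices \<Phi>)"
  by (rule finite_subset[of _ "(\<lambda>c. snd c (\<lambda>_. 0)) ` \<Phi>"]) (force simp: complex_vertices_def)+

lemma vertex_in: "x \<in> complex_vertices \<Phi> \<Longrightarrow> x \<in> X"
  using cell_in by (auto simp: complex_vertices_def cube_def)

text \<open>
  A standard path from a corner of the cell whose interior contains the point to this point, namely the
  segment from the origin of the cube.
\<close>

definition anchor :: "'a \<Rightarrow> real \<Rightarrow> 'a" where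
  "anchor z = (SOME g. \<exists>K \<kappa> u. (K, \<kappa>) \<in> \<Phi> \<and> u \<in> open_cube K \<and> \<kappa> u = z \<and> g = \<kappa> \<circ> line (\<lambda>_. 0) u)"

lemma anchor_eq:
  assumes "(K, \<kappa>) \<in> \<Phi>" "u \<in> open_cube K"
  shows "anchor (\<kappa> u) = \<kappa> \<circ> line (\<lambda>_. 0) u"
  unfolding anchor_def
  by (rule some_equality) (use assms unique_cell in \<open>blast+\<close>)

text \<open>
  The standard path stays in the closure of the open cell, so in every cube that contains the point
  it is a segment from a corner.
\<close>

lemma anchor_in_cube:
  assumes c: "(I, \<phi>) \<in> \<Phi>" and t: "t \<in> cube I"
  shows "\<exists>v\<in>cube_vertices I. \<forall>s\<in>{0..1}. anchor (\<phi> t) s = \<phi> (line v t s)"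
proof -
  obtain J \<psi> \<pi> F where J: "(J, \<psi>) \<in> \<Phi>" "bij_betw \<pi> J (free I t)" "reindex J \<pi> F t \<in> open_cube J"
    and eq: "\<And>s. s \<in> cube I \<Longrightarrow> same_face I t s \<Longrightarrow> \<phi> s = \<psi> (reindex J \<pi> F s)"
    using carrier[OF c t] by metis
  define v where "v = (\<lambda>i. if i \<in> free I t then flip (inv_into J \<pi> i \<in> F) 0 else t i)"
  have v: "v \<in> cube_vertices I"
    using not_free[OF t] cube_outside[OF t] by (auto simp: v_def cube_vertices_def flip_def free_def)
  then have vc: "v \<in> cube I" using cube_vertices_subset by blast
  have r0: "reindex J \<pi> F v = (\<lambda>_. 0)"
  proof
    fix j
    show "reindex J \<pi> F v j = 0"
      using J(2) by (auto simp: reindex_def v_def bij_betw_inv_into_left dest: bij_betwE)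
  qed
  have "anchor (\<phi> t) s = \<phi> (line v t s)" if s: "s \<in> {0..1}" for s
  proof -
    have "\<phi> t = \<psi> (reindex J \<pi> F t)" using eq[OF t] by (simp add: same_face_def)
    then have "anchor (\<phi> t) s = \<psi> (line (\<lambda>_. 0) (reindex J \<pi> F t) s)" using anchor_eq[OF J(1,3)] by simp
    also have "line (\<lambda>_. 0) (reindex J \<pi> F t) s = reindex J \<pi> F (line v t s)"
      unfolding r0[symmetric] by (auto simp: line_def reindex_def flip_line fun_eq_iff)
    also have "\<psi> \<dots> = \<phi> (line v t s)"
      using eq[OF line_in_cube[OF vc t s]] by (auto simp: same_face_def line_def v_def algebra_simps)
    finally show ?thesis .
  qed
  then show ?thesis using v by blast
qed

end

section \<open>Edge paths in special cube complexes\<close>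

text \<open>
  The vertex of the link of the Salvetti complex which is given by the letter \<open>a\<close>: the loop of the
  generator \<open>fst a\<close>, traversed in the direction \<open>snd a\<close>.
\<close>

definition ray :: "letter \<Rightarrow> real \<Rightarrow> nat \<Rightarrow> complex" where
  "ray a = restrict (\<lambda>s k. if k = fst a then cis (2 * pi * (if snd a then s else 1 - s)) else 1) {0..1}"

lemma cis_quarter: "cis (2 * pi * (1 / 4)) = \<i>" "cis (2 * pi * (1 - 1 / 4)) = - \<i>"
proof -
  show "cis (2 * pi * (1 / 4)) = \<i>" by (simp add: cis.ctr complex_eq_iff)
  have "2 * pi * (1 - 1 / 4) = pi / 2 + pi" by simp
  then show "cis (2 * pi * (1 - 1 / 4)) = - \<i>"
    by (simp only: cis_mult[symmetric]) simp
qed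

lemma ray_inj: "ray a = ray b \<Longrightarrow> a = b"
proof -
  assume eq: "ray a = ray b"
  have ev: "ray x (1 / 4) k = (if k = fst x then if snd x then \<i> else - \<i> else 1)" for x k
    using cis_quarter by (simp add: ray_def)
  have *: "(if k = fst a then if snd a then \<i> else - \<i> else 1) = (if k = fst b then if snd b then \<i> else - \<i> else 1)" for k
    using ev[of a k] ev[of b k] eq by simp
  from *[of "fst a"] *[of "fst b"] show "a = b"
    by (auto simp: prod_eq_iff complex_eq_iff split: if_splits)
qed

lemma ray_inv: "s \<in> {0..1} \<Longrightarrow> ray (inv_letter a) s = ray a (1 - s)"
  by (auto simp: ray_def inv_letter_def)

definition opposite :: "(nat \<Rightarrow> real) \<Rightarrow> nat \<Rightarrow> nat \<Rightarrow> real" where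
  "opposite c i = c(i := 1 - c i)"

lemma opposite_vertex: "c \<in> cube_vertices I \<Longrightarrow> i \<in> I \<Longrightarrow> opposite c i \<in> cube_vertices I"
  by (auto simp: cube_vertices_def opposite_def)

lemma opposite_opposite [simp]: "opposite (opposite c i) i = c"
  by (auto simp: opposite_def fun_eq_iff)

lemma opposite_commute: "opposite (opposite c i) j = opposite (opposite c j) i"
  by (auto simp: opposite_def fun_eq_iff)

lemma out_edge_line:
  assumes "c \<in> cube_vertices I" "i \<in> I" "s \<in> {0..1}"
  shows "out_edge \<phi> c i s = \<phi> (line c (opposite c i) s)"
proof -
  have "c i = 0 \<or> c i = 1" using assms by (auto simp: cube_vertices_def)
  then have "c(i := \<bar>c i - s\<bar>) = line c (opposite c i) s"
    using assms(3) by (auto simp: line_def opposite_def fun_eq_iff algebra_simps)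
  then show ?thesis using assms(3) by (simp add: out_edge_def)
qed

context cubed_space
begin

lemma cell_path:
  assumes c: "(I, \<phi>) \<in> \<Phi>" and p: "path p" "path_image p \<subseteq> cube I"
  shows "path (\<phi> \<circ> p)" "path_image (\<phi> \<circ> p) \<subseteq> X"
  using p cell[OF c] by (auto intro!: path_continuous_image intro: continuous_on_subset simp: path_image_compose)

lemma out_edge_path:
  assumes c: "(I, \<phi>) \<in> \<Phi>" and v: "v \<in> cube_vertices I" and i: "i \<in> I"
  shows "path (out_edge \<phi> v i)" "path_image (out_edge \<phi> v i) \<subseteq> X"
    "pathstart (out_edge \<phi> v i) = \<phi> v" "pathfinish (out_edge \<phi> v i) = \<phi> (opposite v i)"
    "homotopic_paths X (\<phi> \<circ> line v (opposite v i)) (out_edge \<phi> v i)"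
proof -
  have vc: "v \<in> cube I" "opposite v i \<in> cube I" using v opposite_vertex[OF v i] cube_vertices_subset by blast+
  have eq: "(\<phi> \<circ> line v (opposite v i)) s = out_edge \<phi> v i s" if "s \<in> {0..1}" for s
    using out_edge_line[OF v i that, of \<phi>] by simp
  note l = cell_path[OF c path_line(1) path_image_line[OF vc]]
  show h: "homotopic_paths X (\<phi> \<circ> line v (opposite v i)) (out_edge \<phi> v i)"
    by (rule homotopic_paths_eq[OF l eq])
  show "path (out_edge \<phi> v i)" "path_image (out_edge \<phi> v i) \<subseteq> X"
    using homotopic_paths_imp_path[OF h] homotopic_paths_imp_subset[OF h] by auto
  show "pathstart (out_edge \<phi> v i) = \<phi> v" "pathfinish (out_edge \<phi> v i) = \<phi> (opposite v i)"
    using eq[of 0] eq[of 1] by (auto simp: pathstart_def pathfinish_def)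
qed

end

locale special_space = cubed_space X \<Phi> + raag V E
  for X :: "'a::topological_space set" and \<Phi> V E +
  fixes f :: "'a \<Rightarrow> nat \<Rightarrow> complex"
  assumes local_iso: "local_isometry X \<Phi> (salvetti V E) (salvetti_cells V E) f"
    and compact_space: "compact X"
begin

lemmas finite_cells = finite_cells[OF compact_space]

abbreviation vertices :: "'a set" where
  "vertices \<equiv> complex_vertices \<Phi>"

lemma f_map: "continuous_on X f" "f ` X \<subseteq> salvetti V E"
  using local_iso by (auto simp: local_isometry_def cubical_map_def)

lemma cell_map:
  assumes c: "(I, \<phi>) \<in> \<Phi>"
  shows "\<exists>\<sigma> \<pi> F. clique V E \<sigma> \<and> bij_betw \<pi> \<sigma> I \<and> (\<forall>t\<in>cube I. f (\<phi> t) = torus_map (reindex \<sigma> \<pi> F t))"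
proof -
  have "\<forall>(I, \<phi>)\<in>\<Phi>. \<exists>(J, \<psi>)\<in>salvetti_cells V E. \<exists>h. cube_isometry I J h \<and> (\<forall>t\<in>cube I. f (\<phi> t) = \<psi> (h t))"
    using local_iso unfolding local_isometry_def cubical_map_def by (elim conjE)
  from bspec[OF this c, unfolded prod.case]
  obtain d where d: "d \<in> salvetti_cells V E"
    "case d of (J, \<psi>) \<Rightarrow> \<exists>h. cube_isometry I J h \<and> (\<forall>t\<in>cube I. f (\<phi> t) = \<psi> (h t))" by (rule bexE)
  obtain \<sigma> where \<sigma>: "d = (\<sigma>, torus_map)" "clique V E \<sigma>" using d(1) by (auto simp: salvetti_cells_def)
  obtain h where h: "cube_isometry I \<sigma> h" "\<forall>t\<in>cube I. f (\<phi> t) = torus_map (h t)"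
    using d(2) unfolding \<sigma>(1) prod.case by (elim exE conjE) (rule that)
  obtain \<pi> F where \<pi>: "bij_betw \<pi> \<sigma> I" "\<forall>t\<in>cube I. h t = reindex \<sigma> \<pi> F t"
    using h(1) unfolding cube_isometry_reindex by (elim exE conjE) (rule that)
  then have "\<forall>t\<in>cube I. f (\<phi> t) = torus_map (reindex \<sigma> \<pi> F t)" using h(2) by simp
  with \<sigma>(2) \<pi>(1) show ?thesis by (intro exI conjI)
qed

text \<open>
  The label of an edge of a cube depends only on its direction and on the side from which it is
  traversed. In particular opposite edges of a square have the same label.
\<close>

lemma edge_labels:
  assumes c: "(I, \<phi>) \<in> \<Phi>"
  shows "\<exists>lab. (\<forall>v\<in>cube_vertices I. \<forall>i\<in>I. fst (lab i (v i)) \<in> V \<and> link_map f (out_edge \<phi> v i) = ray (lab i (v i)))"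
proof -
  obtain \<sigma> \<pi> F where cl: "clique V E \<sigma>" and \<pi>: "bij_betw \<pi> \<sigma> I"
    and f: "\<And>t. t \<in> cube I \<Longrightarrow> f (\<phi> t) = torus_map (reindex \<sigma> \<pi> F t)"
    using cell_map[OF c] by blast
  define \<rho> where "\<rho> = inv_into \<sigma> \<pi>"
  define lab where "lab = (\<lambda>i x. (\<rho> i, (x = (0::real)) = (\<rho> i \<notin> F)))"
  have "fst (lab i (v i)) \<in> V \<and> link_map f (out_edge \<phi> v i) = ray (lab i (v i))"
    if v: "v \<in> cube_vertices I" and i: "i \<in> I" for v i
  proof
    have \<rho>: "\<rho> i \<in> \<sigma>" "\<pi> (\<rho> i) = i"
      using \<pi> i by (auto simp: \<rho>_def bij_betw_inv_into_right bij_betw_imp_surj_on inv_into_into)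
    show "fst (lab i (v i)) \<in> V" using \<rho> cl by (auto simp: lab_def clique_def)
    show "link_map f (out_edge \<phi> v i) = ray (lab i (v i))"
      unfolding link_map_def ray_def
    proof (rule restrict_ext)
      fix s :: real assume s: "s \<in> {0..1}"
      have vi: "v i = 0 \<or> v i = 1" using v i by (auto simp: cube_vertices_def)
      have v01: "v j = 0 \<or> v j = 1" for j using v by (cases "j \<in> I") (auto simp: cube_vertices_def)
      have t: "v(i := \<bar>v i - s\<bar>) \<in> cube I"
        using v i s vi subsetD[OF cube_vertices_subset v] by (auto simp: cube_def)
      have inj: "\<pi> k = i \<longleftrightarrow> k = \<rho> i" if "k \<in> \<sigma>" for k
        using that \<rho> \<pi> by (metis bij_betw_def inj_onD)
      have cis1: "cis (2 * pi) = 1" "cis (2 * pi * 1) = 1" by (simp_all add: cis.ctr complex_eq_iff)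
      have "(f \<circ> out_edge \<phi> v i) s = torus_map (reindex \<sigma> \<pi> F (v(i := \<bar>v i - s\<bar>)))"
        using f[OF t] s by (simp add: out_edge_def)
      also have "\<dots> = (\<lambda>k. if k = fst (lab i (v i)) then cis (2 * pi * (if snd (lab i (v i)) then s else 1 - s)) else 1)"
      proof
        fix k
        consider "k = \<rho> i" | "k \<in> \<sigma>" "k \<noteq> \<rho> i" | "k \<notin> \<sigma>" by blast
        then show "torus_map (reindex \<sigma> \<pi> F (v(i := \<bar>v i - s\<bar>))) k =
            (if k = fst (lab i (v i)) then cis (2 * pi * (if snd (lab i (v i)) then s else 1 - s)) else 1)"
        proof cases
          case 1
          then show ?thesis using vi \<rho> s
            by (auto simp: torus_map_def reindex_def lab_def flip_def)
        next
          case 2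
          then have "\<pi> k \<noteq> i" using inj by simp
          then show ?thesis using 2 v01[of "\<pi> k"] cis1
            by (auto simp: torus_map_def reindex_def lab_def flip_def)
        next
          case 3
          then show ?thesis using \<rho> by (auto simp: torus_map_def reindex_def lab_def)
        qed
      qed
      finally show "(f \<circ> out_edge \<phi> v i) s = (\<lambda>k. if k = fst (lab i (v i)) then
          cis (2 * pi * (if snd (lab i (v i)) then s else 1 - s)) else 1)" .
    qed
  qed
  then show ?thesis by blast
qed

text \<open>
  There is at most one such edge \<open>\<alpha>\<close>, as \<open>f\<close> is injective on the link of \<open>x\<close>.
\<close>

definition edge :: "'a \<Rightarrow> letter \<Rightarrow> (real \<Rightarrow> 'a) \<Rightarrow> bool" where
  "edge x a \<alpha> \<longleftrightarrow> x \<in> vertices \<and> \<alpha> \<in> link_vertices \<Phi> x \<and> link_map f \<alpha> = ray a"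

lemma edge_unique: "edge x a \<alpha> \<Longrightarrow> edge x a \<beta> \<Longrightarrow> \<alpha> = \<beta>"
proof -
  assume e: "edge x a \<alpha>" "edge x a \<beta>"
  then have "inj_on (link_map f) (link_vertices \<Phi> x)"
    using local_iso unfolding edge_def local_isometry_def by blast
  then show "\<alpha> = \<beta>" using e unfolding edge_def by (metis inj_onD)
qed

lemma link_vertexE:
  assumes "\<alpha> \<in> link_vertices \<Phi> x"
  obtains I \<phi> v i where "(I, \<phi>) \<in> \<Phi>" "v \<in> cube_vertices I" "i \<in> I" "\<phi> v = x" "\<alpha> = out_edge \<phi> v i"
  using assms by (auto simp: link_vertices_def link_simplices_def corner_simplex_def corners_def)

lemma out_edge_link: "(I, \<phi>) \<in> \<Phi> \<Longrightarrow> v \<in> cube_vertices I \<Longrightarrow> i \<in> I \<Longrightarrow> out_edge \<phi> v i \<in> link_vertices \<Phi> (\<phi> v)"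
  unfolding link_vertices_def link_simplices_def corner_simplex_def corners_def by force

lemma edge_of_direction:
  assumes c: "(I, \<phi>) \<in> \<Phi>" and v: "v \<in> cube_vertices I" and i: "i \<in> I"
  obtains a where "fst a \<in> V" "edge (\<phi> v) a (out_edge \<phi> v i)"
  using edge_labels[OF c] v i vertex_of_corner[OF c v] out_edge_link[OF c v i] unfolding edge_def by metis

lemma edge_cell:
  assumes "edge x a \<alpha>"
  obtains I \<phi> v i where "(I, \<phi>) \<in> \<Phi>" "v \<in> cube_vertices I" "i \<in> I" "\<phi> v = x" "\<alpha> = out_edge \<phi> v i"
proof -
  have "\<alpha> \<in> link_vertices \<Phi> x" using assms by (simp add: edge_def)
  then show ?thesis by (rule link_vertexE) (rule that)
qed

lemma edge_path:
  assumes "edge x a \<alpha>"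
  shows "path \<alpha>" "path_image \<alpha> \<subseteq> X" "pathstart \<alpha> = x" "pathfinish \<alpha> \<in> vertices" "fst a \<in> V" "x \<in> vertices"
    "\<And>s. s \<in> {0..1} \<Longrightarrow> f (\<alpha> s) = ray a s"
proof -
  obtain I \<phi> v i where c: "(I, \<phi>) \<in> \<Phi>" "v \<in> cube_vertices I" "i \<in> I" "\<phi> v = x" "\<alpha> = out_edge \<phi> v i"
    using edge_cell[OF assms] .
  show "path \<alpha>" "path_image \<alpha> \<subseteq> X" "pathstart \<alpha> = x" using out_edge_path[OF c(1-3)] c by auto
  show "pathfinish \<alpha> \<in> vertices"
    using out_edge_path(4)[OF c(1-3)] vertex_of_corner[OF c(1) opposite_vertex[OF c(2,3)]] c(5) by simp
  show "x \<in> vertices" using assms by (simp add: edge_def)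
  obtain b where "fst b \<in> V" "edge (\<phi> v) b (out_edge \<phi> v i)" using edge_of_direction[OF c(1-3)] .
  moreover from this have "ray b = ray a" using assms c(5) by (simp add: edge_def)
  then have "b = a" by (rule ray_inj)
  ultimately show "fst a \<in> V" by simp
  fix s :: real assume "s \<in> {0..1}"
  then have "link_map f \<alpha> s = f (\<alpha> s)" by (simp add: link_map_def)
  then show "f (\<alpha> s) = ray a s" using assms by (simp add: edge_def)
qed

lemma opposite_edge:
  assumes c: "(I, \<phi>) \<in> \<Phi>" and v: "v \<in> cube_vertices I" and i: "i \<in> I" and e: "edge (\<phi> v) a (out_edge \<phi> v i)"
  shows "edge (\<phi> (opposite v i)) (inv_letter a) (out_edge \<phi> (opposite v i) i)"
    "s \<in> {0..1} \<Longrightarrow> out_edge \<phi> (opposite v i) i s = out_edge \<phi> v i (1 - s)"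
proof -
  let ?w = "opposite v i"
  note w = opposite_vertex[OF v i]
  show eq: "out_edge \<phi> ?w i s = out_edge \<phi> v i (1 - s)" if "s \<in> {0..1}" for s
    using out_edge_line[OF w i that, of \<phi>] out_edge_line[OF v i, of "1 - s" \<phi>] that by (simp add: line_swap)
  have "link_map f (out_edge \<phi> ?w i) = ray (inv_letter a)"
  proof
    fix s
    show "link_map f (out_edge \<phi> ?w i) s = ray (inv_letter a) s"
    proof (cases "s \<in> {0..1}")
      case True
      then have "link_map f (out_edge \<phi> ?w i) s = f (out_edge \<phi> v i (1 - s))"
        using eq[OF True] by (simp add: link_map_def)
      also have "\<dots> = ray a (1 - s)" using edge_path(7)[OF e, of "1 - s"] True by simp
      finally show ?thesis using ray_inv[OF True] by simp
    next
      case False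
      then show ?thesis by (simp add: link_map_def ray_def restrict_def del: atLeastAtMost_iff)
    qed
  qed
  then show "edge (\<phi> ?w) (inv_letter a) (out_edge \<phi> ?w i)"
    unfolding edge_def using vertex_of_corner[OF c w] out_edge_link[OF c w i] by simp
qed

lemma edge_reverse:
  assumes "edge x a \<alpha>"
  obtains \<beta> where "edge (pathfinish \<alpha>) (inv_letter a) \<beta>" "pathfinish \<beta> = x"
    "\<forall>s\<in>{0..1}. \<beta> s = reversepath \<alpha> s"
proof -
  obtain I \<phi> v i where c: "(I, \<phi>) \<in> \<Phi>" "v \<in> cube_vertices I" "i \<in> I" "\<phi> v = x" "\<alpha> = out_edge \<phi> v i"
    using edge_cell[OF assms] .
  have e: "edge (\<phi> v) a (out_edge \<phi> v i)" using assms c by simp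
  show ?thesis
  proof (rule that)
    show "edge (pathfinish \<alpha>) (inv_letter a) (out_edge \<phi> (opposite v i) i)"
      using opposite_edge(1)[OF c(1-3) e] out_edge_path(4)[OF c(1-3)] c(5) by simp
    show "pathfinish (out_edge \<phi> (opposite v i) i) = x"
      using out_edge_path(4)[OF c(1) opposite_vertex[OF c(2,3)] c(3)] c(4) by simp
    show "\<forall>s\<in>{0..1}. out_edge \<phi> (opposite v i) i s = reversepath \<alpha> s"
      using opposite_edge(2)[OF c(1-3) e] c(5) by (simp add: reversepath_def)
  qed
qed

lemma f_vertex: "x \<in> vertices \<Longrightarrow> f x = (\<lambda>_. 1)"
proof -
  assume "x \<in> vertices"
  then obtain \<phi> where c: "({}, \<phi>) \<in> \<Phi>" "x = \<phi> (\<lambda>_. 0)" by (auto simp: complex_vertices_def)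
  obtain \<sigma> \<pi> F where "bij_betw \<pi> \<sigma> {}" "\<forall>t\<in>cube {}. f (\<phi> t) = torus_map (reindex \<sigma> \<pi> F t)"
    using cell_map[OF c(1)] by blast
  then show ?thesis using c(2) by (auto simp: bij_betw_def cube_def reindex_def torus_map_def)
qed

lemma salvetti_square:
  assumes ab: "com a b" and V: "fst a \<in> V" "fst b \<in> V"
  shows "{ray a, ray b} \<in> link_simplices (salvetti_cells V E) (\<lambda>_. 1)"
proof -
  let ?\<sigma> = "{fst a, fst b}"
  define w where "w = (\<lambda>k. if k = fst a then of_bool (\<not> snd a) else if k = fst b then of_bool (\<not> snd b) else 0 :: real)"
  have ne: "fst a \<noteq> fst b" and E: "{fst a, fst b} \<in> E" using ab by (auto simp: com_def)
  have "clique V E ?\<sigma>" using E V by (auto simp: clique_def insert_commute)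
  then have cell: "(?\<sigma>, torus_map) \<in> salvetti_cells V E" by (auto simp: salvetti_cells_def)
  have w: "w \<in> cube_vertices ?\<sigma>" by (auto simp: w_def cube_vertices_def)
  have cis1: "cis (2 * pi) = 1" "cis (2 * pi * 1) = 1" by (simp_all add: cis.ctr complex_eq_iff)
  have t: "torus_map w = (\<lambda>_. 1)" by (auto simp: torus_map_def w_def cis1)
  have "out_edge torus_map w (fst a) = ray a"
    unfolding out_edge_def ray_def by (rule restrict_ext) (auto simp: torus_map_def w_def cis1 fun_eq_iff)
  moreover have "out_edge torus_map w (fst b) = ray b"
    unfolding out_edge_def ray_def by (rule restrict_ext) (use ne in \<open>auto simp: torus_map_def w_def cis1 fun_eq_iff\<close>)
  ultimately have "{ray a, ray b} = corner_simplex ((?\<sigma>, torus_map), w)" by (simp add: corner_simplex_def)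
  moreover have "((?\<sigma>, torus_map), w) \<in> corners (salvetti_cells V E) (\<lambda>_. 1)"
    using cell w t by (simp add: corners_def)
  ultimately show ?thesis unfolding link_simplices_def by blast
qed

text \<open>
  The Salvetti complex contains the square of the two generators, and the link of \<open>x\<close> is mapped onto
  a full subcomplex; so \<open>X\<close> has a square at \<open>x\<close> with the two given edges.
\<close>

lemma square_corner:
  assumes e: "edge x a \<alpha>" "edge x b \<beta>" and ab: "com a b"
  obtains I \<phi> v i j where "(I, \<phi>) \<in> \<Phi>" "v \<in> cube_vertices I" "i \<in> I" "j \<in> I" "i \<noteq> j" "\<phi> v = x"
    "\<alpha> = out_edge \<phi> v i" "\<beta> = out_edge \<phi> v j"
proof -
  have x: "x \<in> vertices" using e by (simp add: edge_def)
  have "{ray a, ray b} \<in> link_simplices (salvetti_cells V E) (f x)"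
    using salvetti_square[OF ab] edge_path(5)[OF e(1)] edge_path(5)[OF e(2)] f_vertex[OF x] by simp
  moreover have "{ray a, ray b} \<subseteq> link_map f ` link_vertices \<Phi> x"
    using e unfolding edge_def by (metis empty_subsetI imageI insert_subset)
  ultimately obtain A where A: "A \<in> link_simplices \<Phi> x" "link_map f ` A = {ray a, ray b}"
    using local_iso x unfolding local_isometry_def by blast
  obtain I \<phi> v where c: "(I, \<phi>) \<in> \<Phi>" "v \<in> cube_vertices I" "\<phi> v = x" "A = out_edge \<phi> v ` I"
    using A(1) by (auto simp: link_simplices_def corner_simplex_def corners_def)
  have "ray a \<in> link_map f ` A" using A(2) by simp
  then obtain i where i: "i \<in> I" "link_map f (out_edge \<phi> v i) = ray a" unfolding c(4) by auto
  have "ray b \<in> link_map f ` A" using A(2) by simp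
  then obtain j where j: "j \<in> I" "link_map f (out_edge \<phi> v j) = ray b" unfolding c(4) by auto
  have "edge x a (out_edge \<phi> v i)" "edge x b (out_edge \<phi> v j)"
    using out_edge_link[OF c(1,2) i(1)] out_edge_link[OF c(1,2) j(1)] i(2) j(2) x c(3) by (auto simp: edge_def)
  then have "\<alpha> = out_edge \<phi> v i" "\<beta> = out_edge \<phi> v j" using e edge_unique by blast+
  moreover have "i \<noteq> j" using i(2) j(2) ray_inj[of a b] ab by (auto simp: com_def)
  ultimately show ?thesis using that c i(1) j(1) by blast
qed

text \<open>
  The inverse of \<open>\<alpha>\<close> and the edge \<open>\<beta>\<close> issue from the same vertex and have commuting labels, hence
  they span a square. The other two sides of this square give the path on the right.
\<close>

lemma square_swap:
  assumes e: "edge x a \<alpha>" "edge (pathfinish \<alpha>) b \<beta>" and ab: "com a b"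
  obtains \<beta>' \<alpha>' where "edge x b \<beta>'" "edge (pathfinish \<beta>') a \<alpha>'" "pathfinish \<alpha>' = pathfinish \<beta>"
    "homotopic_paths X (\<alpha> +++ \<beta>) (\<beta>' +++ \<alpha>')"
proof -
  obtain \<gamma> where \<gamma>: "edge (pathfinish \<alpha>) (inv_letter a) \<gamma>" "pathfinish \<gamma> = x"
    using edge_reverse[OF e(1)] .
  have ab': "com (inv_letter a) b" using ab by simp
  obtain I \<phi> v i j where c: "(I, \<phi>) \<in> \<Phi>" and v: "v \<in> cube_vertices I" and ij: "i \<in> I" "j \<in> I" "i \<noteq> j"
    and x: "\<phi> v = pathfinish \<alpha>" and \<gamma>': "\<gamma> = out_edge \<phi> v i" and \<beta>: "\<beta> = out_edge \<phi> v j"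
    using square_corner[OF \<gamma>(1) e(2) ab'] .
  obtain lab where lab: "\<And>v i. v \<in> cube_vertices I \<Longrightarrow> i \<in> I \<Longrightarrow> link_map f (out_edge \<phi> v i) = ray (lab i (v i))"
    using edge_labels[OF c] by blast
  define vi vj vij where "vi = opposite v i" and "vj = opposite v j" and "vij = opposite vi j"
  have vs: "vi \<in> cube_vertices I" "vj \<in> cube_vertices I" "vij \<in> cube_vertices I"
    using opposite_vertex v ij by (auto simp: vi_def vj_def vij_def)
  have cs: "v \<in> cube I" "vi \<in> cube I" "vj \<in> cube I" "vij \<in> cube I"
    using v vs cube_vertices_subset by blast+
  have opp: "opposite vi i = v" "opposite vij i = vj"
    by (simp_all add: vi_def vj_def vij_def opposite_commute[of v i j])
  have xi: "\<phi> vi = x" using out_edge_path(4)[OF c v ij(1)] \<gamma>(2) \<gamma>' by (simp add: vi_def)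
  have "edge (\<phi> v) (inv_letter a) (out_edge \<phi> v i)" using \<gamma>(1) \<gamma>' x by simp
  from opposite_edge(1)[OF c v ij(1) this] have ei: "edge x a (out_edge \<phi> vi i)" using xi by (simp add: vi_def)
  then have \<alpha>: "\<alpha> = out_edge \<phi> vi i" using e(1) edge_unique by blast
  have edge_by: "edge (\<phi> w) l (out_edge \<phi> w k)"
    if "edge (\<phi> u) l (out_edge \<phi> u k)" "u \<in> cube_vertices I" "w \<in> cube_vertices I" "k \<in> I" "w k = u k" for u w k l
    using that lab[of u k] lab[of w k] vertex_of_corner[OF c that(3)] out_edge_link[OF c that(3,4)]
    by (simp add: edge_def)
  show ?thesis
  proof (rule that)
    show 1: "edge x b (out_edge \<phi> vi j)"
      using edge_by[of v b j vi] e(2) x \<beta> v vs ij xi by (simp add: vi_def opposite_def)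
    have fin: "pathfinish (out_edge \<phi> vi j) = \<phi> vij" using out_edge_path(4)[OF c vs(1) ij(2)] by (simp add: vij_def)
    show "edge (pathfinish (out_edge \<phi> vi j)) a (out_edge \<phi> vij i)"
      using edge_by[of vi a i vij] ei xi v vs ij fin by (simp add: vij_def opposite_def)
    show "pathfinish (out_edge \<phi> vij i) = pathfinish \<beta>"
      using out_edge_path(4)[OF c vs(3) ij(1)] out_edge_path(4)[OF c v ij(2)] opp \<beta> by (simp add: vj_def)
    have "homotopic_paths X (\<phi> \<circ> (line vi v +++ line v vj)) (\<phi> \<circ> (line vi vij +++ line vij vj))"
      using cs by (intro cube_paths_homotopic[where I = I] cell(2,3)[OF c]) (auto simp: path_image_join path_image_line)
    then have h: "homotopic_paths X ((\<phi> \<circ> line vi v) +++ (\<phi> \<circ> line v vj)) ((\<phi> \<circ> line vi vij) +++ (\<phi> \<circ> line vij vj))"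
      by (simp add: path_compose_join)
    have h1: "homotopic_paths X ((\<phi> \<circ> line vi v) +++ (\<phi> \<circ> line v vj)) (\<alpha> +++ \<beta>)"
      using out_edge_path(5)[OF c vs(1) ij(1)] out_edge_path(5)[OF c v ij(2)] opp
      by (intro homotopic_paths_join) (auto simp: \<alpha> \<beta> vj_def pathfinish_def pathstart_def)
    have h2: "homotopic_paths X ((\<phi> \<circ> line vi vij) +++ (\<phi> \<circ> line vij vj)) (out_edge \<phi> vi j +++ out_edge \<phi> vij i)"
      using out_edge_path(5)[OF c vs(1) ij(2)] out_edge_path(5)[OF c vs(3) ij(1)] opp
      by (intro homotopic_paths_join) (auto simp: vij_def pathfinish_def pathstart_def)
    show "homotopic_paths X (\<alpha> +++ \<beta>) (out_edge \<phi> vi j +++ out_edge \<phi> vij i)"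
      using h h1 h2 homotopic_paths_sym homotopic_paths_trans by blast
  qed
qed

subsection \<open>Reading words\<close>

text \<open>
  The edge path from \<open>x\<close> with the label word \<open>w\<close>, if there is one, ends in \<open>y\<close> and is parametrised
  as \<open>p\<close>. It ends with a constant path, which is harmless up to homotopy.
\<close>

primrec reads :: "'a \<Rightarrow> letter list \<Rightarrow> 'a \<Rightarrow> (real \<Rightarrow> 'a) \<Rightarrow> bool" where
  "reads x [] y p \<longleftrightarrow> x \<in> vertices \<and> y = x \<and> p = (\<lambda>_. x)"
| "reads x (a # w) y p \<longleftrightarrow> (\<exists>\<alpha> q. edge x a \<alpha> \<and> reads (pathfinish \<alpha>) w y q \<and> p = \<alpha> +++ q)"

lemma reads_Cons: "edge x a \<alpha> \<Longrightarrow> reads (pathfinish \<alpha>) w y q \<Longrightarrow> reads x (a # w) y (\<alpha> +++ q)"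
  by auto

lemma reads_unique: "reads x w y p \<Longrightarrow> reads x w y' p' \<Longrightarrow> y = y' \<and> p = p'"
proof (induction w arbitrary: x y y' p p')
  case (Cons a w)
  then obtain \<alpha> q \<alpha>' q' where "edge x a \<alpha>" "reads (pathfinish \<alpha>) w y q" "p = \<alpha> +++ q"
    "edge x a \<alpha>'" "reads (pathfinish \<alpha>') w y' q'" "p' = \<alpha>' +++ q'" by auto
  then show ?case using Cons.IH edge_unique by metis
qed simp

lemma path_const: "path (\<lambda>_. x)" "path_image (\<lambda>_. x) = {x}" "pathstart (\<lambda>_. x) = x" "pathfinish (\<lambda>_. x) = x"
  by (auto simp: path_def path_image_def pathstart_def pathfinish_def)

lemma reads_path:
  "reads x w y p \<Longrightarrow> path p \<and> path_image p \<subseteq> X \<and> pathstart p = x \<and> pathfinish p = y \<and>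
     x \<in> vertices \<and> y \<in> vertices \<and> (\<forall>a\<in>set w. fst a \<in> V)"
proof (induction w arbitrary: x p)
  case Nil
  then show ?case using vertex_in by (auto simp: path_const)
next
  case (Cons a w)
  then obtain \<alpha> q where *: "edge x a \<alpha>" "reads (pathfinish \<alpha>) w y q" "p = \<alpha> +++ q" by auto
  then show ?case using Cons.IH[OF *(2)] edge_path[OF *(1)] by (auto simp: path_image_join)
qed

lemma reads_append:
  assumes "reads x u y p" "reads y w z q"
  shows "\<exists>r. reads x (u @ w) z r \<and> homotopic_paths X (p +++ q) r"
  using assms(1)
proof (induction u arbitrary: x p)
  case Nil
  then have "y = x" "p = (\<lambda>_. x)" by auto
  then show ?case using assms(2) reads_path[OF assms(2)] homotopic_paths_const_left[of q X x] by auto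
next
  case (Cons a u)
  then obtain \<alpha> p' where *: "edge x a \<alpha>" "reads (pathfinish \<alpha>) u y p'" "p = \<alpha> +++ p'" by auto
  obtain r where r: "reads (pathfinish \<alpha>) (u @ w) z r" "homotopic_paths X (p' +++ q) r" using Cons.IH[OF *(2)] by blast
  note pq = reads_path[OF *(2)] reads_path[OF assms(2)] edge_path[OF *(1)]
  have "homotopic_paths X ((\<alpha> +++ p') +++ q) (\<alpha> +++ (p' +++ q))"
    using pq by (intro homotopic_paths_assoc') auto
  also have "homotopic_paths X \<dots> (\<alpha> +++ r)"
    using pq r by (intro homotopic_paths_join) auto
  finally show ?case using * r by auto
qed

lemma reads_split:
  "reads x (u @ w) z r \<Longrightarrow> \<exists>y p q. reads x u y p \<and> reads y w z q"
proof (induction u arbitrary: x r)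
  case Nil
  then show ?case using reads_path by fastforce
next
  case (Cons a u)
  then obtain \<alpha> r' where *: "edge x a \<alpha>" "reads (pathfinish \<alpha>) (u @ w) z r'" by auto
  then show ?case using Cons.IH[OF *(2)] by fastforce
qed

lemma reads_edge: "edge x a \<alpha> \<Longrightarrow> reads x [a] (pathfinish \<alpha>) (\<alpha> +++ (\<lambda>_. pathfinish \<alpha>))"
  using edge_path(4)[of x a \<alpha>] by auto

lemma reads_inverse:
  "reads x w y p \<Longrightarrow> \<exists>q. reads y (inv_word w) x q \<and> homotopic_paths X (reversepath p) q"
proof (induction w arbitrary: x p)
  case Nil
  then show ?case using vertex_in by (auto simp: reversepath_def path_const)
next
  case (Cons a w)
  then obtain \<alpha> p' where *: "edge x a \<alpha>" "reads (pathfinish \<alpha>) w y p'" "p = \<alpha> +++ p'" by auto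
  obtain q where q: "reads y (inv_word w) (pathfinish \<alpha>) q" "homotopic_paths X (reversepath p') q"
    using Cons.IH[OF *(2)] by blast
  obtain \<beta> where \<beta>: "edge (pathfinish \<alpha>) (inv_letter a) \<beta>" "pathfinish \<beta> = x"
    "\<forall>s\<in>{0..1}. \<beta> s = reversepath \<alpha> s" using edge_reverse[OF *(1)] .
  let ?\<beta> = "\<beta> +++ (\<lambda>_. x)"
  have r\<beta>: "reads (pathfinish \<alpha>) [inv_letter a] x ?\<beta>" using reads_edge[OF \<beta>(1)] \<beta>(2) by simp
  obtain r where r: "reads y (inv_word w @ [inv_letter a]) x r" "homotopic_paths X (q +++ ?\<beta>) r"
    using reads_append[OF q(1) r\<beta>] by blast
  note pq = reads_path[OF *(2)] edge_path[OF *(1)] edge_path[OF \<beta>(1)] reads_path[OF q(1)] reads_path[OF r\<beta>]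
  have "homotopic_paths X (reversepath \<alpha>) \<beta>"
    using pq \<beta>(3) by (intro homotopic_paths_eq) auto
  also have "homotopic_paths X \<beta> ?\<beta>"
    using pq \<beta>(2) by (intro homotopic_paths_sym[OF homotopic_paths_const_right]) auto
  finally have "homotopic_paths X (reversepath p' +++ reversepath \<alpha>) (q +++ ?\<beta>)"
    using q(2) pq by (intro homotopic_paths_join) auto
  moreover have "reversepath p = reversepath p' +++ reversepath \<alpha>" unfolding *(3)
    using pq by (intro reversepath_joinpaths) auto
  ultimately have "homotopic_paths X (reversepath p) r" using homotopic_paths_trans[OF _ r(2)] by simp
  then show ?case using r(1) by auto
qed

text \<open>
  The relation to which \<open>ex_normal_form\<close> is applied: commuting letters are exchanged across squares,
  and inverse letters are cancelled along backtracking edges.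
\<close>

definition rewritable :: "letter list \<Rightarrow> letter list \<Rightarrow> bool" where
  "rewritable u v \<longleftrightarrow> (\<forall>x y p. reads x u y p \<longrightarrow> (\<exists>q. reads x v y q \<and> homotopic_paths X p q))"

lemma rewritable_refl: "rewritable u u"
  unfolding rewritable_def
proof (intro allI impI)
  fix x y p assume r: "reads x u y p"
  then have "homotopic_paths X p p" using reads_path[OF r] by simp
  with r show "\<exists>q. reads x u y q \<and> homotopic_paths X p q" by blast
qed

lemma rewritable_trans: "rewritable u v \<Longrightarrow> rewritable v w \<Longrightarrow> rewritable u w"
  unfolding rewritable_def using homotopic_paths_trans by metis

lemma rewritable_prefix: "rewritable u v \<Longrightarrow> rewritable (c @ u) (c @ v)"
proof (induction c)
  case (Cons a c)
  then have IH: "rewritable (c @ u) (c @ v)" by blast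
  show ?case unfolding rewritable_def
  proof (intro allI impI)
    fix x y p assume "reads x ((a # c) @ u) y p"
    then obtain \<alpha> p' where *: "edge x a \<alpha>" "reads (pathfinish \<alpha>) (c @ u) y p'" "p = \<alpha> +++ p'" by auto
    then obtain q where q: "reads (pathfinish \<alpha>) (c @ v) y q" "homotopic_paths X p' q"
      using IH unfolding rewritable_def by blast
    have "homotopic_paths X (\<alpha> +++ p') (\<alpha> +++ q)"
      using q edge_path[OF *(1)] reads_path[OF *(2)] by (intro homotopic_paths_join) auto
    then show "\<exists>q. reads x ((a # c) @ v) y q \<and> homotopic_paths X p q" using * q by auto
  qed
qed simp

lemma rewritable_swap:
  assumes ab: "com a b"
  shows "rewritable (c @ a # b # r) (c @ b # a # r)"
proof (rule rewritable_prefix)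
  show "rewritable (a # b # r) (b # a # r)" unfolding rewritable_def
  proof (intro allI impI)
    fix x y p assume "reads x (a # b # r) y p"
    then obtain \<alpha> \<beta> q where *: "edge x a \<alpha>" "edge (pathfinish \<alpha>) b \<beta>" "reads (pathfinish \<beta>) r y q"
      "p = \<alpha> +++ (\<beta> +++ q)" by auto
    obtain \<beta>' \<alpha>' where s: "edge x b \<beta>'" "edge (pathfinish \<beta>') a \<alpha>'" "pathfinish \<alpha>' = pathfinish \<beta>"
      "homotopic_paths X (\<alpha> +++ \<beta>) (\<beta>' +++ \<alpha>')" using square_swap[OF *(1,2) ab] .
    note pq = edge_path[OF *(1)] edge_path[OF *(2)] edge_path[OF s(1)] edge_path[OF s(2)] reads_path[OF *(3)]
    have "homotopic_paths X p ((\<alpha> +++ \<beta>) +++ q)" unfolding *(4)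
      using pq by (intro homotopic_paths_assoc) auto
    also have "homotopic_paths X \<dots> ((\<beta>' +++ \<alpha>') +++ q)"
      by (rule homotopic_paths_join[OF s(4)]) (use pq in auto)
    also have "homotopic_paths X \<dots> (\<beta>' +++ (\<alpha>' +++ q))"
      using pq s(3) by (intro homotopic_paths_assoc') auto
    finally have h: "homotopic_paths X p (\<beta>' +++ (\<alpha>' +++ q))" .
    have "reads x (b # a # r) y (\<beta>' +++ (\<alpha>' +++ q))"
      using reads_Cons[OF s(1) reads_Cons[OF s(2)]] *(3) s(3) by simp
    with h show "\<exists>q. reads x (b # a # r) y q \<and> homotopic_paths X p q" by blast
  qed
qed

lemma rewritable_cancel: "rewritable (c @ a # inv_letter a # r) (c @ r)"
proof (rule rewritable_prefix)
  show "rewritable (a # inv_letter a # r) r" unfolding rewritable_def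
  proof (intro allI impI)
    fix x y p assume "reads x (a # inv_letter a # r) y p"
    then obtain \<alpha> \<beta> q where *: "edge x a \<alpha>" "edge (pathfinish \<alpha>) (inv_letter a) \<beta>" "reads (pathfinish \<beta>) r y q"
      "p = \<alpha> +++ (\<beta> +++ q)" by auto
    obtain \<gamma> where \<gamma>: "edge (pathfinish \<alpha>) (inv_letter a) \<gamma>" "pathfinish \<gamma> = x"
      "\<forall>s\<in>{0..1}. \<gamma> s = reversepath \<alpha> s" using edge_reverse[OF *(1)] .
    have \<beta>: "\<beta> = \<gamma>" using *(2) \<gamma>(1) edge_unique by blast
    note pq = edge_path[OF *(1)] edge_path[OF *(2)] reads_path[OF *(3)]
    have "homotopic_paths X \<beta> (reversepath \<alpha>)"
      using pq \<gamma>(3) \<beta> by (intro homotopic_paths_eq) auto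
    then have "homotopic_paths X p (\<alpha> +++ (reversepath \<alpha> +++ q))" unfolding *(4)
      using pq \<beta> by (intro homotopic_paths_join) auto
    also have "homotopic_paths X \<dots> q"
      using pq \<gamma>(2) \<beta> by (intro homotopic_paths_cancel) auto
    finally show "\<exists>q. reads x r y q \<and> homotopic_paths X p q" using *(3) \<gamma>(2) \<beta> by auto
  qed
qed

end

context special_space
begin

section \<open>Every path is homotopic to an edge path\<close>

lemma corner_reads:
  assumes c: "(I, \<phi>) \<in> \<Phi>" and v: "v \<in> cube_vertices I" and w: "w \<in> cube_vertices I"
  shows "\<exists>u e. reads (\<phi> v) u (\<phi> w) e \<and> homotopic_paths X (\<phi> \<circ> line v w) e"
  using v
proof (induction "card {i \<in> I. v i \<noteq> w i}" arbitrary: v)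
  case 0
  then have "v i = w i" for i
    using cell(1)[OF c] w by (cases "i \<in> I") (auto simp: cube_vertices_def)
  then have "v = w" by blast
  moreover have "\<phi> \<circ> line w w = (\<lambda>_. \<phi> w)" by (simp add: fun_eq_iff)
  ultimately show ?case
    using vertex_of_corner[OF c w] vertex_in by (intro exI[of _ "[]"]) (auto simp: path_const)
next
  case (Suc n)
  then obtain i where i: "i \<in> I" "v i \<noteq> w i"
    by (metis (mono_tags, lifting) card.empty empty_Collect_eq nat.distinct(1))
  let ?v = "opposite v i"
  have v': "?v \<in> cube_vertices I" using opposite_vertex Suc.prems i by blast
  have "(v i = 0 \<or> v i = 1) \<and> (w i = 0 \<or> w i = 1)" using Suc.prems w i(1) by (auto simp: cube_vertices_def)
  then have "{j \<in> I. ?v j \<noteq> w j} = {j \<in> I. v j \<noteq> w j} - {i}" using i by (auto simp: opposite_def)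
  then have "n = card {j \<in> I. ?v j \<noteq> w j}"
    using Suc.hyps(2) i cell(1)[OF c] by simp
  from Suc.hyps(1)[OF this v'] obtain u e where
    e: "reads (\<phi> ?v) u (\<phi> w) e" "homotopic_paths X (\<phi> \<circ> line ?v w) e" by blast
  obtain a where a: "edge (\<phi> v) a (out_edge \<phi> v i)" using edge_of_direction[OF c Suc.prems i(1)] .
  note oe = out_edge_path[OF c Suc.prems i(1)]
  have r: "reads (\<phi> v) (a # u) (\<phi> w) (out_edge \<phi> v i +++ e)" by (rule reads_Cons[OF a]) (use e(1) oe(4) in simp)
  have cs: "v \<in> cube I" "?v \<in> cube I" "w \<in> cube I" using Suc.prems v' w cube_vertices_subset by blast+
  have "homotopic_paths X (\<phi> \<circ> line v w) (\<phi> \<circ> (line v ?v +++ line ?v w))"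
    using cs by (intro cube_paths_homotopic[where I = I] cell(2,3)[OF c]) (auto simp: path_image_join path_image_line)
  also have "\<phi> \<circ> (line v ?v +++ line ?v w) = (\<phi> \<circ> line v ?v) +++ (\<phi> \<circ> line ?v w)"
    by (rule path_compose_join)
  also have "homotopic_paths X \<dots> (out_edge \<phi> v i +++ e)"
    using oe(5) e(2) by (intro homotopic_paths_join) (auto simp: pathstart_def pathfinish_def)
  finally show ?case using r by blast
qed

lemma anchor_path:
  assumes "z \<in> X"
  shows "path (anchor z)" "path_image (anchor z) \<subseteq> X" "pathfinish (anchor z) = z" "pathstart (anchor z) \<in> vertices"
proof -
  obtain K \<kappa> u where c: "(K, \<kappa>) \<in> \<Phi>" "u \<in> open_cube K" "\<kappa> u = z" using ex_cell[OF assms] .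
  have a: "anchor z = \<kappa> \<circ> line (\<lambda>_. 0) u" using anchor_eq[OF c(1,2)] c(3) by simp
  have 0: "(\<lambda>_. 0) \<in> cube_vertices K" by (simp add: cube_vertices_def)
  have "u \<in> cube K" "(\<lambda>_. 0) \<in> cube K" using c(2) 0 open_cube_subset cube_vertices_subset by blast+
  then show "path (anchor z)" "path_image (anchor z) \<subseteq> X"
    unfolding a using cell_path[OF c(1) path_line(1) path_image_line] by blast+
  show "pathfinish (anchor z) = z" "pathstart (anchor z) \<in> vertices"
    using a c(3) vertex_of_corner[OF c(1) 0] by (auto simp: pathfinish_def pathstart_def)
qed

text \<open>
  Edge paths start and end at vertices, so the ends of \<open>p\<close> are first moved to vertices along the
  standard paths. Note that the standard path of a point leads from the vertex to the point.
\<close>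

definition edge_approximable :: "(real \<Rightarrow> 'a) \<Rightarrow> bool" where
  "edge_approximable p \<longleftrightarrow> path p \<and> path_image p \<subseteq> X \<and>
     (\<exists>u e. reads (pathstart (anchor (pathstart p))) u (pathstart (anchor (pathfinish p))) e \<and>
        homotopic_paths X p ((reversepath (anchor (pathstart p)) +++ e) +++ anchor (pathfinish p)))"

lemma edge_approximable_homotopic:
  assumes "homotopic_paths X p q" "edge_approximable q"
  shows "edge_approximable p"
  using assms homotopic_paths_imp_pathstart[OF assms(1)] homotopic_paths_imp_pathfinish[OF assms(1)]
    homotopic_paths_imp_path[OF assms(1)] homotopic_paths_imp_subset[OF assms(1)] homotopic_paths_trans[OF assms(1)]
  unfolding edge_approximable_def by metis

lemma path_ends_in:
  assumes "path_image p \<subseteq> X"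
  shows "pathstart p \<in> X" "pathfinish p \<in> X"
  using assms pathstart_in_path_image[of p] pathfinish_in_path_image[of p] by blast+

text \<open>
  Inside a convex cube a segment can be replaced by a path via two corners, and the corners can be
  joined along edges of the cube.
\<close>

lemma edge_approximable_line:
  assumes c: "(I, \<phi>) \<in> \<Phi>" and t: "t \<in> cube I" and t': "t' \<in> cube I"
  shows "edge_approximable (\<phi> \<circ> line t t')"
proof -
  obtain v where v: "v \<in> cube_vertices I" "\<And>s. s \<in> {0..1} \<Longrightarrow> anchor (\<phi> t) s = \<phi> (line v t s)"
    using anchor_in_cube[OF c t] by blast
  obtain v' where v': "v' \<in> cube_vertices I" "\<And>s. s \<in> {0..1} \<Longrightarrow> anchor (\<phi> t') s = \<phi> (line v' t' s)"
    using anchor_in_cube[OF c t'] by blast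
  obtain u e where e: "reads (\<phi> v) u (\<phi> v') e" "homotopic_paths X (\<phi> \<circ> line v v') e"
    using corner_reads[OF c v(1) v'(1)] by blast
  have vc: "v \<in> cube I" "v' \<in> cube I" using v(1) v'(1) cube_vertices_subset by blast+
  note cp = cell_path[OF c path_line(1) path_image_line]
  have tX: "\<phi> t \<in> X" "\<phi> t' \<in> X" using cell_in[OF c] t t' by auto
  have h1: "homotopic_paths X (\<phi> \<circ> line t v) (reversepath (anchor (\<phi> t)))"
  proof (rule homotopic_paths_eq[OF cp[OF t vc(1)]])
    fix s :: real assume "s \<in> {0..1}"
    then show "(\<phi> \<circ> line t v) s = reversepath (anchor (\<phi> t)) s"
      using v(2)[of "1 - s"] by (simp add: reversepath_def line_swap)
  qed
  have h2: "homotopic_paths X (\<phi> \<circ> line v' t') (anchor (\<phi> t'))"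
    by (rule homotopic_paths_eq[OF cp[OF vc(2) t']]) (use v'(2) in simp)
  have "homotopic_paths X (\<phi> \<circ> line t t') (\<phi> \<circ> ((line t v +++ line v v') +++ line v' t'))"
    using t t' vc by (intro cube_paths_homotopic[where I = I] cell(2,3)[OF c]) (auto simp: path_image_join path_image_line)
  also have "\<phi> \<circ> ((line t v +++ line v v') +++ line v' t') =
      ((\<phi> \<circ> line t v) +++ (\<phi> \<circ> line v v')) +++ (\<phi> \<circ> line v' t')" by (simp add: path_compose_join)
  also have "homotopic_paths X \<dots> ((reversepath (anchor (\<phi> t)) +++ e) +++ anchor (\<phi> t'))"
    using h1 h2 e(2) by (intro homotopic_paths_join) (auto simp: pathstart_compose pathfinish_compose)
  finally have h: "homotopic_paths X (\<phi> \<circ> line t t') ((reversepath (anchor (\<phi> t)) +++ e) +++ anchor (\<phi> t'))" .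
  have ends: "pathstart (\<phi> \<circ> line t t') = \<phi> t" "pathfinish (\<phi> \<circ> line t t') = \<phi> t'"
    "pathstart (anchor (\<phi> t)) = \<phi> v" "pathstart (anchor (\<phi> t')) = \<phi> v'"
    using v(2)[of 0] v'(2)[of 0] by (auto simp: pathstart_def pathfinish_def)
  show ?thesis unfolding edge_approximable_def ends
    using cp[OF t t'] h e(1) by blast
qed

lemma edge_approximable_join:
  assumes p: "edge_approximable p" and q: "edge_approximable q" and pq: "pathfinish p = pathstart q"
  shows "edge_approximable (p +++ q)"
proof -
  define a b c where "a = anchor (pathstart p)" and "b = anchor (pathstart q)" and "c = anchor (pathfinish q)"
  have P: "path p" "path_image p \<subseteq> X" "path q" "path_image q \<subseteq> X" using p q by (auto simp: edge_approximable_def)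
  obtain u e where e: "reads (pathstart a) u (pathstart b) e" "homotopic_paths X p ((reversepath a +++ e) +++ b)"
    using p pq unfolding edge_approximable_def a_def b_def by auto
  obtain u' e' where e': "reads (pathstart b) u' (pathstart c) e'" "homotopic_paths X q ((reversepath b +++ e') +++ c)"
    using q unfolding edge_approximable_def b_def c_def by auto
  obtain r where r: "reads (pathstart a) (u @ u') (pathstart c) r" "homotopic_paths X (e +++ e') r"
    using reads_append[OF e(1) e'(1)] by blast
  have A: "path a" "path_image a \<subseteq> X" "pathfinish a = pathstart p"
    "path b" "path_image b \<subseteq> X" "pathfinish b = pathstart q"
    "path c" "path_image c \<subseteq> X" "pathfinish c = pathfinish q"
    unfolding a_def b_def c_def using anchor_path path_ends_in[OF P(2)] path_ends_in[OF P(4)] by auto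
  note R = reads_path[OF e(1)] reads_path[OF e'(1)] reads_path[OF r(1)]
  have "homotopic_paths X (p +++ q) (((reversepath a +++ e) +++ b) +++ ((reversepath b +++ e') +++ c))"
    using homotopic_paths_join[OF e(2) e'(2) pq] .
  also have "homotopic_paths X \<dots> ((reversepath a +++ e) +++ (b +++ ((reversepath b +++ e') +++ c)))"
    using A R by (intro homotopic_paths_assoc') (auto simp: path_image_join)
  also have "homotopic_paths X \<dots> ((reversepath a +++ e) +++ (b +++ (reversepath b +++ (e' +++ c))))"
    by (rule homotopic_paths_join, use A R in \<open>simp add: path_image_join\<close>,
        rule homotopic_paths_join, use A R in \<open>simp add: path_image_join\<close>,
        rule homotopic_paths_assoc') (use A R in \<open>auto simp: path_image_join\<close>)
  also have "homotopic_paths X \<dots> ((reversepath a +++ e) +++ (e' +++ c))"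
    by (rule homotopic_paths_join, use A R in \<open>simp add: path_image_join\<close>,
        rule homotopic_paths_cancel) (use A R in \<open>auto simp: path_image_join\<close>)
  also have "homotopic_paths X \<dots> (((reversepath a +++ e) +++ e') +++ c)"
    using A R by (intro homotopic_paths_assoc) (auto simp: path_image_join)
  also have "homotopic_paths X \<dots> ((reversepath a +++ (e +++ e')) +++ c)"
    by (rule homotopic_paths_join, rule homotopic_paths_assoc') (use A R in \<open>auto simp: path_image_join\<close>)
  also have "homotopic_paths X \<dots> ((reversepath a +++ r) +++ c)"
    using A R r(2) by (intro homotopic_paths_join) (auto simp: path_image_join)
  finally have h: "homotopic_paths X (p +++ q) ((reversepath a +++ r) +++ c)" .
  have ends: "pathstart (p +++ q) = pathstart p" "pathfinish (p +++ q) = pathfinish q" by auto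
  show ?thesis unfolding edge_approximable_def ends a_def[symmetric] c_def[symmetric]
    using homotopic_paths_imp_path[OF h] homotopic_paths_imp_subset[OF h] r(1) h by blast
qed

lemma edge_approximable_reverse:
  assumes p: "edge_approximable p"
  shows "edge_approximable (reversepath p)"
proof -
  define a b where "a = anchor (pathstart p)" and "b = anchor (pathfinish p)"
  have P: "path p" "path_image p \<subseteq> X" using p by (auto simp: edge_approximable_def)
  obtain u e where e: "reads (pathstart a) u (pathstart b) e" "homotopic_paths X p ((reversepath a +++ e) +++ b)"
    using p unfolding edge_approximable_def a_def b_def by auto
  obtain r where r: "reads (pathstart b) (inv_word u) (pathstart a) r" "homotopic_paths X (reversepath e) r"
    using reads_inverse[OF e(1)] by blast
  have A: "path a" "path_image a \<subseteq> X" "pathfinish a = pathstart p"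
    "path b" "path_image b \<subseteq> X" "pathfinish b = pathfinish p"
    unfolding a_def b_def using anchor_path path_ends_in[OF P(2)] by auto
  note R = reads_path[OF e(1)] reads_path[OF r(1)]
  have "homotopic_paths X (reversepath p) (reversepath ((reversepath a +++ e) +++ b))"
    using e(2) by (simp add: homotopic_paths_reversepath)
  also have "reversepath ((reversepath a +++ e) +++ b) = reversepath b +++ (reversepath e +++ a)"
    using A R by (simp add: reversepath_joinpaths)
  also have "homotopic_paths X \<dots> (reversepath b +++ (r +++ a))"
    using A R r(2) by (intro homotopic_paths_join) (auto simp: path_image_join)
  also have "homotopic_paths X \<dots> ((reversepath b +++ r) +++ a)"
    using A R by (intro homotopic_paths_assoc) (auto simp: path_image_join)
  finally have h: "homotopic_paths X (reversepath p) ((reversepath b +++ r) +++ a)" .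
  have ends: "pathstart (reversepath p) = pathfinish p" "pathfinish (reversepath p) = pathstart p" by auto
  show ?thesis unfolding edge_approximable_def ends a_def[symmetric] b_def[symmetric]
    using homotopic_paths_imp_path[OF h] homotopic_paths_imp_subset[OF h] r(1) h by blast
qed

lemma homotopic_subpaths_join:
  assumes p: "path p" "path_image p \<subseteq> X" and "a \<in> {0..1}" "b \<in> {0..1}" "c \<in> {0..1}"
  shows "homotopic_paths X (p \<circ> linepath a c) ((p \<circ> linepath a b) +++ (p \<circ> linepath b c))"
proof -
  have seg: "closed_segment u v \<subseteq> {0..1}" if "u \<in> {0..1}" "v \<in> {0..1}" for u v :: real
    using that by (intro closed_segment_subset) auto
  have "homotopic_paths X (p \<circ> linepath a c) (p \<circ> (linepath a b +++ linepath b c))"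
    by (rule homotopic_paths_compose_unit[OF p]) (use seg assms(3-) in \<open>auto simp: path_image_join\<close>)
  then show ?thesis by (simp add: path_compose_join)
qed

text \<open>
  The property passes from two adjacent subintervals of the unit interval to their union. Every
  parameter has a neighbourhood whose subintervals are mapped into a star of the corresponding point
  \<open>z\<close>; when such a subinterval is cut at the parameter of \<open>z\<close>, its two parts are homotopic to
  segments in cubes. So the claim follows by the usual compactness argument for intervals.
\<close>

theorem path_edge_approximable:
  assumes p: "path p" "path_image p \<subseteq> X"
  shows "edge_approximable p"
proof -
  have "0 \<le> (0::real) \<longrightarrow> 1 \<le> (1::real) \<longrightarrow> edge_approximable (p \<circ> linepath 0 1)"
  proof (rule Bolzano[where P = "\<lambda>a b. 0 \<le> a \<longrightarrow> b \<le> 1 \<longrightarrow> edge_approximable (p \<circ> linepath a b)"])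
    fix a b c :: real
    assume 1: "0 \<le> a \<longrightarrow> b \<le> 1 \<longrightarrow> edge_approximable (p \<circ> linepath a b)"
      "0 \<le> b \<longrightarrow> c \<le> 1 \<longrightarrow> edge_approximable (p \<circ> linepath b c)" "a \<le> b" "b \<le> c"
    show "0 \<le> a \<longrightarrow> c \<le> 1 \<longrightarrow> edge_approximable (p \<circ> linepath a c)"
    proof (intro impI)
      assume "0 \<le> a" "c \<le> 1"
      then have "edge_approximable ((p \<circ> linepath a b) +++ (p \<circ> linepath b c))"
        using 1 by (intro edge_approximable_join) (auto simp: pathstart_compose pathfinish_compose)
      moreover have "homotopic_paths X (p \<circ> linepath a c) ((p \<circ> linepath a b) +++ (p \<circ> linepath b c))"
        using p 1 \<open>0 \<le> a\<close> \<open>c \<le> 1\<close> by (intro homotopic_subpaths_join) auto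
      ultimately show "edge_approximable (p \<circ> linepath a c)" using edge_approximable_homotopic by blast
    qed
  next
    fix x :: real assume x: "0 \<le> x" "x \<le> 1"
    define z where "z = p x"
    have zX: "z \<in> X" using p(2) x by (auto simp: z_def path_image_def)
    obtain e where g: "gap z e" using ex_gap[OF zX] by blast
    obtain O' where O': "open O'" "star z e = X \<inter> O'" using open_star[OF g] by (auto simp: openin_open)
    have "z \<in> O'" using star_center[OF zX g] O'(2) by blast
    then obtain A where A: "open A" "x \<in> A" "\<And>s. s \<in> {0..1} \<Longrightarrow> s \<in> A \<Longrightarrow> p s \<in> O'"
      using p(1) O'(1) x unfolding path_def continuous_on_topological z_def by (metis atLeastAtMost_iff)
    from openE[OF A(1,2)] obtain d where d: "d > 0" "ball x d \<subseteq> A" .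
    have ray: "edge_approximable (p \<circ> linepath x s)" if s: "s \<in> {0..1}" "\<bar>s - x\<bar> < d" for s
    proof -
      have seg: "closed_segment x s \<subseteq> {0..1}" using x s by (intro closed_segment_subset) auto
      then have pa: "path (p \<circ> linepath x s)"
        using p(1) by (intro path_continuous_image) (auto simp: path_def intro: continuous_on_subset)
      have "closed_segment x s \<subseteq> ball x d \<inter> {0..1}"
        using s x by (intro Int_greatest closed_segment_subset) (auto simp: dist_real_def d)
      then have "p r \<in> star z e" if "r \<in> closed_segment x s" for r
        using that A(3)[of r] d(2) O'(2) p(2) unfolding path_image_def by blast
      then have im: "path_image (p \<circ> linepath x s) \<subseteq> star z e" by (auto simp: path_image_compose)
      have st: "pathstart (p \<circ> linepath x s) = z" by (simp add: z_def pathstart_compose)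
      from path_from_center[OF finite_cells g pa im st]
      obtain I \<phi> t0 t where "(I, \<phi>) \<in> \<Phi>" "t0 \<in> cube I" "t \<in> cube I"
        "homotopic_paths X (p \<circ> linepath x s) (\<phi> \<circ> line t0 t)" by (elim exE conjE) (rule that)
      then show ?thesis using edge_approximable_line edge_approximable_homotopic by blast
    qed
    show "\<exists>d>0. \<forall>a b. a \<le> x \<and> x \<le> b \<and> b - a < d \<longrightarrow> 0 \<le> a \<longrightarrow> b \<le> 1 \<longrightarrow> edge_approximable (p \<circ> linepath a b)"
    proof (intro exI[of _ d] conjI allI impI)
      show "d > 0" by fact
      fix a b assume ab: "a \<le> x \<and> x \<le> b \<and> b - a < d" "0 \<le> a" "b \<le> 1"
      have "edge_approximable (p \<circ> linepath a x)"
        using edge_approximable_reverse[OF ray[of a]] ab x by (simp add: path_compose_reversepath[symmetric])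
      moreover have "edge_approximable (p \<circ> linepath x b)" using ray[of b] ab x by simp
      ultimately have "edge_approximable ((p \<circ> linepath a x) +++ (p \<circ> linepath x b))"
        by (rule edge_approximable_join) (simp add: pathstart_compose pathfinish_compose)
      moreover have "homotopic_paths X (p \<circ> linepath a b) ((p \<circ> linepath a x) +++ (p \<circ> linepath x b))"
        using p ab x by (intro homotopic_subpaths_join) auto
      ultimately show "edge_approximable (p \<circ> linepath a b)" using edge_approximable_homotopic by blast
    qed
  qed simp
  moreover have "p \<circ> linepath 0 1 = p" by (simp add: fun_eq_iff linepath_def)
  ultimately show ?thesis by simp
qed

end

section \<open>Words of homotopic edge paths\<close>

context raag
begin

text \<open>
  The loop of the generator \<open>v\<close> is \<open>cis (2 * pi * s)\<close>, which passes through \<open>-1\<close> from the upper to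
  the lower half plane. The condition on the real parts excludes that the real axis is crossed at \<open>1\<close>.
\<close>

definition cross :: "nat \<Rightarrow> complex \<Rightarrow> complex \<Rightarrow> stacks \<Rightarrow> stacks" where
  "cross v y z = (if Re y < 0 \<and> Re z < 0 then
     if Im y \<ge> 0 \<and> Im z < 0 then act (v, True)
     else if Im y < 0 \<and> Im z \<ge> 0 then act (v, False) else id else id)"

lemma act_True_False [simp]: "act (v, True) (act (v, False) p) = p" "act (v, False) (act (v, True) p) = p"
  using act_inv[of "(v, False)" p] act_inv[of "(v, True)" p] by (auto simp: inv_letter_def)

text \<open>
  A point \<open>z\<close> of the unit circle in the left half plane which is closer than \<open>1 / 2\<close> to a point on
  the other side of the real axis has real part at most \<open>- 1 / 2\<close>.
\<close>

lemma cross_far: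
  assumes z: "cmod z = 1" "Re z < 0" and zw: "cmod (z - w) < 1 / 2" "Im z < 0 \<longleftrightarrow> Im w \<ge> 0"
    and yz: "cmod (y - z) < 1 / 2"
  shows "Re y < 0"
proof -
  have "\<bar>Im z\<bar> \<le> \<bar>Im (z - w)\<bar>" using zw(2) by auto
  also have "\<dots> < 1 / 2" using abs_Im_le_cmod[of "z - w"] zw(1) by linarith
  finally have "\<bar>Im z\<bar> ^ 2 < (1 / 2) ^ 2" by (intro power_strict_mono) auto
  then have im: "(Im z)\<^sup>2 < 1 / 4" by (simp add: power2_eq_square)
  have "(Re z)\<^sup>2 + (Im z)\<^sup>2 = 1" using z(1) by (simp add: cmod_power2[symmetric])
  with im have re: "(Re z)\<^sup>2 > 3 / 4" by linarith
  have "Re z \<le> - 1 / 2"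
  proof (rule ccontr)
    assume "\<not> Re z \<le> - 1 / 2"
    then have "\<bar>Re z\<bar> ^ 2 \<le> (1 / 2) ^ 2" using z(2) by (intro power_mono) auto
    then show False using re by (simp add: power2_eq_square)
  qed
  moreover have "Re (y - z) < 1 / 2" using complex_Re_le_cmod[of "y - z"] yz by linarith
  ultimately show ?thesis by simp
qed

text \<open>
  If one of the three points has nonnegative real part, then by the previous lemma the other two are
  not on different sides of \<open>-1\<close>, and nothing happens at all. Otherwise only the signs of the
  imaginary parts matter.
\<close>

lemma cross_trans:
  assumes "cmod y = 1" "cmod z = 1" "cmod w = 1"
    and d: "cmod (y - z) < 1 / 2" "cmod (z - w) < 1 / 2" "cmod (y - w) < 1 / 2"
  shows "cross v z w (cross v y z p) = cross v y w p"
proof -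
  note sym = norm_minus_commute[of y z] norm_minus_commute[of z w] norm_minus_commute[of y w]
  consider "Re y < 0" "Re z < 0" "Re w < 0" | "Re y \<ge> 0" | "Re z \<ge> 0" | "Re w \<ge> 0" by linarith
  then show ?thesis
  proof cases
    case 1
    then show ?thesis by (auto simp: cross_def)
  next
    case 2
    have "\<not> (Re z < 0 \<and> (Im z < 0 \<longleftrightarrow> Im w \<ge> 0))" using cross_far[of z w y] 2 assms by auto
    then show ?thesis using 2 by (auto simp: cross_def)
  next
    case 3
    have "\<not> (Re y < 0 \<and> (Im y < 0 \<longleftrightarrow> Im w \<ge> 0))" using cross_far[of y w z] 3 assms sym by auto
    then show ?thesis using 3 by (auto simp: cross_def)
  next
    case 4
    have "\<not> (Re z < 0 \<and> (Im z < 0 \<longleftrightarrow> Im y \<ge> 0))" using cross_far[of z y w] 4 assms sym by auto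
    then show ?thesis using 4 by (auto simp: cross_def)
  qed
qed

lemma cross_refl [simp]: "cross v y y p = p"
  by (auto simp: cross_def)

text \<open>
  If both maps are nontrivial, then the two coordinates of \<open>z\<close> are different from \<open>1\<close>, so by the
  definition of the Salvetti complex the two generators are adjacent.
\<close>

lemma cross_commute:
  assumes z: "z \<in> salvetti V E" and uv: "u \<noteq> v"
  shows "cross u (z u) c1 (cross v c2 (z v) p) = cross v c2 (z v) (cross u (z u) c1 p)"
proof (cases "Re (z u) < 0 \<and> Re (z v) < 0")
  case True
  then have "z u \<noteq> 1" "z v \<noteq> 1" by auto
  then have "{u, v} \<in> E" using z uv by (auto simp: salvetti_def clique_def)
  then have "com (u, b) (v, b')" for b b' using uv by (simp add: com_def)
  note c = act_com[OF this]
  show ?thesis by (auto simp: cross_def c)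
qed (auto simp: cross_def)

text \<open>
  The effect of moving from \<open>y\<close> to a nearby point \<open>z\<close> of the Salvetti complex. The maps for the
  different coordinates commute, so their order is irrelevant.
\<close>

definition transit :: "(nat \<Rightarrow> complex) \<Rightarrow> (nat \<Rightarrow> complex) \<Rightarrow> stacks \<Rightarrow> stacks" where
  "transit y z = fold (\<lambda>v. cross v (y v) (z v)) (sorted_list_of_set V)"

definition close :: "(nat \<Rightarrow> complex) \<Rightarrow> (nat \<Rightarrow> complex) \<Rightarrow> bool" where
  "close y z \<longleftrightarrow> (\<forall>v\<in>V. cmod (y v - z v) < 1 / 2)"

lemma finite_V: "finite V"
  using graph by (simp add: finite_simple_graph_def)

lemma close_refl: "close y y"
  by (simp add: close_def)

lemma transit_refl [simp]: "transit y y p = p"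
proof -
  have "fold (\<lambda>v. cross v (y v) (y v)) L p = p" for L by (induction L arbitrary: p) auto
  then show ?thesis by (simp add: transit_def)
qed

text \<open>
  The cocycle condition: on a small scale the effect of a path depends only on its end points.
\<close>

lemma transit_trans:
  assumes S: "y \<in> salvetti V E" "z \<in> salvetti V E" "w \<in> salvetti V E"
    and c: "close y z" "close z w" "close y w"
  shows "transit z w (transit y z p) = transit y w p"
proof -
  have comm: "cross v (z v) (w v) (fold (\<lambda>u. cross u (y u) (z u)) L p) =
      fold (\<lambda>u. cross u (y u) (z u)) L (cross v (z v) (w v) p)" if "v \<notin> set L" for v L p
    using that by (induction L arbitrary: p) (auto simp: cross_commute[OF S(2)])
  have "fold (\<lambda>v. cross v (z v) (w v)) L (fold (\<lambda>v. cross v (y v) (z v)) L p) = fold (\<lambda>v. cross v (y v) (w v)) L p"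
    if "distinct L" "set L \<subseteq> V" for L
    using that
  proof (induction L arbitrary: p)
    case (Cons v L)
    have "cross v (z v) (w v) (cross v (y v) (z v) p) = cross v (y v) (w v) p" for p
      using Cons.prems S c by (intro cross_trans) (auto simp: salvetti_def close_def)
    then show ?case using Cons comm[of v L] by simp
  qed simp
  then show ?thesis using finite_V by (simp add: transit_def)
qed

lemma transit_single:
  assumes v: "v \<in> V" and u: "\<And>u p. u \<noteq> v \<Longrightarrow> cross u (y u) (z u) p = p"
  shows "transit y z p = cross v (y v) (z v) p"
proof -
  have "fold (\<lambda>v. cross v (y v) (z v)) L p = (if v \<in> set L then cross v (y v) (z v) p else p)" if "distinct L" for L p
    using that
  proof (induction L arbitrary: p)
    case (Cons k L)
    then show ?case using u by (cases "k = v") auto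
  qed simp
  then show ?thesis using v finite_V by (simp add: transit_def)
qed

text \<open>
  A lift of \<open>q\<close> to the covering space of the Salvetti complex whose fibre is the set of stacks on which
  the Artin group acts. Instead of a topology on the total space, the transition maps \<open>transit\<close>
  describe how a lift has to continue; the scale \<open>e\<close> at which they do is uniform along the path.
\<close>

definition lift_at :: "real \<Rightarrow> real \<Rightarrow> real \<Rightarrow> (real \<Rightarrow> nat \<Rightarrow> complex) \<Rightarrow> (real \<Rightarrow> stacks) \<Rightarrow> bool" where
  "lift_at e a b q m \<longleftrightarrow> (\<forall>s\<in>{a..b}. \<forall>s'\<in>{a..b}. \<bar>s - s'\<bar> < e \<longrightarrow>
     close (q s) (q s') \<and> m s' = transit (q s) (q s') (m s))"

definition lift :: "(real \<Rightarrow> nat \<Rightarrow> complex) \<Rightarrow> (real \<Rightarrow> stacks) \<Rightarrow> bool" where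
  "lift q m \<longleftrightarrow> (\<exists>e>0. lift_at e 0 1 q m)"

lemma lift_atD:
  assumes "lift_at e a b q m" "s \<in> {a..b}" "s' \<in> {a..b}" "\<bar>s - s'\<bar> < e"
  shows "close (q s) (q s')" "m s' = transit (q s) (q s') (m s)"
  using assms unfolding lift_at_def by blast+

lemma lift_at_glue:
  assumes S: "\<And>s. s \<in> {a..c} \<Longrightarrow> q s \<in> salvetti V E" and abc: "a \<le> b" "b \<le> c"
    and cl: "\<And>s s'. s \<in> {a..c} \<Longrightarrow> s' \<in> {a..c} \<Longrightarrow> \<bar>s - s'\<bar> < e \<Longrightarrow> close (q s) (q s')"
    and m: "lift_at e a b q m" and m': "lift_at e b c q m'" and b: "m b = m' b"
  shows "lift_at e a c q (\<lambda>s. if s \<le> b then m s else m' s)"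
  unfolding lift_at_def
proof (intro ballI impI conjI)
  fix s s' assume s: "s \<in> {a..c}" "s' \<in> {a..c}" "\<bar>s - s'\<bar> < e"
  show "close (q s) (q s')" by (rule cl[OF s])
  have b': "b \<in> {a..c}" using abc by auto
  have tr: "transit (q b) (q s') (transit (q s) (q b) p) = transit (q s) (q s') p"
    if "\<bar>s - b\<bar> < e" "\<bar>b - s'\<bar> < e" for p
    using that s b' by (intro transit_trans S cl) auto
  consider "s \<le> b" "s' \<le> b" | "b < s" "b < s'" | "s \<le> b" "b < s'" | "b < s" "s' \<le> b" by linarith
  then show "(if s' \<le> b then m s' else m' s') = transit (q s) (q s') (if s \<le> b then m s else m' s)"
  proof cases
    case 1
    then show ?thesis using s lift_atD(2)[OF m _ _ s(3)] by simp
  next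
    case 2
    then show ?thesis using s lift_atD(2)[OF m' _ _ s(3)] by simp
  next
    case 3
    then have "\<bar>s - b\<bar> < e" "\<bar>b - s'\<bar> < e" using s by auto
    moreover have "m b = transit (q s) (q b) (m s)" "m' s' = transit (q b) (q s') (m' b)"
      using calculation 3 s abc by (auto intro: lift_atD(2)[OF m] lift_atD(2)[OF m'])
    ultimately show ?thesis using 3 tr[of "m s"] b by simp
  next
    case 4
    then have "\<bar>s - b\<bar> < e" "\<bar>b - s'\<bar> < e" using s by auto
    moreover have "m' b = transit (q s) (q b) (m' s)" "m s' = transit (q b) (q s') (m b)"
      using calculation 4 s abc by (auto intro: lift_atD(2)[OF m] lift_atD(2)[OF m'])
    ultimately show ?thesis using 4 tr[of "m' s"] b by simp
  qed
qed

lemma ex_lift_at: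
  assumes S: "\<And>s. s \<in> {0..1} \<Longrightarrow> q s \<in> salvetti V E" and e: "e > 0"
    and cl: "\<And>s s'. s \<in> {0..1} \<Longrightarrow> s' \<in> {0..1} \<Longrightarrow> \<bar>s - s'\<bar> < e \<Longrightarrow> close (q s) (q s')"
  shows "\<exists>m. lift_at e 0 1 q m \<and> m 0 = p"
proof -
  have "0 \<le> (0::real) \<longrightarrow> 1 \<le> (1::real) \<longrightarrow> (\<forall>p. \<exists>m. lift_at e 0 1 q m \<and> m 0 = p)"
  proof (rule Bolzano[where P = "\<lambda>a b. 0 \<le> a \<longrightarrow> b \<le> 1 \<longrightarrow> (\<forall>p. \<exists>m. lift_at e a b q m \<and> m a = p)"])
    fix a b c :: real
    assume 1: "0 \<le> a \<longrightarrow> b \<le> 1 \<longrightarrow> (\<forall>p. \<exists>m. lift_at e a b q m \<and> m a = p)"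
      "0 \<le> b \<longrightarrow> c \<le> 1 \<longrightarrow> (\<forall>p. \<exists>m. lift_at e b c q m \<and> m b = p)" "a \<le> b" "b \<le> c"
    show "0 \<le> a \<longrightarrow> c \<le> 1 \<longrightarrow> (\<forall>p. \<exists>m. lift_at e a c q m \<and> m a = p)"
    proof (intro impI allI)
      fix p assume ac: "0 \<le> a" "c \<le> 1"
      obtain m where m: "lift_at e a b q m" "m a = p" using 1 ac by force
      obtain m' where m': "lift_at e b c q m'" "m' b = m b" using 1 ac by force
      have "lift_at e a c q (\<lambda>s. if s \<le> b then m s else m' s)"
        using 1 ac m m' by (intro lift_at_glue S cl) auto
      then show "\<exists>m. lift_at e a c q m \<and> m a = p" using m(2) 1(3)
        by (intro exI[of _ "\<lambda>s. if s \<le> b then m s else m' s"]) simp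
    qed
  next
    fix x :: real
    show "\<exists>d>0. \<forall>a b. a \<le> x \<and> x \<le> b \<and> b - a < d \<longrightarrow> 0 \<le> a \<longrightarrow> b \<le> 1 \<longrightarrow> (\<forall>p. \<exists>m. lift_at e a b q m \<and> m a = p)"
    proof (intro exI[of _ e] conjI allI impI)
      show "e > 0" by fact
      fix a b p assume ab: "a \<le> x \<and> x \<le> b \<and> b - a < e" "0 \<le> a" "b \<le> 1"
      have "lift_at e a b q (\<lambda>s. transit (q a) (q s) p)" unfolding lift_at_def
      proof (intro ballI impI conjI)
        fix s s' assume s: "s \<in> {a..b}" "s' \<in> {a..b}" "\<bar>s - s'\<bar> < e"
        then show "close (q s) (q s')" using ab by (intro cl) auto
        show "transit (q a) (q s') p = transit (q s) (q s') (transit (q a) (q s) p)"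
          using s ab by (intro transit_trans[symmetric] S cl) auto
      qed
      then show "\<exists>m. lift_at e a b q m \<and> m a = p"
        by (intro exI[of _ "\<lambda>s. transit (q a) (q s) p"]) simp
    qed
  qed simp
  then show ?thesis by simp
qed

lemma lift_unique:
  assumes "lift q m" "lift q m'" "m 0 = m' 0"
  shows "m 1 = m' 1"
proof -
  obtain e1 where e1: "e1 > 0" "lift_at e1 0 1 q m" using assms(1) by (auto simp: lift_def)
  obtain e2 where e2: "e2 > 0" "lift_at e2 0 1 q m'" using assms(2) by (auto simp: lift_def)
  have "0 \<le> (0::real) \<longrightarrow> 1 \<le> (1::real) \<longrightarrow> m 0 = m' 0 \<longrightarrow> m 1 = m' 1"
  proof (rule Bolzano[where P = "\<lambda>a b. 0 \<le> a \<longrightarrow> b \<le> 1 \<longrightarrow> m a = m' a \<longrightarrow> m b = m' b"])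
    fix x :: real
    show "\<exists>d>0. \<forall>a b. a \<le> x \<and> x \<le> b \<and> b - a < d \<longrightarrow> 0 \<le> a \<longrightarrow> b \<le> 1 \<longrightarrow> m a = m' a \<longrightarrow> m b = m' b"
    proof (intro exI[of _ "min e1 e2"] conjI allI impI)
      show "min e1 e2 > 0" using e1 e2 by simp
      fix a b assume "a \<le> x \<and> x \<le> b \<and> b - a < min e1 e2" "0 \<le> a" "b \<le> 1" "m a = m' a"
      then show "m b = m' b" using lift_atD(2)[OF e1(2), of a b] lift_atD(2)[OF e2(2), of a b] by auto
    qed
  qed auto
  then show ?thesis using assms(3) by simp
qed

lemma lift_cong:
  assumes "\<And>s. s \<in> {0..1} \<Longrightarrow> q s = q' s" "lift q m" "\<And>s. s \<in> {0..1} \<Longrightarrow> m s = m' s"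
  shows "lift q' m'"
  using assms by (auto simp: lift_def lift_at_def)

lemma lift_const: "lift (\<lambda>_. y) (\<lambda>_. p)"
  unfolding lift_def lift_at_def by (intro exI[of _ 1]) (auto simp: close_refl)

lemma lift_reverse: "lift q m \<Longrightarrow> lift (\<lambda>s. q (1 - s)) (\<lambda>s. m (1 - s))"
proof -
  assume "lift q m"
  then obtain e where e: "e > 0" "lift_at e 0 1 q m" by (auto simp: lift_def)
  have "lift_at e 0 1 (\<lambda>s. q (1 - s)) (\<lambda>s. m (1 - s))" unfolding lift_at_def
  proof (intro ballI impI)
    fix s s' :: real assume s: "s \<in> {0..1}" "s' \<in> {0..1}" "\<bar>s - s'\<bar> < e"
    show "close (q (1 - s)) (q (1 - s')) \<and> m (1 - s') = transit (q (1 - s)) (q (1 - s')) (m (1 - s))"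
      using lift_atD[OF e(2), of "1 - s" "1 - s'"] s by auto
  qed
  then show ?thesis using e(1) by (auto simp: lift_def)
qed

lemma close_of_continuous:
  fixes q :: "'b::metric_space \<Rightarrow> nat \<Rightarrow> complex"
  assumes K: "compact K" and q: "continuous_on K q"
  shows "\<exists>e>0. \<forall>x\<in>K. \<forall>y\<in>K. dist x y < e \<longrightarrow> close (q x) (q y)"
proof -
  have "\<exists>e>0. \<forall>d. 0 < d \<longrightarrow> d \<le> e \<longrightarrow> (\<forall>v\<in>V. \<forall>x\<in>K. \<forall>y\<in>K. dist x y < d \<longrightarrow> cmod (q x v - q y v) < 1 / 2)"
  proof (rule finite_uniform[OF finite_V])
    fix v
    have "continuous_on K (\<lambda>x. q x v)" by (rule continuous_on_product_then_coordinatewise[OF q])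
    from compact_uniformly_continuous[OF this K]
    obtain e where "e > 0" "\<forall>x\<in>K. \<forall>y\<in>K. dist y x < e \<longrightarrow> dist (q y v) (q x v) < 1 / 2"
      unfolding uniformly_continuous_on_def by (metis half_gt_zero_iff zero_less_one)
    then show "\<exists>e>0. \<forall>d. 0 < d \<longrightarrow> d \<le> e \<longrightarrow> (\<forall>x\<in>K. \<forall>y\<in>K. dist x y < d \<longrightarrow> cmod (q x v - q y v) < 1 / 2)"
      by (intro exI[of _ e]) (auto simp: dist_norm[symmetric] dist_commute)
  qed
  then obtain e where "e > 0" "\<forall>v\<in>V. \<forall>x\<in>K. \<forall>y\<in>K. dist x y < e \<longrightarrow> cmod (q x v - q y v) < 1 / 2" by blast
  then show ?thesis unfolding close_def by (intro exI[of _ e]) auto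
qed

lemma lift_join:
  assumes p: "lift p m" "path p" "path_image p \<subseteq> salvetti V E"
    and q: "lift q m'" "path q" "path_image q \<subseteq> salvetti V E"
    and pq: "p 1 = q 0" "m 1 = m' 0"
  shows "lift (p +++ q) (\<lambda>s. if s \<le> 1 / 2 then m (2 * s) else m' (2 * s - 1))"
proof -
  obtain e1 where e1: "e1 > 0" "lift_at e1 0 1 p m" using p(1) by (auto simp: lift_def)
  obtain e2 where e2: "e2 > 0" "lift_at e2 0 1 q m'" using q(1) by (auto simp: lift_def)
  have j: "path (p +++ q)" "path_image (p +++ q) \<subseteq> salvetti V E"
    using p q pq(1) by (auto simp: pathstart_def pathfinish_def path_image_join)
  obtain e3 where e3: "e3 > 0" "\<forall>x\<in>{0..1}. \<forall>y\<in>{0..1}. dist x y < e3 \<longrightarrow> close ((p +++ q) x) ((p +++ q) y)"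
    using close_of_continuous[OF compact_Icc, of 0 1 "p +++ q"] j(1) by (auto simp: path_def)
  define e where "e = min (min (e1 / 2) (e2 / 2)) e3"
  have e: "e > 0" "2 * e \<le> e1" "2 * e \<le> e2" "e \<le> e3" using e1 e2 e3 by (auto simp: e_def)
  have "lift_at e 0 1 (p +++ q) (\<lambda>s. if s \<le> 1 / 2 then m (2 * s) else m' (2 * s - 1))"
  proof (rule lift_at_glue)
    show "(p +++ q) s \<in> salvetti V E" if "s \<in> {0..1}" for s using that j(2) by (auto simp: path_image_def)
    show "close ((p +++ q) s) ((p +++ q) s')" if "s \<in> {0..1}" "s' \<in> {0..1}" "\<bar>s - s'\<bar> < e" for s s'
      using that e3 e(4) by (simp add: dist_real_def)
    show "lift_at e 0 (1 / 2) (p +++ q) (\<lambda>s. m (2 * s))" unfolding lift_at_def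
    proof (intro ballI impI)
      fix s s' :: real assume s: "s \<in> {0..1 / 2}" "s' \<in> {0..1 / 2}" "\<bar>s - s'\<bar> < e"
      show "close ((p +++ q) s) ((p +++ q) s') \<and> m (2 * s') = transit ((p +++ q) s) ((p +++ q) s') (m (2 * s))"
        using lift_atD[OF e1(2), of "2 * s" "2 * s'"] s e by (auto simp: joinpaths_def)
    qed
    have q': "(p +++ q) s = q (2 * s - 1)" if "s \<in> {1 / 2..1}" for s
    proof (cases "s = 1 / 2")
      case True
      show ?thesis unfolding True using pq(1) by (simp add: joinpaths_def)
    qed (use that in \<open>simp add: joinpaths_def\<close>)
    show "lift_at e (1 / 2) 1 (p +++ q) (\<lambda>s. m' (2 * s - 1))" unfolding lift_at_def
    proof (intro ballI impI)
      fix s s' :: real assume s: "s \<in> {1 / 2..1}" "s' \<in> {1 / 2..1}" "\<bar>s - s'\<bar> < e"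
      show "close ((p +++ q) s) ((p +++ q) s') \<and> m' (2 * s' - 1) = transit ((p +++ q) s) ((p +++ q) s') (m' (2 * s - 1))"
        using lift_atD[OF e2(2), of "2 * s - 1" "2 * s' - 1"] s e q'[OF s(1)] q'[OF s(2)] by auto
    qed
    show "m (2 * (1 / 2)) = m' (2 * (1 / 2) - 1)" using pq(2) by simp
  qed auto
  then show ?thesis using e(1) by (auto simp: lift_def)
qed

text \<open>
  For each \<open>t\<close> lift the path \<open>h (t, \<cdot>)\<close>, all at the same scale. If \<open>t'\<close> is near \<open>t\<close>, then the lift for
  \<open>t\<close> followed by the transitions from \<open>h (t, s)\<close> to \<open>h (t', s)\<close> is a lift for \<open>t'\<close> by the cocycle
  condition. So the end point of the lift is locally constant in \<open>t\<close>.
\<close>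

lemma homotopy_lift:
  fixes h :: "real \<times> real \<Rightarrow> nat \<Rightarrow> complex"
  assumes h: "continuous_on ({0..1} \<times> {0..1}) h" "h ` ({0..1} \<times> {0..1}) \<subseteq> salvetti V E"
    and ends: "\<And>t. t \<in> {0..1} \<Longrightarrow> h (t, 0) = h (0, 0)" "\<And>t. t \<in> {0..1} \<Longrightarrow> h (t, 1) = h (0, 1)"
    and m: "lift (\<lambda>s. h (0, s)) m" and m': "lift (\<lambda>s. h (1, s)) m'" and start: "m 0 = m' 0"
  shows "m 1 = m' 1"
proof -
  let ?K = "{0..1} \<times> {0..1} :: (real \<times> real) set"
  have S: "h (t, s) \<in> salvetti V E" if "t \<in> {0..1}" "s \<in> {0..1}" for t s using h(2) that by auto
  have "compact ?K" by (intro compact_Times compact_Icc)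
  from close_of_continuous[OF this h(1)]
  obtain e0 where e0: "e0 > 0" "\<forall>x\<in>?K. \<forall>y\<in>?K. dist x y < e0 \<longrightarrow> close (h x) (h y)" by blast
  define e where "e = e0 / 2"
  have e: "e > 0" using e0 by (simp add: e_def)
  have cl: "close (h (t, s)) (h (t', s'))"
    if "t \<in> {0..1}" "t' \<in> {0..1}" "s \<in> {0..1}" "s' \<in> {0..1}" "\<bar>t - t'\<bar> < e" "\<bar>s - s'\<bar> < e" for t t' s s'
  proof -
    have "dist (t, s) (t', s') \<le> dist t t' + dist s s'"
      unfolding dist_prod_def by (simp add: sqrt_sum_squares_le_sum)
    also have "\<dots> < e0" using that by (simp add: dist_real_def e_def)
    finally show ?thesis using e0(2) that by auto
  qed
  have "\<exists>M. lift_at e 0 1 (\<lambda>s. h (t, s)) M \<and> M 0 = m 0" if "t \<in> {0..1}" for t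
    using that e by (intro ex_lift_at S cl) auto
  then have "\<forall>t\<in>{0..1}. \<exists>M. lift_at e 0 1 (\<lambda>s. h (t, s)) M \<and> M 0 = m 0" by blast
  then obtain M where M: "\<forall>t\<in>{0..1}. lift_at e 0 1 (\<lambda>s. h (t, s)) (M t) \<and> M t 0 = m 0"
    by (rule bchoice[THEN exE])
  have step: "M t 1 = M t' 1" if t: "t \<in> {0..1}" "t' \<in> {0..1}" "\<bar>t - t'\<bar> < e" for t t'
  proof -
    define N where "N s = transit (h (t, s)) (h (t', s)) (M t s)" for s
    have Mt: "lift_at e 0 1 (\<lambda>s. h (t, s)) (M t)" using M t by blast
    have "lift_at e 0 1 (\<lambda>s. h (t', s)) N" unfolding lift_at_def
    proof (intro ballI impI conjI)
      fix s s' :: real assume s: "s \<in> {0..1}" "s' \<in> {0..1}" "\<bar>s - s'\<bar> < e"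
      show "close (h (t', s)) (h (t', s'))" using s t e by (intro cl) auto
      have "N s' = transit (h (t, s')) (h (t', s')) (transit (h (t, s)) (h (t, s')) (M t s))"
        unfolding N_def using lift_atD(2)[OF Mt s] by simp
      also have "\<dots> = transit (h (t, s)) (h (t', s')) (M t s)"
        using s t e by (intro transit_trans S cl) auto
      also have "\<dots> = transit (h (t', s)) (h (t', s')) (N s)"
        unfolding N_def using s t e by (intro transit_trans[symmetric] S cl) auto
      finally show "N s' = transit (h (t', s)) (h (t', s')) (N s)" .
    qed
    moreover have "lift_at e 0 1 (\<lambda>s. h (t', s)) (M t')" using M t by blast
    moreover have "N 0 = M t' 0" using M t ends(1)[OF t(1)] ends(1)[OF t(2)] by (simp add: N_def)
    ultimately have "N 1 = M t' 1" using lift_unique[of "\<lambda>s. h (t', s)" N "M t'"] e by (auto simp: lift_def)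
    then show ?thesis using ends(2)[OF t(1)] ends(2)[OF t(2)] by (simp add: N_def)
  qed
  have "0 \<le> (0::real) \<longrightarrow> 1 \<le> (1::real) \<longrightarrow> M 0 1 = M 1 1"
  proof (rule Bolzano[where P = "\<lambda>a b. 0 \<le> a \<longrightarrow> b \<le> 1 \<longrightarrow> M a 1 = M b 1"])
    fix x :: real
    show "\<exists>d>0. \<forall>a b. a \<le> x \<and> x \<le> b \<and> b - a < d \<longrightarrow> 0 \<le> a \<longrightarrow> b \<le> 1 \<longrightarrow> M a 1 = M b 1"
      using e step by (intro exI[of _ e]) auto
  qed auto
  moreover have L: "lift (\<lambda>s. h (t, s)) (M t)" "M t 0 = m 0" if "t \<in> {0..1}" for t
    unfolding lift_def using bspec[OF M that] e by blast+
  have "M 0 1 = m 1" by (rule lift_unique[OF L(1) m]) (use L(2) in auto)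
  moreover have "M 1 1 = m' 1" by (rule lift_unique[OF L(1) m']) (use L(2) start in auto)
  ultimately show ?thesis by simp
qed

subsection \<open>The lift of an edge\<close>

lemma cos_sin_unit:
  assumes "0 \<le> s" "s \<le> (1::real)"
  shows "cos (2 * pi * s) < 0 \<longleftrightarrow> 1 / 4 < s \<and> s < 3 / 4"
    and "s \<le> 1 / 2 \<Longrightarrow> sin (2 * pi * s) \<ge> 0"
    and "1 / 2 < s \<Longrightarrow> s < 1 \<Longrightarrow> sin (2 * pi * s) < 0"
proof -
  have sh: "cos (2 * pi * s) = - cos (2 * pi * s - pi)" by (simp add: cos_diff)
  show "cos (2 * pi * s) < 0 \<longleftrightarrow> 1 / 4 < s \<and> s < 3 / 4"
  proof
    assume "1 / 4 < s \<and> s < 3 / 4"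
    then have "pi * (1 / 4) < pi * s" "pi * s < pi * (3 / 4)" by (simp_all only: mult_less_cancel_left_pos pi_gt_zero)
    then have "cos (2 * pi * s - pi) > 0" by (intro cos_gt_zero_pi; linarith)
    then show "cos (2 * pi * s) < 0" using sh by linarith
  next
    assume neg: "cos (2 * pi * s) < 0"
    show "1 / 4 < s \<and> s < 3 / 4"
    proof (rule ccontr)
      assume "\<not> (1 / 4 < s \<and> s < 3 / 4)"
      then consider "s \<le> 1 / 4" | "s \<ge> 3 / 4" by linarith
      then have "cos (2 * pi * s) \<ge> 0"
      proof cases
        case 1
        then have "pi * s \<le> pi * (1 / 4)" "0 \<le> pi * s" using assms by (auto simp: mult_left_mono)
        then show ?thesis by (intro cos_ge_zero; linarith)
      next
        case 2
        then have "pi * (3 / 4) \<le> pi * s" "pi * s \<le> pi * 1" using assms by (auto simp: mult_left_mono)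
        then have "cos (2 * pi - 2 * pi * s) \<ge> 0" by (intro cos_ge_zero; linarith)
        then show ?thesis by (simp add: cos_diff)
      qed
      then show False using neg by simp
    qed
  qed
  show "sin (2 * pi * s) \<ge> 0" if "s \<le> 1 / 2"
  proof -
    have "pi * s \<le> pi * (1 / 2)" "0 \<le> pi * s" using that assms by (auto simp: mult_left_mono)
    then show ?thesis by (intro sin_ge_zero; linarith)
  qed
  show "sin (2 * pi * s) < 0" if "1 / 2 < s" "s < 1"
  proof -
    have "pi * (1 / 2) < pi * s" "pi * s < pi * 1" using that by (simp_all only: mult_less_cancel_left_pos pi_gt_zero)
    then have "sin (2 * pi * s - pi) > 0" by (intro sin_gt_zero; linarith)
    then show ?thesis by (simp add: sin_diff)
  qed
qed

text \<open>
  The lift of the loop of a generator jumps at the time \<open>1 / 2\<close>, when the loop passes through \<open>-1\<close>.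
\<close>

lemma ray_transit:
  assumes v: "v \<in> V" and s: "s \<in> {0..1}" "s' \<in> {0..1}" "\<bar>s - s'\<bar> < 1 / 4"
  shows "(if s' \<le> 1 / 2 then p else act (v, True) p) =
    transit (ray (v, True) s) (ray (v, True) s') (if s \<le> 1 / 2 then p else act (v, True) p)"
proof -
  let ?y = "ray (v, True) s" and ?z = "ray (v, True) s'"
  have y: "?y v = cis (2 * pi * s)" "?z v = cis (2 * pi * s')" using s by (auto simp: ray_def)
  have "transit ?y ?z q = cross v (?y v) (?z v) q" for q
    using v s by (intro transit_single) (auto simp: ray_def cross_def)
  then have t: "transit ?y ?z q = cross v (cis (2 * pi * s)) (cis (2 * pi * s')) q" for q using y by simp
  note cs = cos_sin_unit[of s] and cs' = cos_sin_unit[of s']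
  consider "1 / 4 < s \<and> s < 3 / 4 \<and> 1 / 4 < s' \<and> s' < 3 / 4"
    | "\<not> (1 / 4 < s \<and> s < 3 / 4 \<and> 1 / 4 < s' \<and> s' < 3 / 4)" by blast
  then show ?thesis
  proof cases
    case 1
    then have c: "cos (2 * pi * s) < 0" "cos (2 * pi * s') < 0" using cs(1) cs'(1) s by auto
    have sn: "sin (2 * pi * r) \<ge> 0 \<longleftrightarrow> r \<le> 1 / 2" if "1 / 4 < r" "r < 3 / 4" for r
      using cos_sin_unit(2)[of r] cos_sin_unit(3)[of r] that by fastforce
    have sn1: "sin (2 * pi * s) \<ge> 0 \<longleftrightarrow> s \<le> 1 / 2" and sn2: "sin (2 * pi * s') \<ge> 0 \<longleftrightarrow> s' \<le> 1 / 2"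
      using sn 1 by auto
    show ?thesis unfolding t cross_def using c
      by (auto simp: sn1 sn2 not_le[symmetric])
  next
    case 2
    then have "\<not> (cos (2 * pi * s) < 0 \<and> cos (2 * pi * s') < 0)" using cs(1) cs'(1) s by auto
    then have "cross v (cis (2 * pi * s)) (cis (2 * pi * s')) q = q" for q by (auto simp: cross_def)
    moreover have "s \<le> 1 / 2 \<longleftrightarrow> s' \<le> 1 / 2"
    proof -
      have "s - s' < 1 / 4" "s' - s < 1 / 4" using s(3) by linarith+
      moreover have "s \<le> 1 / 4 \<or> s \<ge> 3 / 4 \<or> s' \<le> 1 / 4 \<or> s' \<ge> 3 / 4" using 2 by auto
      ultimately show ?thesis by auto
    qed
    ultimately show ?thesis unfolding t by auto
  qed
qed

lemma lift_ray_True: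
  assumes v: "v \<in> V"
  shows "lift (ray (v, True)) (\<lambda>s. if s \<le> 1 / 2 then p else act (v, True) p)"
proof -
  have "continuous_on {0..1} (\<lambda>s k. if k = v then cis (2 * pi * s) else 1)"
  proof (rule continuous_on_coordinatewise_then_product)
    fix k show "continuous_on {0..1} (\<lambda>s. if k = v then cis (2 * pi * s) else 1)"
      by (cases "k = v") (auto intro!: continuous_intros)
  qed
  then have "continuous_on {0..1} (ray (v, True))"
    by (rule continuous_on_eq) (auto simp: ray_def)
  from close_of_continuous[OF compact_Icc this]
  obtain e where e: "e > 0" "\<forall>x\<in>{0..1}. \<forall>y\<in>{0..1}. dist x y < e \<longrightarrow> close (ray (v, True) x) (ray (v, True) y)" by blast
  have "lift_at (min e (1 / 4)) 0 1 (ray (v, True)) (\<lambda>s. if s \<le> 1 / 2 then p else act (v, True) p)"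
    unfolding lift_at_def
  proof (intro ballI impI conjI)
    fix s s' :: real assume s: "s \<in> {0..1}" "s' \<in> {0..1}" "\<bar>s - s'\<bar> < min e (1 / 4)"
    then show "close (ray (v, True) s) (ray (v, True) s')" using e(2) by (simp add: dist_real_def)
    show "(if s' \<le> 1 / 2 then p else act (v, True) p) =
      transit (ray (v, True) s) (ray (v, True) s') (if s \<le> 1 / 2 then p else act (v, True) p)"
      using s by (intro ray_transit[OF v]) auto
  qed
  then show ?thesis using e(1) unfolding lift_def by (intro exI[of _ "min e (1 / 4)"]) auto
qed

lemma lift_ray:
  assumes a: "fst a \<in> V"
  shows "\<exists>m. lift (ray a) m \<and> m 0 = p \<and> m 1 = act a p"
proof (cases "snd a")
  case True
  then have "a = (fst a, True)" by (simp add: prod_eq_iff)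
  then show ?thesis using lift_ray_True[OF a, of p]
    by (intro exI[of _ "\<lambda>s. if s \<le> 1 / 2 then p else act (fst a, True) p"]) simp
next
  case False
  then have a': "a = (fst a, False)" by (simp add: prod_eq_iff)
  define m where "m s = (if s \<le> 1 / 2 then act a p else act (fst a, True) (act a p))" for s :: real
  have "lift (ray (fst a, True)) m" unfolding m_def by (rule lift_ray_True[OF a])
  from lift_reverse[OF this] have "lift (ray a) (\<lambda>s. m (1 - s))"
  proof (rule lift_cong[rotated])
    fix s :: real assume "s \<in> {0..1}"
    then show "ray (fst a, True) (1 - s) = ray a s"
      using ray_inv[of s "(fst a, True)"] a' by (simp add: inv_letter_def)
  qed simp
  moreover have "act (fst a, True) (act a p) = p" using a' by (metis act_True_False(1))
  ultimately show ?thesis by (intro exI[of _ "\<lambda>s. m (1 - s)"]) (auto simp: m_def)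
qed

end

context special_space
begin

lemma f_path:
  assumes "path p" "path_image p \<subseteq> X"
  shows "path (f \<circ> p)" "path_image (f \<circ> p) \<subseteq> salvetti V E"
  using assms f_map by (auto intro!: path_continuous_image intro: continuous_on_subset simp: path_image_compose)

text \<open>
  Each edge maps to the loop of its label, whose lift ends after the action of this label.
\<close>

lemma reads_lift:
  "reads x w y p \<Longrightarrow> \<exists>m. lift (f \<circ> p) m \<and> m 0 = k \<and> m 1 = acts w k"
proof (induction w arbitrary: x p k)
  case Nil
  then have "f \<circ> p = (\<lambda>_. f x)" by (simp add: fun_eq_iff)
  then show ?case using lift_const by (intro exI[of _ "\<lambda>_. k"]) simp
next
  case (Cons a w)
  then obtain \<alpha> q where *: "edge x a \<alpha>" "reads (pathfinish \<alpha>) w y q" "p = \<alpha> +++ q" by auto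
  note E = edge_path[OF *(1)] reads_path[OF *(2)]
  obtain m1 where m1: "lift (ray a) m1" "m1 0 = k" "m1 1 = act a k" using lift_ray[OF E(5)] by blast
  have m1': "lift (f \<circ> \<alpha>) m1" by (rule lift_cong[OF _ m1(1)]) (use E(7) in auto)
  obtain m2 where m2: "lift (f \<circ> q) m2" "m2 0 = act a k" "m2 1 = acts w (act a k)" using Cons.IH[OF *(2)] by blast
  have "lift ((f \<circ> \<alpha>) +++ (f \<circ> q)) (\<lambda>s. if s \<le> 1 / 2 then m1 (2 * s) else m2 (2 * s - 1))"
  proof (rule lift_join[OF m1' _ _ m2(1)])
    show "path (f \<circ> \<alpha>)" "path_image (f \<circ> \<alpha>) \<subseteq> salvetti V E" using f_path E by auto
    show "path (f \<circ> q)" "path_image (f \<circ> q) \<subseteq> salvetti V E" using f_path E by auto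
    show "(f \<circ> \<alpha>) 1 = (f \<circ> q) 0" using E by (simp add: pathstart_def pathfinish_def)
    show "m1 1 = m2 0" using m1 m2 by simp
  qed
  then show ?case using m1 m2 *(3)
    by (intro exI[of _ "\<lambda>s. if s \<le> 1 / 2 then m1 (2 * s) else m2 (2 * s - 1)"]) (simp add: path_compose_join)
qed

text \<open>
  The homotopy is carried to the Salvetti complex by \<open>f\<close>, where the lifts of the two paths have the
  same end point; and the end points of the lifts are given by the action of the words.
\<close>

theorem homotopic_reads_act_equally:
  assumes p: "reads x w y p" and q: "reads x w' y q" and h: "homotopic_paths X p q"
  shows "acts w k = acts w' k"
proof -
  obtain m where m: "lift (f \<circ> p) m" "m 0 = k" "m 1 = acts w k" using reads_lift[OF p] by blast
  obtain m' where m': "lift (f \<circ> q) m'" "m' 0 = k" "m' 1 = acts w' k" using reads_lift[OF q] by blast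
  obtain H :: "real \<times> real \<Rightarrow> 'a" where H: "continuous_on ({0..1} \<times> {0..1}) H" "H \<in> ({0..1} \<times> {0..1}) \<rightarrow> X"
    "\<forall>s\<in>{0..1}. H (0, s) = p s" "\<forall>s\<in>{0..1}. H (1, s) = q s"
    "\<forall>t\<in>{0..1}. pathstart (H \<circ> Pair t) = pathstart p \<and> pathfinish (H \<circ> Pair t) = pathfinish p"
    using h unfolding homotopic_paths by (elim exE conjE) (rule that)
  have ends: "H (t, 0) = p 0" "H (t, 1) = p 1" if "t \<in> {0..1}" for t
    using H(5) that by (auto simp: pathstart_def pathfinish_def)
  have "m 1 = m' 1"
  proof (rule homotopy_lift[of "f \<circ> H"])
    show "continuous_on ({0..1} \<times> {0..1}) (f \<circ> H)"
      using H(1,2) f_map(1) by (intro continuous_on_compose) (auto intro: continuous_on_subset)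
    show "(f \<circ> H) ` ({0..1} \<times> {0..1}) \<subseteq> salvetti V E" using H(2) f_map(2) by auto
    show "(f \<circ> H) (t, 0) = (f \<circ> H) (0, 0)" "(f \<circ> H) (t, 1) = (f \<circ> H) (0, 1)" if "t \<in> {0..1}" for t
      using ends[OF that] ends[of 0] by auto
    show "lift (\<lambda>s. (f \<circ> H) (0, s)) m" by (rule lift_cong[OF _ m(1)]) (use H(3) in auto)
    show "lift (\<lambda>s. (f \<circ> H) (1, s)) m'" by (rule lift_cong[OF _ m'(1)]) (use H(4) in auto)
    show "m 0 = m' 0" using m m' by simp
  qed
  then show ?thesis using m m' by simp
qed

end

section \<open>Normal forms of group elements\<close>

lemma path_class_eq_iff:
  assumes "path q" "path_image q \<subseteq> X"
  shows "path_class X p = path_class X q \<longleftrightarrow> homotopic_paths X p q"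
proof
  assume "path_class X p = path_class X q"
  moreover have "q \<in> path_class X q" using assms by (simp add: path_class_def)
  ultimately show "homotopic_paths X p q" by (auto simp: path_class_def)
next
  assume h: "homotopic_paths X p q"
  show "path_class X p = path_class X q"
    unfolding path_class_def using h homotopic_paths_sym[OF h] homotopic_paths_trans by blast
qed

lemma fundamental_group_mult:
  assumes "path p" "path_image p \<subseteq> X" "path q" "path_image q \<subseteq> X" "pathfinish p = pathstart q"
  shows "mult (fundamental_group X x) (path_class X p) (path_class X q) = path_class X (p +++ q)"
proof -
  have same: "path_class X (p' +++ q') = path_class X (p +++ q)" if "p' \<in> path_class X p" "q' \<in> path_class X q" for p' q'
  proof -
    have "homotopic_paths X (p +++ q) (p' +++ q')"
      using that assms(5) by (intro homotopic_paths_join) (auto simp: path_class_def)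
    then have "homotopic_paths X (p' +++ q') (p +++ q)" by (rule homotopic_paths_sym)
    then show ?thesis using assms by (subst path_class_eq_iff) (auto simp: path_image_join)
  qed
  have ne: "p \<in> path_class X p" "q \<in> path_class X q" using assms by (auto simp: path_class_def)
  have "(\<Union>p'\<in>path_class X p. \<Union>q'\<in>path_class X q. path_class X (p' +++ q')) =
      (\<Union>p'\<in>path_class X p. \<Union>q'\<in>path_class X q. path_class X (p +++ q))"
    by (intro SUP_cong refl same)
  also have "\<dots> = path_class X (p +++ q)" using ne by auto
  finally show ?thesis by (simp add: fundamental_group_def)
qed

locale special_group = special_space X \<Phi> V E f + group G
  for X :: "'a::topological_space set" and \<Phi> V E f and G :: "('g, 'm) monoid_scheme" (structure) +
  fixes z :: 'a and h :: "'g \<Rightarrow> (real \<Rightarrow> 'a) set"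
  assumes base: "z \<in> X" and iso: "h \<in> iso G (fundamental_group X z)"
begin

definition origin :: 'a where
  "origin = pathstart (anchor z)"

definition based :: "(real \<Rightarrow> 'a) \<Rightarrow> real \<Rightarrow> 'a" where
  "based e = (reversepath (anchor z) +++ e) +++ anchor z"

text \<open>
  The element \<open>g\<close> is the class of the loop that is labelled by \<open>w\<close>, after this has been conjugated by
  the standard path from the vertex \<open>origin\<close> to the base point \<open>z\<close>.
\<close>

definition codes :: "'g \<Rightarrow> letter list \<Rightarrow> bool" where
  "codes g w \<longleftrightarrow> g \<in> carrier G \<and> (\<exists>e. reads origin w origin e \<and> h g = path_class X (based e))"

lemmas anchor_base = anchor_path[OF base, folded origin_def]

lemma based_path:
  assumes "path e" "path_image e \<subseteq> X" "pathstart e = origin" "pathfinish e = origin"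
  shows "path (based e)" "path_image (based e) \<subseteq> X" "pathstart (based e) = z" "pathfinish (based e) = z"
  using assms anchor_base by (auto simp: based_def path_image_join origin_def)

lemma based_homotopic:
  assumes "homotopic_paths X e e'" "pathstart e = origin" "pathfinish e = origin"
  shows "homotopic_paths X (based e) (based e')"
  unfolding based_def using assms anchor_base
  by (intro homotopic_paths_join) (auto simp: origin_def)

lemma based_cancel:
  assumes e: "path e" "path_image e \<subseteq> X" "pathstart e = origin" "pathfinish e = origin"
  shows "homotopic_paths X ((anchor z +++ based e) +++ reversepath (anchor z)) e"
proof -
  let ?a = "anchor z"
  have A: "path ?a" "path_image ?a \<subseteq> X" "pathfinish ?a = z" "pathstart ?a = origin"
    using anchor_base by (auto simp: origin_def)
  have "homotopic_paths X (based e) (reversepath ?a +++ (e +++ ?a))"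
    unfolding based_def using A e by (intro homotopic_paths_assoc') auto
  then have "homotopic_paths X (?a +++ based e) (?a +++ (reversepath ?a +++ (e +++ ?a)))"
    using A based_path[OF e] by (intro homotopic_paths_join) auto
  also have "homotopic_paths X \<dots> (e +++ ?a)"
    using A e by (intro homotopic_paths_cancel) (auto simp: path_image_join)
  finally have "homotopic_paths X (?a +++ based e) (e +++ ?a)" .
  then have "homotopic_paths X ((?a +++ based e) +++ reversepath ?a) ((e +++ ?a) +++ reversepath ?a)"
    by (rule homotopic_paths_join) (use A e based_path[OF e] in auto)
  also have "homotopic_paths X \<dots> (e +++ (?a +++ reversepath ?a))"
    using A e by (intro homotopic_paths_assoc') auto
  also have "homotopic_paths X \<dots> (e +++ (\<lambda>_. origin))"
    using A e by (intro homotopic_paths_join homotopic_paths_right_inverse) auto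
  also have "homotopic_paths X \<dots> e"
    using e by (intro homotopic_paths_const_right) auto
  finally show ?thesis .
qed

lemma based_injective:
  assumes e: "path e" "path_image e \<subseteq> X" "pathstart e = origin" "pathfinish e = origin"
    and e': "path e'" "path_image e' \<subseteq> X" "pathstart e' = origin" "pathfinish e' = origin"
    and hom: "homotopic_paths X (based e) (based e')"
  shows "homotopic_paths X e e'"
proof -
  have "homotopic_paths X ((anchor z +++ based e) +++ reversepath (anchor z))
      ((anchor z +++ based e') +++ reversepath (anchor z))"
    by (rule homotopic_paths_join, rule homotopic_paths_join)
       (use hom anchor_base based_path[OF e] in auto)
  then show ?thesis
    using based_cancel[OF e] based_cancel[OF e'] homotopic_paths_sym homotopic_paths_trans by blast
qed

lemma based_join:
  assumes e: "path e" "path_image e \<subseteq> X" "pathstart e = origin" "pathfinish e = origin"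
    and e': "path e'" "path_image e' \<subseteq> X" "pathstart e' = origin" "pathfinish e' = origin"
  shows "homotopic_paths X (based e +++ based e') (based (e +++ e'))"
proof -
  let ?a = "anchor z" and ?r = "reversepath (anchor z)"
  have A: "path ?a" "path_image ?a \<subseteq> X" "pathfinish ?a = z" "pathstart ?a = origin"
    using anchor_base by (auto simp: origin_def)
  note B = A e e' based_path[OF e] based_path[OF e']
  have "homotopic_paths X (based e +++ based e') ((?r +++ e) +++ (?a +++ based e'))"
    unfolding based_def[of e] using B by (intro homotopic_paths_assoc') (auto simp: path_image_join)
  also have "homotopic_paths X (?a +++ based e') (e' +++ ?a)"
  proof -
    have "homotopic_paths X (based e') (?r +++ (e' +++ ?a))"
      unfolding based_def using B by (intro homotopic_paths_assoc') auto
    then have "homotopic_paths X (?a +++ based e') (?a +++ (?r +++ (e' +++ ?a)))"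
      using B by (intro homotopic_paths_join) auto
    also have "homotopic_paths X \<dots> (e' +++ ?a)"
      using B by (intro homotopic_paths_cancel) (auto simp: path_image_join)
    finally show ?thesis .
  qed
  then have "homotopic_paths X ((?r +++ e) +++ (?a +++ based e')) ((?r +++ e) +++ (e' +++ ?a))"
    by (rule homotopic_paths_join[rotated]) (use B in \<open>auto simp: path_image_join\<close>)
  also have "homotopic_paths X \<dots> (((?r +++ e) +++ e') +++ ?a)"
    using B by (intro homotopic_paths_assoc) (auto simp: path_image_join)
  also have "homotopic_paths X \<dots> (based (e +++ e'))" unfolding based_def
    by (rule homotopic_paths_join, rule homotopic_paths_assoc') (use B in \<open>auto simp: path_image_join\<close>)
  finally show ?thesis .
qed

lemma reads_loop:
  assumes "reads origin w origin e"
  shows "path e" "path_image e \<subseteq> X" "pathstart e = origin" "pathfinish e = origin"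
  using reads_path[OF assms] by auto

lemma h_facts:
  shows "inj_on h (carrier G)" "h ` carrier G = carrier (fundamental_group X z)"
    "\<And>x y. x \<in> carrier G \<Longrightarrow> y \<in> carrier G \<Longrightarrow> h (x \<otimes> y) = mult (fundamental_group X z) (h x) (h y)"
  using iso by (auto simp: iso_def hom_def bij_betw_def)

lemma ex_element:
  assumes "reads origin w origin e"
  shows "\<exists>g. codes g w"
proof -
  have "path_class X (based e) \<in> carrier (fundamental_group X z)"
    using based_path[OF reads_loop[OF assms]] by (auto simp: fundamental_group_def)
  then obtain g where "g \<in> carrier G" "h g = path_class X (based e)" using h_facts(2) by (metis imageE)
  then show ?thesis using assms by (auto simp: codes_def)
qed

lemma codes_rewritable:
  assumes "codes g w" "rewritable w w'"
  shows "codes g w'"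
proof -
  obtain e where e: "reads origin w origin e" "h g = path_class X (based e)" and g: "g \<in> carrier G"
    using assms(1) by (auto simp: codes_def)
  obtain e' where e': "reads origin w' origin e'" "homotopic_paths X e e'"
    using assms(2) e(1) unfolding rewritable_def by blast
  have "homotopic_paths X (based e) (based e')"
    using based_homotopic[OF e'(2)] reads_loop[OF e(1)] by simp
  then have "path_class X (based e) = path_class X (based e')"
    using path_class_eq_iff based_path[OF reads_loop[OF e'(1)]] by blast
  then show ?thesis using e e' g by (auto simp: codes_def)
qed

lemma rewritable_normal: "\<exists>w'. normal w' \<and> length w' \<le> length w \<and> rewritable w w'"
  using ex_normal_form[of rewritable w] rewritable_refl rewritable_trans rewritable_swap rewritable_cancel by metis

lemma ex_normal_code:
  assumes g: "g \<in> carrier G"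
  shows "\<exists>w. normal w \<and> codes g w"
proof -
  have "h g \<in> carrier (fundamental_group X z)" using h_facts(2) g by blast
  then obtain p where p: "h g = path_class X p" "path p" "path_image p \<subseteq> X" "pathstart p = z" "pathfinish p = z"
    by (auto simp: fundamental_group_def)
  obtain u e where e: "reads origin u origin e" "homotopic_paths X p (based e)"
    using path_edge_approximable[OF p(2,3)] p(4,5) unfolding edge_approximable_def origin_def based_def by auto
  have "path_class X p = path_class X (based e)"
    using path_class_eq_iff based_path[OF reads_loop[OF e(1)]] e(2) by blast
  then have "codes g u" using g e(1) p(1) by (auto simp: codes_def)
  then show ?thesis using rewritable_normal[of u] codes_rewritable by blast
qed

lemma codes_element_unique:
  assumes "codes g w" "codes g' w"
  shows "g = g'"
proof -
  have "h g = h g'" using assms reads_unique unfolding codes_def by metis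
  then show ?thesis using assms h_facts(1) by (auto simp: codes_def dest: inj_onD)
qed

text \<open>
  Different normal words cannot describe the same element, because the words of homotopic loops act in
  the same way on all stacks.
\<close>

lemma codes_acts:
  assumes "codes g w" "codes g w'"
  shows "acts w k = acts w' k"
proof -
  obtain e where e: "reads origin w origin e" "h g = path_class X (based e)" using assms by (auto simp: codes_def)
  obtain e' where e': "reads origin w' origin e'" "h g = path_class X (based e')" using assms by (auto simp: codes_def)
  note E = reads_loop[OF e(1)] and E' = reads_loop[OF e'(1)]
  have "homotopic_paths X (based e) (based e')"
    using e(2) e'(2) path_class_eq_iff based_path[OF E'] by metis
  then have "homotopic_paths X e e'" by (rule based_injective[OF E E'])
  then show ?thesis by (rule homotopic_reads_act_equally[OF e(1) e'(1)])
qed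

lemma codes_normal_unique: "codes g w \<Longrightarrow> codes g w' \<Longrightarrow> normal w \<Longrightarrow> normal w' \<Longrightarrow> w = w'"
  using codes_acts normal_unique by blast

lemma codes_mult:
  assumes "codes g w" "codes g' w'"
  shows "codes (g \<otimes> g') (w @ w')"
proof -
  obtain e where e: "reads origin w origin e" "h g = path_class X (based e)" and g: "g \<in> carrier G"
    using assms by (auto simp: codes_def)
  obtain e' where e': "reads origin w' origin e'" "h g' = path_class X (based e')" and g': "g' \<in> carrier G"
    using assms by (auto simp: codes_def)
  note E = reads_loop[OF e(1)] and E' = reads_loop[OF e'(1)]
  obtain r where r: "reads origin (w @ w') origin r" "homotopic_paths X (e +++ e') r"
    using reads_append[OF e(1) e'(1)] by blast
  have "homotopic_paths X (based e +++ based e') (based (e +++ e'))" by (rule based_join[OF E E'])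
  also have "homotopic_paths X \<dots> (based r)" using E E' by (intro based_homotopic r(2)) auto
  finally have "path_class X (based e +++ based e') = path_class X (based r)"
    using path_class_eq_iff based_path[OF reads_loop[OF r(1)]] by blast
  moreover have "h (g \<otimes> g') = path_class X (based e +++ based e')"
    using h_facts(3)[OF g g'] e(2) e'(2) fundamental_group_mult based_path[OF E] based_path[OF E'] by metis
  ultimately show ?thesis using r(1) g g' by (auto simp: codes_def)
qed

definition code :: "'g \<Rightarrow> letter list" where
  "code g = (SOME w. normal w \<and> codes g w)"

lemma code: "g \<in> carrier G \<Longrightarrow> normal (code g) \<and> codes g (code g)"
  unfolding code_def by (rule someI_ex[OF ex_normal_code])

lemma code_inj: "inj_on code (carrier G)"
  using code codes_element_unique by (metis inj_onI)

lemma code_length: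
  assumes "x \<in> carrier G" "y \<in> carrier G"
  shows "length (code (x \<otimes> y)) \<le> length (code x) + length (code y)"
proof -
  have c: "codes (x \<otimes> y) (code x @ code y)" using assms code codes_mult by blast
  obtain w where w: "normal w" "length w \<le> length (code x @ code y)" "rewritable (code x @ code y) w"
    using rewritable_normal by blast
  have "code (x \<otimes> y) = w"
    using codes_normal_unique[of "x \<otimes> y" "code (x \<otimes> y)" w] code[of "x \<otimes> y"] assms codes_rewritable[OF c w(3)] w(1)
    by simp
  then show ?thesis using w(2) by simp
qed

subsection \<open>Finite generation\<close>

abbreviation letters :: "letter set" where
  "letters \<equiv> V \<times> UNIV"

lemma finite_letters: "finite letters"
  using finite_V by simp

lemma rewritable_inv_word: "rewritable (c @ inv_word u @ u @ d) (c @ d)"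
proof (induction u arbitrary: c d)
  case Nil
  then show ?case using rewritable_refl by simp
next
  case (Cons a u)
  have "rewritable ((c @ inv_word u) @ inv_letter a # inv_letter (inv_letter a) # (u @ d)) ((c @ inv_word u) @ (u @ d))"
    by (rule rewritable_cancel)
  then have "rewritable (c @ inv_word (a # u) @ (a # u) @ d) (c @ inv_word u @ u @ d)" by simp
  then show ?case using Cons rewritable_trans by blast
qed

lemma inv_word_inv_word [simp]: "inv_word (inv_word u) = u"
  by (simp add: inv_word_def rev_map comp_def)

lemma rewritable_inv_word': "rewritable (c @ u @ inv_word u @ d) (c @ d)"
  using rewritable_inv_word[of c "inv_word u" d] by simp

definition reachable :: "'a set" where
  "reachable = {y. \<exists>w p. reads origin w y p}"

definition route :: "'a \<Rightarrow> letter list" where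
  "route y = (SOME w. \<exists>p. reads origin w y p)"

lemma route: "y \<in> reachable \<Longrightarrow> \<exists>p. reads origin (route y) y p"
  unfolding route_def reachable_def by (rule someI_ex) blast

lemma finite_reachable: "finite reachable"
  by (rule finite_subset[OF _ finite_vertices[OF finite_cells]]) (use reads_path in \<open>auto simp: reachable_def\<close>)

text \<open>
  Choose for every reachable vertex a route from the origin. An edge becomes a loop when a route to
  its first vertex and the way back from its last vertex are added. There are finitely many such
  loops, and in the product of those that belong to the edges of a given loop the routes cancel.
\<close>

lemma ex_finite_generating_set: "\<exists>S. finite_generating_set G S"
proof -
  \<comment> \<open>\<open>D\<close> bounds the length of all routes; a loop made from one edge then has length at most \<open>2 * D + 1\<close>.\<close>
  define D where "D = (\<Sum>y\<in>reachable. length (route y))"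
  have D: "length (route y) \<le> D" if "y \<in> reachable" for y
    unfolding D_def by (rule member_le_sum) (use that finite_reachable in auto)
  define T where "T = {g. \<exists>w. codes g w \<and> length w \<le> 2 * D + 1}"
  have TG: "T \<subseteq> carrier G" by (auto simp: T_def codes_def)
  have "T \<subseteq> (\<lambda>w. THE g. codes g w) ` {w. set w \<subseteq> letters \<and> length w \<le> 2 * D + 1}"
  proof
    fix g assume "g \<in> T"
    then obtain w where w: "codes g w" "length w \<le> 2 * D + 1" by (auto simp: T_def)
    have "(THE g. codes g w) = g" using w(1) codes_element_unique by blast
    moreover have "set w \<subseteq> letters" using w(1) reads_path unfolding codes_def by (metis SigmaI UNIV_I prod.collapse subsetI)
    ultimately show "g \<in> (\<lambda>w. THE g. codes g w) ` {w. set w \<subseteq> letters \<and> length w \<le> 2 * D + 1}"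
      using w(2) by (intro image_eqI[of _ _ w]) auto
  qed
  moreover have "finite ((\<lambda>w. THE g. codes g w) ` {w. set w \<subseteq> letters \<and> length w \<le> 2 * D + 1})"
    by (intro finite_imageI finite_lists_length_le finite_letters)
  ultimately have "finite T" by (rule finite_subset)
  have short: "\<exists>g\<in>generate G T. codes g w" if "reads origin w origin e" "length w \<le> 2 * D + 1" for w e
    using ex_element[OF that(1)] that(2) generate.incl[of _ T G] unfolding T_def by blast
  have triv: "reads origin [] origin (\<lambda>_. origin)" using anchor_base(4) by (simp add: origin_def)
  have o_reach: "origin \<in> reachable" using triv unfolding reachable_def by blast
  have home: "\<exists>q. reads y (inv_word (route y)) origin q" if "y \<in> reachable" for y
    using route[OF that] reads_inverse by blast
  have "\<exists>g\<in>generate G T. codes g (w @ inv_word (route y))" if "reads origin w y p" for w y p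
    using that
  proof (induction w arbitrary: y p rule: rev_induct)
    case Nil
    then have "y = origin" by simp
    then show ?case using short home[OF o_reach] D[OF o_reach] by fastforce
  next
    case (snoc a w)
    then obtain y' p' q' where r: "reads origin w y' p'" "reads y' [a] y q'" using reads_split by blast
    have y': "y' \<in> reachable" and y: "y \<in> reachable" using r(1) snoc.prems by (auto simp: reachable_def)
    obtain g where g: "g \<in> generate G T" "codes g (w @ inv_word (route y'))" using snoc.IH[OF r(1)] by blast
    obtain s where s: "reads origin (route y' @ [a] @ inv_word (route y)) origin s"
      using route[OF y'] r(2) home[OF y] reads_append by metis
    have "length (route y' @ [a] @ inv_word (route y)) \<le> 2 * D + 1" using D[OF y'] D[OF y] by simp
    from short[OF s this] obtain g' where g': "g' \<in> generate G T" "codes g' (route y' @ [a] @ inv_word (route y))" by blast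
    have "codes (g \<otimes> g') ((w @ inv_word (route y')) @ (route y' @ [a] @ inv_word (route y)))"
      by (rule codes_mult[OF g(2) g'(2)])
    then have "codes (g \<otimes> g') (w @ inv_word (route y') @ route y' @ ([a] @ inv_word (route y)))" by simp
    from codes_rewritable[OF this rewritable_inv_word] have "codes (g \<otimes> g') ((w @ [a]) @ inv_word (route y))" by simp
    then show ?case using generate.eng[OF g(1) g'(1)] by blast
  qed
  note gen = this
  have "g \<in> generate G T" if g: "g \<in> carrier G" for g
  proof -
    obtain w where w: "codes g w" using ex_normal_code[OF g] by blast
    then obtain e where e: "reads origin w origin e" by (auto simp: codes_def)
    obtain g1 where g1: "g1 \<in> generate G T" "codes g1 (w @ inv_word (route origin))" using gen[OF e] by blast
    obtain p where p: "reads origin (route origin) origin p" using route[OF o_reach] by blast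
    obtain g2 where g2: "g2 \<in> generate G T" "codes g2 (route origin)" using short[OF p] D[OF o_reach] by auto
    have "codes (g1 \<otimes> g2) (w @ inv_word (route origin) @ route origin @ [])" using codes_mult[OF g1(2) g2(2)] by simp
    from codes_rewritable[OF this rewritable_inv_word] have "codes (g1 \<otimes> g2) w" by simp
    then have "g = g1 \<otimes> g2" using w codes_element_unique by blast
    then show ?thesis using generate.eng[OF g1(1) g2(1)] by simp
  qed
  then have "generate G T = carrier G" using generate_incl[OF TG] by blast
  then show ?thesis using \<open>finite T\<close> TG unfolding finite_generating_set_def by blast
qed

subsection \<open>The automaton of normal words\<close>

text \<open>
  The automaton of the normal words that can be read from a vertex. Its state consists of the vertex
  that has been reached and the set of letters which must not follow.
\<close>

definition step :: "'a \<times> letter set \<Rightarrow> letter \<Rightarrow> ('a \<times> letter set) option" where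
  "step = (\<lambda>(x, F) a. if a \<in> F \<or> (\<nexists>\<alpha>. edge x a \<alpha>) then None
     else Some (pathfinish (THE \<alpha>. edge x a \<alpha>), forbid a F))"

lemma step_eq: "step (x, F) a = Some (y, F') \<longleftrightarrow> a \<notin> F \<and> F' = forbid a F \<and> (\<exists>\<alpha>. edge x a \<alpha> \<and> y = pathfinish \<alpha>)"
proof -
  have "(THE \<alpha>. edge x a \<alpha>) = \<alpha>" if "edge x a \<alpha>" for \<alpha> using that edge_unique by blast
  then show ?thesis unfolding step_def by auto
qed

lemma run_step_iff:
  assumes "x \<in> vertices"
  shows "run step (x, F) w = Some (y, F') \<longleftrightarrow> normal_from F w \<and> F' = fold forbid w F \<and> (\<exists>p. reads x w y p)"
  using assms
proof (induction w arbitrary: x F)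
  case Nil
  then show ?case by auto
next
  case (Cons a w)
  show ?case
  proof (cases "\<exists>\<alpha>. edge x a \<alpha>")
    case True
    then obtain \<alpha> where \<alpha>: "edge x a \<alpha>" by blast
    have r: "(\<exists>p. reads x (a # w) y p) \<longleftrightarrow> (\<exists>p. reads (pathfinish \<alpha>) w y p)"
    proof
      assume "\<exists>p. reads x (a # w) y p"
      then obtain \<beta> q where "edge x a \<beta>" "reads (pathfinish \<beta>) w y q" by auto
      then show "\<exists>p. reads (pathfinish \<alpha>) w y p" using edge_unique[OF \<alpha>] by blast
    qed (use reads_Cons[OF \<alpha>] in blast)
    show ?thesis
    proof (cases "a \<in> F")
      case True
      then have "step (x, F) a = None" by (simp add: step_def)
      then show ?thesis using True by simp
    next
      case False
      then have "step (x, F) a = Some (pathfinish \<alpha>, forbid a F)" using step_eq \<alpha> by blast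
      then have "run step (x, F) (a # w) = run step (pathfinish \<alpha>, forbid a F) w" by simp
      then show ?thesis unfolding r using Cons.IH[OF edge_path(4)[OF \<alpha>], of "forbid a F"] False by simp
    qed
  next
    case False
    then have "step (x, F) a = None" by (simp add: step_def)
    then show ?thesis using False by auto
  qed
qed

lemma origin_vertex: "origin \<in> vertices"
  using anchor_base(4) by simp

lemma forbid_letters: "a \<in> letters \<Longrightarrow> F \<subseteq> letters \<Longrightarrow> forbid a F \<subseteq> letters"
  using graph by (auto simp: forbid_def com_def inv_letter_def finite_simple_graph_def)

theorem growth_dichotomy: "exponential_growth G \<or> polynomial_growth G"
proof -
  obtain S0 where S0: "finite_generating_set G S0" using ex_finite_generating_set by blast
  let ?Q = "vertices \<times> Pow letters"
  have "finite ?Q" using finite_vertices[OF finite_cells] finite_letters by simp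
  moreover have "(origin, {}) \<in> ?Q" using origin_vertex by simp
  moreover have "r \<in> ?Q \<and> a \<in> letters" if q: "q \<in> ?Q" and st: "step q a = Some r" for q a r
  proof -
    obtain x F where q': "q = (x, F)" "F \<subseteq> letters" using q by auto
    obtain y F' where r': "r = (y, F')" by (cases r)
    obtain \<alpha> where \<alpha>: "edge x a \<alpha>" "y = pathfinish \<alpha>" "F' = forbid a F"
      using st unfolding q'(1) r' step_eq by blast
    have a: "a \<in> letters" using edge_path(5)[OF \<alpha>(1)] by (cases a) auto
    then show ?thesis using edge_path(4)[OF \<alpha>(1)] \<alpha> forbid_letters[OF a q'(2)] r' by simp
  qed
  ultimately consider
    (loops) "\<exists>t q u v. run step (origin, {}) t = Some q \<and> run step q u = Some q \<and> run step q v = Some q \<and>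
            length u = length v \<and> u \<noteq> v"
    | (poly) "\<exists>K d. \<forall>n. finite {w. length w \<le> n \<and> run step (origin, {}) w \<noteq> None} \<and>
            card {w. length w \<le> n \<and> run step (origin, {}) w \<noteq> None} \<le> K * (n + 1) ^ d"
    using automaton_dichotomy[of ?Q letters "(origin, {})" step] finite_letters by blast
  then show ?thesis
  proof cases
    case loops
    then obtain t q u v where run: "run step (origin, {}) t = Some q" "run step q u = Some q" "run step q v = Some q"
      and uv: "length u = length v" "u \<noteq> v" by blast
    obtain y F where q: "q = (y, F)" by (cases q)
    obtain pt where t: "reads origin t y pt" using run(1) run_step_iff[OF origin_vertex] unfolding q by blast
    then have y: "y \<in> vertices" using reads_path by blast
    obtain pu where u: "reads y u y pu" using run(2) run_step_iff[OF y] unfolding q by blast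
    obtain pv where v: "reads y v y pv" using run(3) run_step_iff[OF y] unfolding q by blast
    obtain pt' where t': "reads y (inv_word t) origin pt'" using reads_inverse[OF t] by blast
    have normal: "normal (t @ concat (map \<phi> ws))" if "\<And>x. \<phi> x \<in> {u, v}" for \<phi> :: "'g \<Rightarrow> letter list" and ws
    proof -
      have "run step q (concat (map \<phi> ws)) = Some q"
      proof (induction ws)
        case (Cons x ws)
        have "run step q (\<phi> x) = Some q" using that[of x] run by auto
        then show ?case using Cons by (simp add: run_append)
      qed simp
      then have "run step (origin, {}) (t @ concat (map \<phi> ws)) = Some q" using run(1) by (simp add: run_append)
      then show ?thesis using run_step_iff[OF origin_vertex] unfolding q by blast
    qed
    have same: "w = w'" if "codes g (w @ inv_word t)" "codes g (w' @ inv_word t)" "normal w" "normal w'" for g w w'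
    proof -
      have "acts (inv_word t) (acts w empty_stacks) = acts (inv_word t) (acts w' empty_stacks)"
        using codes_acts[OF that(1,2), of empty_stacks] by simp
      then have "acts w empty_stacks = acts w' empty_stacks" by (metis acts_inv_word')
      then show ?thesis using normal_unique that by blast
    qed
    obtain g where g: "codes g (t @ u @ inv_word t)" using reads_append t u t' ex_element by metis
    obtain k where k: "codes k (t @ v @ inv_word t)" using reads_append t v t' ex_element by metis
    have gk: "g \<in> carrier G" "k \<in> carrier G" using g k by (auto simp: codes_def)
    have "g \<noteq> k"
    proof
      assume "g = k"
      then have "t @ u = t @ v"
        using same[of g "t @ u" "t @ v"] normal[of "\<lambda>_. u" "[undefined]"] normal[of "\<lambda>_. v" "[undefined]"] g k by simp
      then show False using uv(2) by simp
    qed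
    \<comment> \<open>A product of factors \<open>g\<close> and \<open>k\<close> is described by \<open>t\<close>, a concatenation of loops \<open>u\<close> and \<open>v\<close>, and the way
      back. Without the way back this is a normal word, from which the factors can be recovered.\<close>
    define \<phi> where "\<phi> x = (if x = g then u else v)" for x
    have codes_word: "codes (word_value ws) (t @ concat (map \<phi> ws) @ inv_word t)" if "set ws \<subseteq> {g, k}" for ws
      using that
    proof (induction ws)
      case Nil
      have "reads origin [] origin (\<lambda>_. origin)" using origin_vertex by simp
      then obtain i where i: "codes i []" using ex_element by blast
      then have "codes (i \<otimes> i) []" using codes_mult[OF i i] by simp
      then have "i \<otimes> i = i" using i codes_element_unique by blast
      then have "i = \<one>" using i l_cancel_one by (auto simp: codes_def)
      obtain c where c: "codes c (t @ inv_word t)" using reads_append[OF t t'] ex_element by blast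
      then have "codes c []" using codes_rewritable rewritable_inv_word'[of "[]" t "[]"] by simp
      then have "c = \<one>" using i \<open>i = \<one>\<close> codes_element_unique by blast
      then show ?case using c by simp
    next
      case (Cons x ws)
      have x: "codes x (t @ \<phi> x @ inv_word t)" using Cons.prems g k \<open>g \<noteq> k\<close> by (auto simp: \<phi>_def)
      have "codes (x \<otimes> word_value ws) ((t @ \<phi> x @ inv_word t) @ (t @ concat (map \<phi> ws) @ inv_word t))"
        using codes_mult[OF x] Cons by simp
      then have "codes (x \<otimes> word_value ws) ((t @ \<phi> x) @ inv_word t @ t @ (concat (map \<phi> ws) @ inv_word t))" by simp
      from codes_rewritable[OF this rewritable_inv_word] show ?case by simp
    qed
    have "inj_on word_value {ws. length ws = n \<and> set ws \<subseteq> {g, k}}" for n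
    proof (rule inj_onI)
      fix ws ws' assume ws: "ws \<in> {ws. length ws = n \<and> set ws \<subseteq> {g, k}}" "ws' \<in> {ws. length ws = n \<and> set ws \<subseteq> {g, k}}"
        and eq: "word_value ws = word_value ws'"
      have "t @ concat (map \<phi> ws) = t @ concat (map \<phi> ws')"
        using same[of "word_value ws" "t @ concat (map \<phi> ws)" "t @ concat (map \<phi> ws')"]
          codes_word[of ws] codes_word[of ws'] ws eq normal[of \<phi>] by (simp add: \<phi>_def)
      then have "concat (map \<phi> ws) = concat (map \<phi> ws')" by simp
      moreover have "\<forall>(x, y)\<in>set (zip (map \<phi> ws) (map \<phi> ws')). length x = length y"
        using uv(1) by (auto simp: \<phi>_def zip_map_map)
      ultimately have "map \<phi> ws = map \<phi> ws'" using ws concat_eq_concat_iff[of "map \<phi> ws" "map \<phi> ws'"] by simp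
      moreover have "inj_on \<phi> (set ws \<union> set ws')"
        by (rule inj_on_subset[of _ "{g, k}"]) (use ws uv(2) \<open>g \<noteq> k\<close> in \<open>auto simp: \<phi>_def inj_on_def\<close>)
      ultimately show "ws = ws'" using map_inj_on by blast
    qed
    from free_products_imp_exponential[OF S0 gk \<open>g \<noteq> k\<close> this] show ?thesis ..
  next
    case poly
    then obtain K d where Kd: "\<And>n. finite {w. length w \<le> n \<and> run step (origin, {}) w \<noteq> None} \<and>
            card {w. length w \<le> n \<and> run step (origin, {}) w \<noteq> None} \<le> K * (n + 1) ^ d" by blast
    let ?L = "{w. run step (origin, {}) w \<noteq> None}"
    have "code ` carrier G \<subseteq> ?L"
    proof
      fix w assume "w \<in> code ` carrier G"
      then obtain g where "g \<in> carrier G" "w = code g" by blast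
      then obtain e where "reads origin w origin e" "normal w"
        using code unfolding codes_def by blast
      then have "run step (origin, {}) w = Some (origin, fold forbid w {})"
        using run_step_iff[OF origin_vertex] by blast
      then show "w \<in> ?L" by simp
    qed
    moreover have "{w \<in> ?L. length w \<le> n} = {w. length w \<le> n \<and> run step (origin, {}) w \<noteq> None}" for n by auto
    ultimately have "polynomial_growth G"
      using polynomially_many_codes_imp_polynomial[OF S0 code_inj _ code_length, of ?L K d] Kd by simp
    then show ?thesis ..
  qed
qed

end

theorem theorem7:
  fixes G :: "('g, 'm) monoid_scheme"
  assumes "special_cubulated_group TYPE('a::topological_space) G"
  shows "exponential_growth G \<or> polynomial_growth G"
proof -
  obtain X :: "'a set" and \<Phi> x where G: "group G" and sp: "special_cube_complex X \<Phi>" and X: "compact X" "x \<in> X"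
    and iso: "G \<cong> fundamental_group X x"
    using assms unfolding special_cubulated_group_def by (elim exE conjE) (rule that)
  obtain h where h: "h \<in> iso G (fundamental_group X x)" using iso unfolding is_iso_def by blast
  note sp' = sp[unfolded special_cube_complex_def]
  have cc: "cube_complex X \<Phi>"
    using conjunct1[OF sp'] unfolding nonpositively_curved_def by (rule conjunct1)
  obtain V E f where "finite_simple_graph V E"
    "local_isometry X \<Phi> (salvetti V E) (salvetti_cells V E) f"
    using conjunct2[OF sp'] by (elim exE conjE) (rule that)
  then interpret special_group X \<Phi> V E f G x h
    using G X h cc
    by (intro special_group.intro special_space.intro cubed_space.intro raag.intro
        special_space_axioms.intro special_group_axioms.intro)
  show ?thesis by (rule growth_dichotomy)
qed

end
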